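(* Consider a $p$-type Crump–Mode–Jagers branching process $(\mathcal{Z}_t^{\boldsymbol{\varphi}})_{t\ge0}$ counted with random characteristic $\boldsymbol{\varphi}=(\varphi^1,\dots,\varphi^p)^{\mathsf{T}}$. Suppose that the matrix $\boldsymbol{\mu}=(\mu^{i,j})_{i,j=1,\dots,p}$ of intensity measures consists of locally finite measures and is non-lattice. Let $\vartheta\in\mathbb{R}$ lie in the interior of $\mathcal{D}(\mathcal{L}\boldsymbol{\mu})$, suppose that the spectral radius of $\boldsymbol{\mu}(0)=(\mu^{i,j}(\{0\}))_{i,j}$ is strictly smaller than $1$, and suppose that $$\sup_{\eta\in\mathbb{R}}\big\|(\mathbf{I}_p-\mathcal{L}\boldsymbol{\mu}(\vartheta+\mathrm{i}\eta))^{-1}\big\|<\infty$$ (in particular, all these inverses exist). Further, suppose that $\Lambda_\vartheta$ is finite. Assume that $f(t)=(\mathbf{E}^1[\varphi^1(t)],\dots,\mathbf{E}^p[\varphi^p(t)])^{\mathsf{T}}$ vanishes on the negative half-line, is finite for every $t\ge0$ and is right-continuous with existing left limits as a function of $t$. Further, suppose that (componentwise) $$\int_0^\infty e^{-\theta x}\,\mathrm{V}\!f(x)\,\mathrm{d}x<\infty$$ for some $\theta>\vartheta$ with $\Lambda_\vartheta=\Lambda_\theta$. Then there exist matrices $B_{\lambda,k}\in\mathbb{C}^{p\times p}$ and vectors $b_{\lambda,k}\in\mathbb{C}^p$, $k=0,\dots,\mathtt{k}(\lambda)-1$, $\lambda\in\Lambda_\vartheta$, such that, for $F(t)=(\mathbf{E}^1[\mathcal{Z}_t^{\boldsymbol{\varphi}}],\dots,\mathbf{E}^p[\mathcal{Z}_t^{\boldsymbol{\varphi}}])^{\mathsf{T}}$,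 as $t\to\infty$, $$F(t)=\sum_{\lambda\in\Lambda_\theta}e^{\lambda t}\sum_{k=0}^{\mathtt{k}(\lambda)-1}B_{\lambda,k}\int_0^tf(x)(t-x)^ke^{-\lambda x}\,\mathrm{d}x+O(e^{\theta t})$$ and $$F(t)=\sum_{\lambda\in\Lambda_\theta}e^{\lambda t}\sum_{k=0}^{\mathtt{k}(\lambda)-1}t^kb_{\lambda,k}+O(e^{(\theta+\varepsilon)t}),$$ where the error bounds are to be read component by component and $\varepsilon>0$ can be chosen arbitrarily small, in particular such that $\theta+\varepsilon<\mathrm{Re}(\lambda)$ for every $\lambda\in\Lambda_\theta$.
   Context: The branching process: there are $p\in\mathbb{N}$ types. The process starts with one ancestor $\varnothing$ born at time $S(\varnothing)=0$ with type $\tau(\varnothing)\in\{1,\dots,p\}$. Individuals are labelled by $u\in\mathcal{I}=\bigcup_{n\ge0}\mathbb{N}^n$, with $|u|=n$ for $u\in\mathbb{N}^n$. The $\boldsymbol{\xi}_u=(\xi_u^{i,j})_{i,j}$ are i.i.d. copies of a $p\times p$ matrix $\boldsymbol{\xi}$ of point processes (random locally finite point measures) on $[0,\infty)$, independent of $\tau(\varnothing)$. An individual $u$ of type $i$ born at time $S(u)$ produces children of type $j$ at the times $S(u)+x$, $x$ ranging over the points of $\xi_u^{i,j}$, $j=1,\dots,p$ (with multiplicity). $\tau(u)$ is the type of $u$, $\mathcal{T}\subseteq\mathcal{I}$ is the set of individuals ever born, and $\mathbf{E}^i$ denotes expectation when $\tau(\varnothing)=i$. The intensity measures are $\mu^{i,j}(\cdot)=\mathbf{E}[\xi^{i,j}(\cdot)]$.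 Characteristics: for each $u\in\mathcal{I}$ there are a random lifetime vector $\boldsymbol{\zeta}_u\in[0,\infty]^p$ and a product-measurable, separable random function $\boldsymbol{\varphi}_u=(\varphi_u^1,\dots,\varphi_u^p)^{\mathsf{T}}:\Omega\times\mathbb{R}\to\mathbb{R}^p$ such that the $(\boldsymbol{\xi}_u,\boldsymbol{\zeta}_u)$, $u\in\mathcal{I}$, are i.i.d., the $\boldsymbol{\varphi}_u$, $u\in\mathcal{I}$, are identically distributed (with the law of $\boldsymbol{\varphi}$), and for every $n\in\mathbb{N}$ the $\boldsymbol{\varphi}_u$, $u\in\mathbb{N}^n$, are independent and independent of $(\boldsymbol{\xi}_u,\boldsymbol{\zeta}_u,\boldsymbol{\varphi}_u)$, $|u|<n$. For $u\in\mathcal{T}$ put $\varphi_u(t)=\varphi_u^{\tau(u)}(t)$, and $$\mathcal{Z}_t^{\boldsymbol{\varphi}}=\sum_{u\in\mathcal{T}}\varphi_u(t-S(u)),\quad t\in\mathbb{R}.$$ $\mathbf{I}_p$ is the $p\times p$ identity matrix; $\|\cdot\|$ is a matrix norm on $\mathbb{C}^{p\times p}$. $\mathcal{L}\boldsymbol{\mu}(z)=(\mathcal{L}\mu^{i,j}(z))_{i,j}$ with $\mathcal{L}\mu^{i,j}(z)=\int_{[0,\infty)} e^{-zx}\,\mu^{i,j}(\mathrm{d}x)$, and $$\mathcal{D}(\mathcal{L}\boldsymbol{\mu})=\Big\{z\in\mathbb{C}:\int e^{-\mathrm{Re}(z)x}\,\mu^{i,j}(\mathrm{d}x)<\infty\text{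 for all }i,j\Big\}.$$ Non-lattice: for all $h>0$ and all $h_1,\dots,h_p\in[0,h)$ there exist $i,j$ with $\mu^{i,j}\big((h_j-h_i+h\mathbb{Z})^{\mathsf{c}}\big)>0$. Roots: $\Lambda=\{\lambda\in\mathcal{D}(\mathcal{L}\boldsymbol{\mu}):\det(\mathbf{I}_p-\mathcal{L}\boldsymbol{\mu}(\lambda))=0\}$ and, for $\theta\in\mathbb{R}$, $\Lambda_\theta=\{\lambda\in\Lambda:\mathrm{Re}(\lambda)>\theta\}$. For $\lambda\in\Lambda$, $\mathtt{k}(\lambda)\in\mathbb{N}=\{1,2,\dots\}$ is the smallest natural number such that all entries of $(z-\lambda)^{\mathtt{k}(\lambda)}(\mathbf{I}_p-\mathcal{L}\boldsymbol{\mu}(z))^{-1}$ are holomorphic in some neighborhood of $\lambda$. Total variation function: for $g:\mathbb{R}\to\mathbb{R}$, $$\mathrm{V}\!g(x)=\sup\Big\{\sum_{j=1}^n|g(x_j)-g(x_{j-1})|:-\infty<x_0<\dots<x_n\le x,\ n\in\mathbb{N}\Big\},$$ and $\mathrm{V}\!f=(\mathrm{V}\!f_1,\dots,\mathrm{V}\!f_p)^{\mathsf{T}}$.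
   Formalization: Added: for t≥0 the sum defining Z_t converges unconditionally in L^1 (otherwise Z_t or its mean may be undefined), and each φ_u is product-measurable for the same sigma-algebra in which its independence holds (coordinate independence alone does not suffice). *)

theory Defs
  imports "HOL-Probability.Probability" "HOL-Library.Landau_Symbols"
begin

section \<open>Point processes\<close>

text \<open>Locally finite point measures on $[0,\infty)$, realised as Borel measures on the real line
  that do not charge the negative half-line.\<close>

definition locally_finite_point_measure :: "real measure \<Rightarrow> bool" where
  "locally_finite_point_measure \<nu> \<longleftrightarrow>
     sets \<nu> = sets borel \<and>
     emeasure \<nu> {..<0} = 0 \<and>
     (\<forall>A\<in>sets borel. emeasure \<nu> A = \<infinity> \<or> (\<exists>n::nat. emeasure \<nu> A = of_nat n)) \<and>
     (\<forall>t. emeasure \<nu> {0..t} < \<infinity>)"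

text \<open>The sigma-algebra on point measures is generated by the evaluations
  \<open>\<nu> \<mapsto> \<nu> A\<close> (compare \<^const>\<open>subprob_algebra\<close>); a point process is a random
  element of this space.\<close>

definition point_measure_algebra :: "real measure measure" where
  "point_measure_algebra =
     (SUP A \<in> sets (borel :: real measure).
        vimage_algebra {\<nu>. locally_finite_point_measure \<nu>} (\<lambda>\<nu>. emeasure \<nu> A) borel)"

definition repro_algebra :: "('p::finite \<Rightarrow> 'p \<Rightarrow> real measure) measure" where
  "repro_algebra = (\<Pi>\<^sub>M i\<in>UNIV. \<Pi>\<^sub>M j\<in>UNIV. point_measure_algebra)"

definition lifetime_algebra :: "('p::finite \<Rightarrow> ennreal) measure" where
  "lifetime_algebra = (\<Pi>\<^sub>M i\<in>UNIV. borel)"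

definition path_algebra :: "(real \<Rightarrow> real ^ 'p::finite) measure" where
  "path_algebra = (\<Pi>\<^sub>M t\<in>UNIV. borel)"

definition intensity ::
  "'a measure \<Rightarrow> ('a \<Rightarrow> 'p \<Rightarrow> 'p \<Rightarrow> real measure) \<Rightarrow> 'p \<Rightarrow> 'p \<Rightarrow> real measure" where
  "intensity M \<xi> i j = measure_of UNIV (sets borel) (\<lambda>A. \<integral>\<^sup>+\<omega>. emeasure (\<xi> \<omega> i j) A \<partial>M)"

lemma measurable_emeasure_point_measure_algebra:
  assumes "A \<in> sets borel"
  shows "(\<lambda>\<nu>. emeasure \<nu> A) \<in> borel_measurable point_measure_algebra"
  using assms
  by (auto intro!: measurable_Sup1 measurable_vimage_algebra1 simp: point_measure_algebra_def)

lemma space_point_measure_algebra: "space point_measure_algebra = {\<nu>. locally_finite_point_measure \<nu>}"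
  by (auto simp add: point_measure_algebra_def space_Sup_eq_UN)

lemma emeasure_intensity:
  assumes "\<xi> \<in> measurable M repro_algebra" "A \<in> sets borel"
  shows "emeasure (intensity M \<xi> i j) A = (\<integral>\<^sup>+\<omega>. emeasure (\<xi> \<omega> i j) A \<partial>M)"
proof -
  have m: "(\<lambda>\<omega>. \<xi> \<omega> i j) \<in> measurable M point_measure_algebra"
  proof -
    have "(\<lambda>x. x i) \<in> measurable repro_algebra (\<Pi>\<^sub>M j\<in>UNIV. point_measure_algebra)"
      unfolding repro_algebra_def by (rule measurable_component_singleton) simp
    moreover have "(\<lambda>x. x j) \<in> measurable (\<Pi>\<^sub>M j\<in>UNIV. point_measure_algebra) point_measure_algebra"
      by (rule measurable_component_singleton) simp
    ultimately show ?thesis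
      using measurable_compose[OF measurable_compose[OF assms(1)]] by blast
  qed
  have pm: "sets (\<xi> \<omega> i j) = sets borel" if "\<omega> \<in> space M" for \<omega>
    using measurable_space[OF m that] by (simp add: space_point_measure_algebra locally_finite_point_measure_def)
  have me: "(\<lambda>\<omega>. emeasure (\<xi> \<omega> i j) B) \<in> borel_measurable M" if "B \<in> sets borel" for B
    by (rule measurable_compose[OF m measurable_emeasure_point_measure_algebra[OF that]])
  show ?thesis unfolding intensity_def
  proof (rule emeasure_measure_of_sigma)
    show "sigma_algebra UNIV (sets (borel :: real measure))"
      using sets.sigma_algebra_axioms[of "borel :: real measure"] by simp
    show "positive (sets borel) (\<lambda>A. \<integral>\<^sup>+\<omega>. emeasure (\<xi> \<omega> i j) A \<partial>M)"
      by (simp add: positive_def)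
    show "countably_additive (sets borel) (\<lambda>A. \<integral>\<^sup>+\<omega>. emeasure (\<xi> \<omega> i j) A \<partial>M)"
    proof (rule countably_additiveI)
      fix B :: "nat \<Rightarrow> real set"
      assume B: "range B \<subseteq> sets borel" "disjoint_family B" "\<Union> (range B) \<in> sets borel"
      have "(\<Sum>n. \<integral>\<^sup>+\<omega>. emeasure (\<xi> \<omega> i j) (B n) \<partial>M)
              = (\<integral>\<^sup>+\<omega>. (\<Sum>n. emeasure (\<xi> \<omega> i j) (B n)) \<partial>M)"
        by (rule nn_integral_suminf[symmetric]) (use B me in auto)
      also have "\<dots> = (\<integral>\<^sup>+\<omega>. emeasure (\<xi> \<omega> i j) (\<Union> (range B)) \<partial>M)"
        by (rule nn_integral_cong, rule suminf_emeasure) (use B pm in auto)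
      finally show "(\<Sum>n. \<integral>\<^sup>+\<omega>. emeasure (\<xi> \<omega> i j) (B n) \<partial>M)
          = (\<integral>\<^sup>+\<omega>. emeasure (\<xi> \<omega> i j) (\<Union> (range B)) \<partial>M)" .
    qed
  qed (fact assms(2))
qed

section \<open>The branching process\<close>

text \<open>Separability in the sense of Doob, relative to the closed sets.\<close>

definition separable_process ::
  "'a measure \<Rightarrow> ('a \<Rightarrow> real \<Rightarrow> 'b::topological_space) \<Rightarrow> bool" where
  "separable_process M X \<longleftrightarrow>
     (\<exists>D N. countable D \<and> closure D = UNIV \<and> N \<in> null_sets M \<and>
        (\<forall>\<omega>\<in>space M - N. \<forall>a b C. closed C \<longrightarrow>
           (\<forall>s\<in>D \<inter> {a<..<b}. X \<omega> s \<in> C) \<longrightarrow> (\<forall>s\<in>{a<..<b}. X \<omega> s \<in> C)))"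

text \<open>The information carried by the reproduction processes of the generations before \<open>n\<close>.\<close>

definition repro_past ::
  "'a measure \<Rightarrow> (nat list \<Rightarrow> 'a \<Rightarrow> 'p::finite \<Rightarrow> 'p \<Rightarrow> real measure) \<Rightarrow> nat \<Rightarrow> 'a measure" where
  "repro_past M \<xi> n =
     vimage_algebra (space M) (\<lambda>\<omega>. \<lambda>v\<in>{v. length v < n}. \<xi> v \<omega>)
       (\<Pi>\<^sub>M v\<in>{v. length v < n}. repro_algebra)"

definition full_past ::
  "'a measure \<Rightarrow> (nat list \<Rightarrow> 'a \<Rightarrow> 'p::finite \<Rightarrow> 'p \<Rightarrow> real measure) \<Rightarrow>
   (nat list \<Rightarrow> 'a \<Rightarrow> 'p \<Rightarrow> ennreal) \<Rightarrow> (nat list \<Rightarrow> 'a \<Rightarrow> real \<Rightarrow> real ^ 'p) \<Rightarrow> nat \<Rightarrow> 'a measure" where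
  "full_past M \<xi> \<zeta> \<phi> n =
     vimage_algebra (space M) (\<lambda>\<omega>. \<lambda>v\<in>{v. length v < n}. (\<xi> v \<omega>, \<zeta> v \<omega>, \<phi> v \<omega>))
       (\<Pi>\<^sub>M v\<in>{v. length v < n}. repro_algebra \<Otimes>\<^sub>M lifetime_algebra \<Otimes>\<^sub>M path_algebra)"

text \<open>
  Individuals are lists of natural numbers, \<open>[]\<close> is the ancestor and \<open>u @ [k]\<close> a child
  of \<open>u\<close>.

  The ancestor's type is a parameter \<open>i\<close> of the construction (the input \<open>\<xi>, \<zeta>, \<phi>\<close> does
  not depend on it), so that the expectation $\mathbf{E}^i$ of a functional of the process is the
  expectation of its version with parameter \<open>i\<close>: \<open>\<T> i \<omega>\<close> is the set of individuals
  ever born, \<open>S i u\<close> and \<open>\<tau> i u\<close> are the birth time and type of \<open>u\<close> (irrelevant when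
  \<open>u\<close> is never born).

  The numbering of the children of an individual is left open (by birth order, separately for
  each type, ...); \<open>reproduction\<close> states only that the children of type \<open>j\<close> of \<open>u\<close> are born at
  the points of \<open>\<xi> u \<omega> (\<tau> u) j\<close> shifted by \<open>S u\<close>, with multiplicity.  The
  \<open>adapted\<close> assumptions say that the numbering uses the reproduction processes of earlier
  generations only, as it does whenever it is read off from the point processes of the ancestors.

  Concerning \<open>characteristic\<close>: \<open>\<G> u\<close> is the sigma-algebra in which the random
  function \<open>\<phi> u\<close> is observed.  Being product measurable and being independent refer to the
  same sigma-algebra; for instance \<open>\<G> u\<close> is generated by \<open>(\<xi> u, \<zeta> u)\<close> if \<open>\<phi> u\<close> is a
  product-measurable function of that pair.  Independence of the coordinates \<open>\<phi> u s\<close> alone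
  would not do: one could alter \<open>\<phi> u s\<close> at the random point \<open>s = t - S u\<close>, without
  losing joint measurability or separability and without changing any finite-dimensional law.\<close>

locale cmj_process = prob_space M
  for M :: "'a measure" +
  fixes \<xi> :: "nat list \<Rightarrow> 'a \<Rightarrow> 'p::finite \<Rightarrow> 'p \<Rightarrow> real measure"
    and \<zeta> :: "nat list \<Rightarrow> 'a \<Rightarrow> 'p \<Rightarrow> ennreal"
    and \<phi> :: "nat list \<Rightarrow> 'a \<Rightarrow> real \<Rightarrow> real ^ 'p"
    and \<T> :: "'p \<Rightarrow> 'a \<Rightarrow> nat list set"
    and S :: "'p \<Rightarrow> nat list \<Rightarrow> 'a \<Rightarrow> real"
    and \<tau> :: "'p \<Rightarrow> nat list \<Rightarrow> 'a \<Rightarrow> 'p"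
  assumes repro_indep:
      "indep_vars (\<lambda>_. repro_algebra \<Otimes>\<^sub>M lifetime_algebra) (\<lambda>u \<omega>. (\<xi> u \<omega>, \<zeta> u \<omega>)) UNIV"
    and repro_ident:
      "distr M (repro_algebra \<Otimes>\<^sub>M lifetime_algebra) (\<lambda>\<omega>. (\<xi> u \<omega>, \<zeta> u \<omega>)) =
       distr M (repro_algebra \<Otimes>\<^sub>M lifetime_algebra) (\<lambda>\<omega>. (\<xi> [] \<omega>, \<zeta> [] \<omega>))"
    and separable: "separable_process M (\<phi> u)"
    and phi_ident: "distr M path_algebra (\<phi> u) = distr M path_algebra (\<phi> [])"
    and characteristic:
      "\<exists>\<G>. (\<forall>u. subalgebra M (\<G> u) \<and>
                case_prod (\<phi> u) \<in> borel_measurable (\<G> u \<Otimes>\<^sub>M (borel :: real measure))) \<and>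
            (\<forall>n. indep_sets
                (\<lambda>w. case w of None \<Rightarrow> sets (full_past M \<xi> \<zeta> \<phi> n) | Some u \<Rightarrow> sets (\<G> u))
                (insert None (Some ` {u. length u = n})))"
    and ancestor: "\<omega> \<in> space M \<Longrightarrow> [] \<in> \<T> i \<omega>" "\<omega> \<in> space M \<Longrightarrow> S i [] \<omega> = 0"
      "\<omega> \<in> space M \<Longrightarrow> \<tau> i [] \<omega> = i"
    and parent: "\<omega> \<in> space M \<Longrightarrow> u @ [k] \<in> \<T> i \<omega> \<Longrightarrow> u \<in> \<T> i \<omega>"
    and reproduction:
      "\<omega> \<in> space M \<Longrightarrow> u \<in> \<T> i \<omega> \<Longrightarrow> A \<in> sets borel \<Longrightarrow>
         emeasure (count_space UNIV)
           {k. u @ [k] \<in> \<T> i \<omega> \<and> \<tau> i (u @ [k]) \<omega> = j \<and> S i (u @ [k]) \<omega> - S i u \<omega> \<in> A} =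
         emeasure (\<xi> u \<omega> (\<tau> i u \<omega>) j) A"
    and adapted: "{\<omega> \<in> space M. u \<in> \<T> i \<omega>} \<in> sets (repro_past M \<xi> (length u))"
      "S i u \<in> borel_measurable (repro_past M \<xi> (length u))"
      "\<tau> i u \<in> measurable (repro_past M \<xi> (length u)) (count_space UNIV)"

text \<open>The summand of \<open>u\<close> in the process counted with the characteristic \<open>\<phi>\<close>.\<close>

definition contribution ::
  "(nat list \<Rightarrow> 'a \<Rightarrow> real \<Rightarrow> real ^ 'p::finite) \<Rightarrow> ('p \<Rightarrow> 'a \<Rightarrow> nat list set) \<Rightarrow>
   ('p \<Rightarrow> nat list \<Rightarrow> 'a \<Rightarrow> real) \<Rightarrow> ('p \<Rightarrow> nat list \<Rightarrow> 'a \<Rightarrow> 'p) \<Rightarrow>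
   'p \<Rightarrow> real \<Rightarrow> nat list \<Rightarrow> 'a \<Rightarrow> real" where
  "contribution \<phi> \<T> S \<tau> i t u \<omega> =
     (if u \<in> \<T> i \<omega> then \<phi> u \<omega> (t - S i u \<omega>) $ \<tau> i u \<omega> else 0)"

text \<open>Unconditional summation in $L^1$.  The sum over all individuals ever born may be infinite
  (characteristics are allowed not to vanish at negative times), and is understood in this sense.
  It covers the pointwise, absolutely convergent sum as soon as the sum of the absolute values is
  integrable.\<close>

definition has_L1_sum :: "'a measure \<Rightarrow> ('i \<Rightarrow> 'a \<Rightarrow> real) \<Rightarrow> ('a \<Rightarrow> real) \<Rightarrow> bool" where
  "has_L1_sum M X Z \<longleftrightarrow>
     integrable M Z \<and> (\<forall>u. integrable M (X u)) \<and>
     ((\<lambda>A. \<integral>\<omega>. \<bar>Z \<omega> - (\<Sum>u\<in>A. X u \<omega>)\<bar> \<partial>M) \<longlongrightarrow> 0) (finite_subsets_at_top UNIV)"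

lemma has_L1_sum_infsum:
  fixes X :: "'i::countable \<Rightarrow> 'a \<Rightarrow> real"
  assumes M: "sigma_finite_measure M"
    and X: "\<And>u. X u \<in> borel_measurable M"
    and fin: "(\<integral>\<^sup>+\<omega>. (\<integral>\<^sup>+u. ennreal \<bar>X u \<omega>\<bar> \<partial>count_space UNIV) \<partial>M) < \<infinity>"
  shows "has_L1_sum M X (\<lambda>\<omega>. \<Sum>\<^sub>\<infinity>u. X u \<omega>)"
proof -
  let ?N = "count_space (UNIV :: 'i set)"
  interpret M: sigma_finite_measure M by fact
  interpret N: sigma_finite_measure ?N
    by (rule sigma_finite_measure_count_space_countable) simp
  interpret P: pair_sigma_finite M ?N ..
  define h where "h = (\<lambda>(\<omega>, u). X u \<omega>)"
  have "(\<lambda>(u, \<omega>). X u \<omega>) \<in> borel_measurable (?N \<Otimes>\<^sub>M M)"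
    by (rule measurable_pair_measure_countable1) (auto simp: X)
  from measurable_compose[OF measurable_pair_swap' this]
  have h[measurable]: "h \<in> borel_measurable (M \<Otimes>\<^sub>M ?N)"
    by (simp add: h_def case_prod_beta)
  have ih: "integrable (M \<Otimes>\<^sub>M ?N) h"
  proof (rule integrableI_bounded)
    have "(\<integral>\<^sup>+x. ennreal (norm (h x)) \<partial>(M \<Otimes>\<^sub>M ?N)) =
        (\<integral>\<^sup>+\<omega>. \<integral>\<^sup>+u. ennreal (norm (h (\<omega>, u))) \<partial>?N \<partial>M)"
      by (rule N.nn_integral_fst[symmetric]) measurable
    with fin show "(\<integral>\<^sup>+x. ennreal (norm (h x)) \<partial>(M \<Otimes>\<^sub>M ?N)) < \<infinity>"
      by (simp add: h_def)
  qed (fact h)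
  have ah: "integrable (M \<Otimes>\<^sub>M ?N) (\<lambda>x. \<bar>h x\<bar>)"
    using ih by simp
  have infsum_eq: "(\<Sum>\<^sub>\<infinity>u. X u \<omega>) = (LINT u|?N. X u \<omega>)" for \<omega>
  proof (cases "integrable ?N (\<lambda>u. X u \<omega>)")
    case True
    then show ?thesis
      by (metis Infinite_Set_Sum.abs_summable_on_def infsetsum_def infsetsum_infsum)
  next
    case False
    then have "\<not> (\<lambda>u. X u \<omega>) summable_on UNIV"
      by (metis Infinite_Set_Sum.abs_summable_on_def abs_summable_equivalent
          summable_on_iff_abs_summable_on_real)
    with False show ?thesis
      by (simp add: infsum_not_exists not_integrable_integral_eq)
  qed
  have iZ: "integrable M (\<lambda>\<omega>. LINT u|?N. X u \<omega>)"
    using P.integrable_fst'[OF ih] by (simp add: h_def)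
  have AEi: "AE \<omega> in M. integrable ?N (\<lambda>u. X u \<omega>)"
    using P.AE_integrable_fst'[OF ih] by (simp add: h_def)
  have iX: "integrable M (X u)" for u
  proof (rule integrableI_bounded[OF X])
    have "(\<integral>\<^sup>+\<omega>. ennreal (norm (X u \<omega>)) \<partial>M) \<le> (\<integral>\<^sup>+\<omega>. (\<integral>\<^sup>+u. ennreal \<bar>X u \<omega>\<bar> \<partial>?N) \<partial>M)"
    proof (rule nn_integral_mono)
      fix \<omega>
      show "ennreal (norm (X u \<omega>)) \<le> (\<integral>\<^sup>+u. ennreal \<bar>X u \<omega>\<bar> \<partial>?N)"
        using nn_integral_ge_point[of u UNIV "\<lambda>u. ennreal \<bar>X u \<omega>\<bar>"] by simp
    qed
    then show "(\<integral>\<^sup>+\<omega>. ennreal (norm (X u \<omega>)) \<partial>M) < \<infinity>"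
      using fin by (simp add: order_le_less_trans)
  qed
  define c where "c u = (LINT \<omega>|M. \<bar>X u \<omega>\<bar>)" for u
  have ic: "integrable ?N c"
    using P.integrable_snd[of "\<lambda>\<omega> u. \<bar>X u \<omega>\<bar>"] ah
    by (simp add: c_def[abs_def] h_def case_prod_beta')
  have cs: "c summable_on UNIV" "infsum c UNIV = integral\<^sup>L ?N c"
  proof -
    have a: "Infinite_Set_Sum.abs_summable_on c UNIV"
      using ic by (simp add: Infinite_Set_Sum.abs_summable_on_def)
    then show "c summable_on UNIV"
      using abs_summable_equivalent summable_on_iff_abs_summable_on_real by blast
    show "infsum c UNIV = integral\<^sup>L ?N c"
      using infsetsum_infsum[OF a] by (simp add: infsetsum_def)
  qed
  have fs: "(LINT u|?N. g u * indicator A u) = (\<Sum>u\<in>A. g u)"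
    "integrable ?N (\<lambda>u. g u * indicator A u)" if "finite A" for A and g :: "'i \<Rightarrow> real"
  proof -
    show "(LINT u|?N. g u * indicator A u) = (\<Sum>u\<in>A. g u)"
      using that by (subst lebesgue_integral_count_space_finite_support)
        (auto simp: indicator_def intro!: sum.mono_neutral_cong_left)
    show "integrable ?N (\<lambda>u. g u * indicator A u)"
      using abs_summable_on_finite[OF that, of g] abs_summable_on_altdef'[of A UNIV g]
      by (simp add: set_integrable_def mult.commute)
  qed
  have bound: "(LINT \<omega>|M. \<bar>(\<Sum>\<^sub>\<infinity>u. X u \<omega>) - (\<Sum>u\<in>A. X u \<omega>)\<bar>) \<le> infsum c UNIV - sum c A"
    if A: "finite A" for A
  proof -
    have iA: "integrable (M \<Otimes>\<^sub>M ?N) (\<lambda>x. \<bar>h x\<bar> * indicator (- A) (snd x))"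
      by (rule Bochner_Integration.integrable_bound[OF ah]) (auto simp: indicator_def)
    have "(LINT \<omega>|M. \<bar>(\<Sum>\<^sub>\<infinity>u. X u \<omega>) - (\<Sum>u\<in>A. X u \<omega>)\<bar>)
        \<le> (LINT \<omega>|M. LINT u|?N. \<bar>X u \<omega>\<bar> * indicator (- A) u)"
    proof (rule integral_mono_AE)
      show "integrable M (\<lambda>\<omega>. \<bar>(\<Sum>\<^sub>\<infinity>u. X u \<omega>) - (\<Sum>u\<in>A. X u \<omega>)\<bar>)"
        using iZ iX by (simp add: infsum_eq)
      show "integrable M (\<lambda>\<omega>. LINT u|?N. \<bar>X u \<omega>\<bar> * indicator (- A) u)"
        using P.integrable_fst'[OF iA] by (simp add: h_def)
      show "AE \<omega> in M. \<bar>(\<Sum>\<^sub>\<infinity>u. X u \<omega>) - (\<Sum>u\<in>A. X u \<omega>)\<bar>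
          \<le> (LINT u|?N. \<bar>X u \<omega>\<bar> * indicator (- A) u)"
        using AEi
      proof eventually_elim
        case (elim \<omega>)
        have "(\<Sum>\<^sub>\<infinity>u. X u \<omega>) - (\<Sum>u\<in>A. X u \<omega>)
            = (LINT u|?N. X u \<omega> - X u \<omega> * indicator A u)"
          using elim fs[OF A, of "\<lambda>u. X u \<omega>"] by (simp add: infsum_eq)
        also have "\<dots> = (LINT u|?N. X u \<omega> * indicator (- A) u)"
          by (intro Bochner_Integration.integral_cong) (auto simp: indicator_def)
        also have "\<bar>\<dots>\<bar> \<le> (LINT u|?N. \<bar>X u \<omega> * indicator (- A) u\<bar>)"
          by (rule integral_abs_bound)
        also have "\<dots> = (LINT u|?N. \<bar>X u \<omega>\<bar> * indicator (- A) u)"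
          by (intro Bochner_Integration.integral_cong) (auto simp: indicator_def)
        finally show ?case .
      qed
    qed
    also have "\<dots> = (LINT u|?N. LINT \<omega>|M. \<bar>X u \<omega>\<bar> * indicator (- A) u)"
      using P.Fubini_integral[of "\<lambda>\<omega> u. \<bar>X u \<omega>\<bar> * indicator (- A) u"] iA
      by (simp add: h_def case_prod_beta')
    also have "\<dots> = (LINT u|?N. c u - c u * indicator A u)"
      by (intro Bochner_Integration.integral_cong) (auto simp: indicator_def c_def)
    also have "\<dots> = infsum c UNIV - sum c A"
      using ic fs[OF A, of c] by (simp add: cs)
    finally show ?thesis .
  qed
  have lim: "((\<lambda>A. infsum c UNIV - sum c A) \<longlongrightarrow> infsum c UNIV - infsum c UNIV)
      (finite_subsets_at_top UNIV)"
    by (intro tendsto_diff tendsto_const infsum_tendsto cs)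
  have "((\<lambda>A. LINT \<omega>|M. \<bar>(\<Sum>\<^sub>\<infinity>u. X u \<omega>) - (\<Sum>u\<in>A. X u \<omega>)\<bar>) \<longlongrightarrow> 0)
      (finite_subsets_at_top UNIV)"
  proof (rule tendsto_sandwich[OF _ _ tendsto_const])
    show "\<forall>\<^sub>F A in finite_subsets_at_top UNIV.
        0 \<le> (LINT \<omega>|M. \<bar>(\<Sum>\<^sub>\<infinity>u. X u \<omega>) - (\<Sum>u\<in>A. X u \<omega>)\<bar>)"
      by (rule always_eventually) simp
    show "\<forall>\<^sub>F A in finite_subsets_at_top UNIV.
        (LINT \<omega>|M. \<bar>(\<Sum>\<^sub>\<infinity>u. X u \<omega>) - (\<Sum>u\<in>A. X u \<omega>)\<bar>) \<le> infsum c UNIV - sum c A"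
      by (rule eventually_finite_subsets_at_top_weakI) (rule bound)
  qed (use lim in simp)
  with iZ iX show ?thesis
    by (simp add: has_L1_sum_def infsum_eq)
qed

section \<open>Analytic notions\<close>

text \<open>Values are extended nonnegative reals, so that functions of infinite variation are allowed.\<close>

definition total_variation :: "(real \<Rightarrow> real) \<Rightarrow> real \<Rightarrow> ennreal" where
  "total_variation g x =
     (SUP (n, s) \<in> {(n :: nat, s :: nat \<Rightarrow> real). n \<ge> 1 \<and> (\<forall>j<n. s j < s (Suc j)) \<and> s n \<le> x}.
        ennreal (\<Sum>j=1..n. \<bar>g (s j) - g (s (j - 1))\<bar>))"

definition cspectral_radius :: "complex ^ 'n ^ 'n::finite \<Rightarrow> real" where
  "cspectral_radius A = Max (cmod ` {c. \<exists>v. v \<noteq> 0 \<and> A *v v = c *s v})"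

definition laplace_domain :: "('p::finite \<Rightarrow> 'p \<Rightarrow> real measure) \<Rightarrow> complex set" where
  "laplace_domain \<mu> = {z. \<forall>i j. (\<integral>\<^sup>+x. ennreal (exp (- Re z * x)) \<partial>\<mu> i j) < \<infinity>}"

definition laplace :: "('p::finite \<Rightarrow> 'p \<Rightarrow> real measure) \<Rightarrow> complex \<Rightarrow> complex ^ 'p ^ 'p" where
  "laplace \<mu> z = (\<chi> i j. LINT x:{0..}|\<mu> i j. exp (- z * complex_of_real x))"

definition non_lattice :: "('p::finite \<Rightarrow> 'p \<Rightarrow> real measure) \<Rightarrow> bool" where
  "non_lattice \<mu> \<longleftrightarrow>
     (\<forall>h>0. \<forall>g :: 'p \<Rightarrow> real. (\<forall>i. 0 \<le> g i \<and> g i < h) \<longrightarrow>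
        (\<exists>i j. emeasure (\<mu> i j) (- {g j - g i + h * of_int m | m. True}) > 0))"

definition roots :: "('p::finite \<Rightarrow> 'p \<Rightarrow> real measure) \<Rightarrow> complex set" where
  "roots \<mu> = {z \<in> laplace_domain \<mu>. det (mat 1 - laplace \<mu> z) = 0}"

definition roots_above :: "('p::finite \<Rightarrow> 'p \<Rightarrow> real measure) \<Rightarrow> real \<Rightarrow> complex set" where
  "roots_above \<mu> \<theta> = {z \<in> roots \<mu>. Re z > \<theta>}"

text \<open>The inverse does not exist at the root \<open>r\<close> itself, hence holomorphy of the product in a
  neighborhood means that it has a holomorphic extension \<open>g\<close> to \<open>r\<close>.\<close>

definition root_order :: "('p::finite \<Rightarrow> 'p \<Rightarrow> real measure) \<Rightarrow> complex \<Rightarrow> nat" where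
  "root_order \<mu> r =
     (LEAST k. k \<ge> 1 \<and>
        (\<exists>U. open U \<and> r \<in> U \<and> U \<subseteq> laplace_domain \<mu> \<and>
             (\<forall>z\<in>U - {r}. invertible (mat 1 - laplace \<mu> z)) \<and>
             (\<forall>i j. \<exists>g. g holomorphic_on U \<and>
                (\<forall>z\<in>U - {r}. g z = (z - r) ^ k * matrix_inv (mat 1 - laplace \<mu> z) $ i $ j))))"

end

theory Submission
  imports Defs "HOL-Complex_Analysis.Complex_Analysis" "HOL-Real_Asymp.Real_Asymp"
begin

text \<open>
  Let $U^{i,j}$ be the expected number of individuals of type $j$ born in a set of times when the
  ancestor has type $i$.  Since a characteristic is independent of the birth time of its individual,
  $F^i(t) = \sum_j \int f_j(t-s)\, U^{i,j}(ds)$, and since reproduction is independent of the past, the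
  Laplace transform of $U$ is the resolvent $R(z) = (I - L\mu(z))^{-1}$ for large $\mathrm{Re}\, z$; it is
  finite there because the spectral radius of $\mu(0)$ is smaller than 1.

  Boundedness of $R$ on the line $\mathrm{Re}\, z = \theta_0$ and finiteness of the set of roots bound
  $\det(I - L\mu)$ away from 0 in vertical strips to the right of that line, outside a bounded set
  (Montel and Hurwitz).  So Perron's integral for $\int_0^t U^{i,j}([0,s])\, ds$ can be moved to a line
  $\mathrm{Re}\, z = c$ with $\theta_0 < c < \theta$; the residues at the roots form an exponential
  polynomial.  Difference quotients with an exponentially small step and monotonicity give
  $U^{i,j}([0,t]) = P(t) + O(e^{\theta t})$: the step costs only an arbitrarily small
  exponential factor, which the gap between $c$ and $\theta$ absorbs.  Writing $f$ as a difference of nondecreasing functions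
  and these as mixtures of indicators of half-lines transfers the estimate to $F$, with $P'$ in place of $P$.
\<close>

text \<open>On a vertical line the resolvent is merely bounded, so an inversion integral with weight
  1/z need not converge absolutely. This is why the renewal function is integrated once more: with
  the weight 1/z^2 every contour integral converges absolutely, and every interchange is an
  application of Fubini. The price is a differentiation at the end, which has to rely on
  monotonicity because no regularity of U is available. Over a step d the contour integral gains d^g
  for each g < 1 but not d itself, since |z|^(g-2) ceases to be integrable at g = 1; this is what
  the gap between c and \<open>\<theta>\<close> pays for. The weight also has a double pole at 0, so
  all lines have to stay in Re z > 0. The contour argument therefore runs for
  \<open>\<theta> > 0\<close>. For \<open>\<theta> \<le> 0\<close> the weighted variation integral
  forces f = 0, and zero coefficients serve.\<close>

unbundle no Formal_Power_Series.fps_syntax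

section \<open>Contour shifts and Perron's formula\<close>

lemma integrable_inverse_1_plus_square_real: "integrable lborel (\<lambda>x::real. 1 / (1 + x\<^sup>2))"
  using integrable_inverse_1_plus_square by (simp add: set_integrable_def inverse_eq_divide)

text \<open>Links the vertical sides of growing rectangles to Lebesgue integrals over the whole
  line.\<close>

lemma tendsto_integral_symmetric:
  fixes f :: "real \<Rightarrow> complex"
  assumes f: "integrable lborel f"
  shows "(\<lambda>n::nat. integral {- real n..real n} f) \<longlonglongrightarrow> (LBINT x. f x)"
proof -
  have "(\<lambda>n::nat. LBINT x. indicator {- real n..real n} x *\<^sub>R f x) \<longlonglongrightarrow> (LBINT x. f x)"
  proof (rule integral_dominated_convergence[where w="\<lambda>x. norm (f x)"])
    show "AE x in lborel. (\<lambda>n::nat. indicator {- real n..real n} x *\<^sub>R f x) \<longlonglongrightarrow> f x"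
    proof (rule AE_I2)
      fix x :: real
      obtain N :: nat where "\<bar>x\<bar> \<le> real N" using real_arch_simple by blast
      then have "\<forall>\<^sub>F n in sequentially. indicator {- real n..real n} x *\<^sub>R f x = f x"
        by (intro eventually_sequentiallyI[of N]) (auto simp: indicator_def abs_le_iff)
      then show "(\<lambda>n::nat. indicator {- real n..real n} x *\<^sub>R f x) \<longlonglongrightarrow> f x"
        by (rule tendsto_eventually)
    qed
  qed (use f in \<open>auto simp: indicator_def\<close>)
  moreover have "integral {- real n..real n} f = (LBINT x. indicator {- real n..real n} x *\<^sub>R f x)" for n :: nat
  proof -
    have "set_integrable lborel {- real n..real n} f"
      unfolding set_integrable_def by (rule integrable_mult_indicator[OF _ f]) auto
    from set_borel_integral_eq_integral(2)[OF this] show ?thesis by (simp add: set_lebesgue_integral_def)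
  qed
  ultimately show ?thesis by simp
qed

text \<open>The residue theorem on the rectangles with corners a - in and b + in. The decay 1/(Im
  z)^2 removes the horizontal sides as n grows, and the factor i from dz = i dy cancels against the
  one in 2 pi i.\<close>

lemma vertical_line_shift:
  fixes h :: "complex \<Rightarrow> complex"
  assumes A: "open A" "connected A" "{z. a \<le> Re z \<and> Re z \<le> b} \<subseteq> A"
    and "finite P" and hol: "h holomorphic_on A - P" and P: "P \<subseteq> {z. a < Re z \<and> Re z < b}"
    and "a < b"
    and bound: "\<And>z. a \<le> Re z \<Longrightarrow> Re z \<le> b \<Longrightarrow> T \<le> \<bar>Im z\<bar> \<Longrightarrow> norm (h z) \<le> C / (Im z)\<^sup>2"
    and int: "integrable lborel (\<lambda>y. h (Complex a y))" "integrable lborel (\<lambda>y. h (Complex b y))"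
  shows "(LBINT y. h (Complex b y)) - (LBINT y. h (Complex a y)) = 2 * pi * (\<Sum>p\<in>P. residue h p)"
proof -
  define R where "R = (\<Sum>p\<in>P. residue h p)"
  define J where "J c n = integral {- real n..real n} (\<lambda>y. h (Complex c y))" for c and n :: nat
  define bot top where "bot n = contour_integral (linepath (Complex a (- real n)) (Complex b (- real n))) h"
    and "top n = contour_integral (linepath (Complex b (real n)) (Complex a (real n))) h" for n :: nat
  \<comment> \<open>Beyond height \<open>M\<close> the decay bound applies, horizontal sides miss
    \<open>P\<close>, and the rectangle encloses all of \<open>P\<close>; the entry 1 makes
    \<open>M\<close> positive.\<close>
  define M where "M = Max (insert T (insert 1 ((\<lambda>p. \<bar>Im p\<bar>) ` P)))"
  have M: "T \<le> M" "1 \<le> M" "\<And>p. p \<in> P \<Longrightarrow> \<bar>Im p\<bar> \<le> M"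
    using \<open>finite P\<close> unfolding M_def by (auto intro!: Max_ge simp del: Max_insert)
  have line: "continuous_on (closed_segment z w) h"
    if "z \<in> cbox (Complex a (- real n)) (Complex b (real n))" "w \<in> cbox (Complex a (- real n)) (Complex b (real n))"
      "closed_segment z w \<inter> P = {}" for z w n
  proof -
    have "closed_segment z w \<subseteq> cbox (Complex a (- real n)) (Complex b (real n))"
      using that by (intro closed_segment_subset) auto
    also have "\<dots> \<subseteq> A" using A(3) by (auto simp: in_cbox_complex_iff)
    finally show ?thesis using that hol
      by (intro holomorphic_on_imp_continuous_on[OF holomorphic_on_subset[OF hol]]) auto
  qed
  have seg: "Complex x y \<notin> P" if "x \<le> a \<or> x \<ge> b \<or> \<bar>y\<bar> > M" for x y
    using that P M(3) by force
  have eq: "\<i> * (J b n - J a n) + bot n + top n = 2 * pi * \<i> * R" if n: "real n > M" for n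
  proof -
    let ?a1 = "Complex a (- real n)" and ?a2 = "Complex b (- real n)"
      and ?a3 = "Complex b (real n)" and ?a4 = "Complex a (real n)"
    have npos: "real n > 0" using n M by linarith
    have s1: "closed_segment ?a1 ?a2 \<inter> P = {}" "closed_segment ?a3 ?a4 \<inter> P = {}"
      using n npos seg \<open>a < b\<close> by (auto simp: closed_segment_same_Im) (metis abs_minus_cancel abs_of_nat complex.collapse)+
    have s2: "closed_segment ?a2 ?a3 \<inter> P = {}" "closed_segment ?a4 ?a1 \<inter> P = {}"
      using n npos seg \<open>a < b\<close> by (auto simp: closed_segment_same_Re) (metis complex.collapse order.refl)+
    have cont: "continuous_on (closed_segment ?a1 ?a2) h" "continuous_on (closed_segment ?a2 ?a3) h"
      "continuous_on (closed_segment ?a3 ?a4) h" "continuous_on (closed_segment ?a4 ?a1) h"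
      using npos \<open>a < b\<close> s1 s2 by (auto intro!: line[of _ n] simp: in_cbox_complex_iff)
    note ci = cont[THEN contour_integrable_continuous_linepath]
    have sub: "path_image (rectpath ?a1 ?a3) \<subseteq> A - P"
    proof -
      have "path_image (rectpath ?a1 ?a3) \<subseteq> cbox ?a1 ?a3"
        using npos \<open>a < b\<close> by (intro path_image_rectpath_subset_cbox) auto
      also have "\<dots> \<subseteq> A" using A(3) by (auto simp: in_cbox_complex_iff)
      finally have "path_image (rectpath ?a1 ?a3) \<subseteq> A" .
      moreover have "path_image (rectpath ?a1 ?a3) \<inter> P = {}"
        using s1 s2 by (auto simp: rectpath_def Let_def path_image_join)
      ultimately show ?thesis by blast
    qed
    have "contour_integral (rectpath ?a1 ?a3) h = 2 * pi * \<i> * (\<Sum>p\<in>P. winding_number (rectpath ?a1 ?a3) p * residue h p)"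
    proof (rule Residue_theorem[OF A(1,2) \<open>finite P\<close> hol])
      show "\<forall>z. z \<notin> A \<longrightarrow> winding_number (rectpath ?a1 ?a3) z = 0"
        using A(3) npos \<open>a < b\<close>
        by (auto intro!: winding_number_rectpath_outside simp: in_cbox_complex_iff)
    qed (use sub in auto)
    also have "(\<Sum>p\<in>P. winding_number (rectpath ?a1 ?a3) p * residue h p) = R"
      unfolding R_def
    proof (rule sum.cong[OF refl])
      fix p assume "p \<in> P"
      then have "p \<in> box ?a1 ?a3"
        using P M(3)[of p] n by (auto simp: in_box_complex_iff)
      then show "winding_number (rectpath ?a1 ?a3) p * residue h p = residue h p"
        by (simp add: winding_number_rectpath)
    qed
    finally have "contour_integral (rectpath ?a1 ?a3) h = 2 * pi * \<i> * R" .
    moreover have "contour_integral (rectpath ?a1 ?a3) h =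
       bot n + (contour_integral (linepath ?a2 ?a3) h + (top n + contour_integral (linepath ?a4 ?a1) h))"
      unfolding rectpath_def Let_def bot_def top_def using ci
      by (simp add: contour_integrable_joinI)
    moreover have "contour_integral (linepath ?a2 ?a3) h = \<i> * J b n"
      unfolding J_def using npos by (subst contour_integral_linepath_same_Re[where c=b]) auto
    moreover have "contour_integral (linepath ?a4 ?a1) h = - (\<i> * J a n)"
    proof -
      have "continuous_on (closed_segment ?a1 ?a4) h" using cont(4) by (simp add: closed_segment_commute)
      from contour_integral_reverse_linepath[OF this]
      have "contour_integral (linepath ?a4 ?a1) h = - contour_integral (linepath ?a1 ?a4) h" by simp
      also have "contour_integral (linepath ?a1 ?a4) h = \<i> * J a n"
        unfolding J_def using npos by (subst contour_integral_linepath_same_Re[where c=a]) auto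
      finally show ?thesis .
    qed
    ultimately show ?thesis by (simp add: algebra_simps)
  qed
  have C: "C \<ge> 0"
  proof -
    have "norm (h (Complex a M)) \<le> C / M\<^sup>2" using bound[of "Complex a M"] M \<open>a < b\<close> by auto
    then show ?thesis using M by (metis norm_ge_zero order_trans zero_le_divide_iff not_less zero_less_power
      less_le_trans zero_less_one)
  qed
  have hb: "norm (bot n) \<le> C / (real n)\<^sup>2 * (b - a)" "norm (top n) \<le> C / (real n)\<^sup>2 * (b - a)" if n: "real n > M" for n
  proof -
    have npos: "real n > 0" using n M by linarith
    have s1: "closed_segment (Complex a (- real n)) (Complex b (- real n)) \<inter> P = {}"
       "closed_segment (Complex b (real n)) (Complex a (real n)) \<inter> P = {}"
      using n npos seg \<open>a < b\<close> by (auto simp: closed_segment_same_Im) (metis abs_minus_cancel abs_of_nat complex.collapse)+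
    have ba: "cmod (Complex b y - Complex a y) = b - a" "cmod (Complex a y - Complex b y) = b - a" for y
      using \<open>a < b\<close> by (auto simp: cmod_def)
    have "continuous_on (closed_segment (Complex a (- real n)) (Complex b (- real n))) h"
      using npos \<open>a < b\<close> s1 by (auto intro!: line[of _ n] simp: in_cbox_complex_iff)
    from contour_integral_bound_linepath[OF contour_integrable_continuous_linepath[OF this], of "C / (real n)\<^sup>2"]
    show "norm (bot n) \<le> C / (real n)\<^sup>2 * (b - a)"
      unfolding bot_def using n C M(1,2) \<open>a < b\<close> bound
      by (force simp: ba closed_segment_same_Im closed_segment_eq_real_ivl)
    have "continuous_on (closed_segment (Complex b (real n)) (Complex a (real n))) h"
      using npos \<open>a < b\<close> s1 by (auto intro!: line[of _ n] simp: in_cbox_complex_iff)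
    from contour_integral_bound_linepath[OF contour_integrable_continuous_linepath[OF this], of "C / (real n)\<^sup>2"]
    show "norm (top n) \<le> C / (real n)\<^sup>2 * (b - a)"
      unfolding top_def using n C M(1,2) \<open>a < b\<close> bound
      by (force simp: ba closed_segment_same_Im closed_segment_eq_real_ivl)
  qed
  have ev: "\<forall>\<^sub>F n in sequentially. real n > M"
    by real_asymp
  have lim0: "(\<lambda>n. C / (real n)\<^sup>2 * (b - a)) \<longlonglongrightarrow> 0"
    by real_asymp
  have b0: "bot \<longlonglongrightarrow> 0" "top \<longlonglongrightarrow> 0"
    by (auto intro!: Lim_null_comparison[OF _ lim0] eventually_mono[OF ev] hb)
  have "(\<lambda>n. \<i> * (J b n - J a n) + bot n + top n) \<longlonglongrightarrow>
      \<i> * ((LBINT y. h (Complex b y)) - (LBINT y. h (Complex a y))) + 0 + 0"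
    unfolding J_def by (intro tendsto_intros b0 tendsto_integral_symmetric int)
  moreover have "(\<lambda>n. \<i> * (J b n - J a n) + bot n + top n) \<longlonglongrightarrow> 2 * pi * \<i> * R"
    by (rule tendsto_eventually[OF eventually_mono[OF ev eq]])
  ultimately have "\<i> * ((LBINT y. h (Complex b y)) - (LBINT y. h (Complex a y))) + 0 + 0 = 2 * pi * \<i> * R"
    by (rule LIMSEQ_unique)
  then have "\<i> * ((LBINT y. h (Complex b y)) - (LBINT y. h (Complex a y))) = \<i> * (2 * pi * R)"
    by simp
  then show ?thesis unfolding R_def by (subst (asm) mult_cancel_left) simp
qed

lemma integrable_vertical_line:
  fixes h :: "complex \<Rightarrow> complex"
  assumes "continuous_on {z. Re z = c} h" "\<And>y. norm (h (Complex c y)) \<le> C / (1 + y\<^sup>2)"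
  shows "integrable lborel (\<lambda>y. h (Complex c y))"
proof (rule Bochner_Integration.integrable_bound)
  show "integrable lborel (\<lambda>y::real. C * (1 / (1 + y\<^sup>2)))"
    using integrable_inverse_1_plus_square_real by (rule integrable_mult_right)
  have "continuous_on UNIV (\<lambda>y. h (Complex c y))"
    by (rule continuous_on_compose2[OF assms(1)]) (auto simp: Complex_eq intro!: continuous_intros)
  then show "(\<lambda>y. h (Complex c y)) \<in> borel_measurable lborel"
    using borel_measurable_continuous_onI by simp
  show "AE y in lborel. norm (h (Complex c y)) \<le> norm (C * (1 / (1 + y\<^sup>2)))"
    using assms(2) by (auto intro!: AE_I2 order_trans[OF assms(2)] divide_right_mono)
qed

text \<open>The integrand is holomorphic away from the double pole at 0, where the residue is \<open>t\<close>;
  the line is moved far to the right for \<open>t \<le> 0\<close> and far to the left for \<open>t \<ge> 0\<close>.\<close>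

lemma perron_ramp:
  assumes "\<sigma> > 0"
  shows "(LBINT y. exp (Complex \<sigma> y * t) / (Complex \<sigma> y)\<^sup>2) = 2 * pi * max t 0"
proof -
  define h where "h z = exp (z * complex_of_real t) / z\<^sup>2" for z :: complex
  have nh: "norm (h (Complex c y)) \<le> 1 / (c\<^sup>2 + y\<^sup>2)" if "c * t \<le> 0" for c y
    using that by (auto simp: h_def norm_divide norm_power cmod_power2 divide_right_mono)
  have nh0: "norm (h z) \<le> exp (\<bar>t\<bar> * \<bar>c\<bar>) / (c\<^sup>2 + (Im z)\<^sup>2)" if "\<bar>Re z\<bar> = \<bar>c\<bar>" for c z
  proof -
    have "Re z * t \<le> \<bar>t\<bar> * \<bar>c\<bar>" using that by (metis abs_ge_self abs_mult mult.commute)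
    moreover have "(Re z)\<^sup>2 = c\<^sup>2" using that by (metis power2_abs)
    ultimately show ?thesis
      by (auto simp: h_def norm_divide norm_power cmod_power2 divide_right_mono)
  qed
  have intg: "integrable lborel (\<lambda>y. h (Complex c y))" if "c \<noteq> 0" for c
  proof (rule integrable_vertical_line)
    show "continuous_on {z. Re z = c} h"
      unfolding h_def using that by (auto intro!: continuous_intros)
    fix y
    have "1 + y\<^sup>2 \<le> (1 + 1 / c\<^sup>2) * (c\<^sup>2 + y\<^sup>2)"
      using that by (simp add: field_simps)
    then have "1 / (c\<^sup>2 + y\<^sup>2) \<le> (1 + 1 / c\<^sup>2) / (1 + y\<^sup>2)"
    proof -
      have "c\<^sup>2 + y\<^sup>2 > 0" "1 + y\<^sup>2 > 0" using that by (simp_all add: sum_power2_gt_zero_iff add_pos_nonneg)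
      then show ?thesis using \<open>1 + y\<^sup>2 \<le> _\<close>
        by (simp only: pos_divide_le_eq pos_le_divide_eq times_divide_eq_left) (simp add: mult.commute)
    qed
    with nh0[of "Complex c y" c] show "norm (h (Complex c y)) \<le> exp (\<bar>t\<bar> * \<bar>c\<bar>) * (1 + 1 / c\<^sup>2) / (1 + y\<^sup>2)"
      using mult_left_mono[of "1 / (c\<^sup>2 + y\<^sup>2)" "(1 + 1 / c\<^sup>2) / (1 + y\<^sup>2)" "exp (\<bar>t\<bar> * \<bar>c\<bar>)"] by simp
  qed
  \<comment> \<open>Along lines moving away in a direction with \<open>c n * t \<le> 0\<close> the
    exponential never exceeds 1 in modulus, and \<open>1 \<le> \<bar>c n\<bar>\<close> gives the
    common majorant 1/(1 + y^2).\<close>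
  have lim0: "(\<lambda>n. LBINT y. h (Complex (c n) y)) \<longlonglongrightarrow> 0"
    if c: "filterlim (\<lambda>n. \<bar>c n\<bar>) at_top sequentially" "\<And>n. c n * t \<le> 0" "\<And>n. 1 \<le> \<bar>c n\<bar>" for c :: "nat \<Rightarrow> real"
  proof -
    have "(\<lambda>n. LBINT y. h (Complex (c n) y)) \<longlonglongrightarrow> (LBINT y::real. 0)"
    proof (rule integral_dominated_convergence[where w="\<lambda>y. 1 / (1 + y\<^sup>2)"])
      have c1: "1 \<le> (c n)\<^sup>2" for n using c(3)[of n] by (metis one_le_power power2_abs)
      show "AE y in lborel. norm (h (Complex (c n) y)) \<le> 1 / (1 + y\<^sup>2)" for n
        using c1[of n] by (intro AE_I2 order_trans[OF nh[OF c(2)]]) (auto intro!: divide_left_mono mult_pos_pos add_pos_nonneg)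
      show "AE y in lborel. (\<lambda>n. h (Complex (c n) y)) \<longlonglongrightarrow> 0"
      proof (rule AE_I2)
        fix y
        have "(\<lambda>n. 1 / (\<bar>c n\<bar>)\<^sup>2) \<longlonglongrightarrow> 0"
          by (rule tendsto_divide_0[OF tendsto_const])
             (intro filterlim_at_top_imp_at_infinity filterlim_pow_at_top c, simp)
        then show "(\<lambda>n. h (Complex (c n) y)) \<longlonglongrightarrow> 0"
        proof (rule Lim_null_comparison[rotated], intro always_eventually allI)
          fix n
          show "norm (h (Complex (c n) y)) \<le> 1 / (\<bar>c n\<bar>)\<^sup>2"
            using c1[of n] by (intro order_trans[OF nh[OF c(2)]]) (auto intro!: divide_left_mono mult_pos_pos add_pos_nonneg)
        qed
      qed
      show "(\<lambda>y. h (Complex (c n) y)) \<in> borel_measurable lborel" for n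
      proof -
        have "c n \<noteq> 0" using c(3)[of n] by auto
        then show ?thesis by (rule borel_measurable_integrable[OF intg])
      qed
    qed (use integrable_inverse_1_plus_square_real in simp_all)
    then show ?thesis by simp
  qed
  have hb: "norm (h z) \<le> exp (\<bar>t\<bar> * b) / (Im z)\<^sup>2" if "- b \<le> Re z" "Re z \<le> b" "1 \<le> \<bar>Im z\<bar>" for z b
  proof -
    have "norm (h z) \<le> exp (\<bar>t\<bar> * \<bar>Re z\<bar>) / ((Re z)\<^sup>2 + (Im z)\<^sup>2)" by (rule nh0) simp
    also have "\<dots> \<le> exp (\<bar>t\<bar> * b) / (Im z)\<^sup>2"
    proof (rule frac_le)
      have "\<bar>Re z\<bar> \<le> b" using that by linarith
      then show "exp (\<bar>t\<bar> * \<bar>Re z\<bar>) \<le> exp (\<bar>t\<bar> * b)" by (simp add: mult_left_mono)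
      have "Im z \<noteq> 0" using that by auto
      then show "0 < (Im z)\<^sup>2" by simp
    qed auto
    finally show ?thesis .
  qed
  have res: "residue h 0 = t"
  proof -
    have "residue (\<lambda>z. exp (z * complex_of_real t) / z ^ Suc 1) 0 = (deriv ^^ 1) (\<lambda>z. exp (z * complex_of_real t)) 0 / fact 1"
      by (rule residue_holomorphic_over_power'[of UNIV]) (auto intro!: holomorphic_intros)
    moreover have "deriv (\<lambda>z. exp (z * complex_of_real t)) 0 = t"
      by (rule DERIV_imp_deriv) (auto intro!: derivative_eq_intros)
    ultimately show ?thesis by (simp add: h_def[abs_def] power2_eq_square)
  qed
  have hol: "h holomorphic_on UNIV - {0}"
    unfolding h_def by (auto intro!: holomorphic_intros)
  have "(LBINT y. h (Complex \<sigma> y)) = 2 * pi * max t 0"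
  proof (cases "t \<le> 0")
    case True
    have "(LBINT y. h (Complex (\<sigma> + 1 + real n) y)) = (LBINT y. h (Complex \<sigma> y))" for n
    proof -
      have "(LBINT y. h (Complex (\<sigma> + 1 + real n) y)) - (LBINT y. h (Complex \<sigma> y)) = 2 * pi * (\<Sum>p\<in>{}. residue h p)"
      proof (rule vertical_line_shift[where A="{z. Re z > 0}" and T=1 and C="exp (\<bar>t\<bar> * (\<sigma> + 1 + real n))"])
        show "connected {z. Re z > 0}" using convex_halfspace_Re_gt convex_connected by blast
        show "h holomorphic_on {z. 0 < Re z} - {}" by (rule holomorphic_on_subset[OF hol]) auto
      qed (use \<open>\<sigma> > 0\<close> in \<open>auto intro!: hb intg open_halfspace_Re_gt\<close>)
      then show ?thesis by simp
    qed
    moreover have "(\<lambda>n. LBINT y. h (Complex (\<sigma> + 1 + real n) y)) \<longlonglongrightarrow> 0"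
    proof (rule lim0)
      show "filterlim (\<lambda>n. \<bar>\<sigma> + 1 + real n\<bar>) at_top sequentially"
        by (rule filterlim_at_top_mono[OF filterlim_real_sequentially]) (use \<open>\<sigma> > 0\<close> in auto)
    qed (use True \<open>\<sigma> > 0\<close> in \<open>auto intro: mult_nonneg_nonpos\<close>)
    ultimately have "(\<lambda>n::nat. LBINT y. h (Complex \<sigma> y)) \<longlonglongrightarrow> 0" by simp
    from LIMSEQ_unique[OF this tendsto_const] True show ?thesis by simp
  next
    case False
    have "(LBINT y. h (Complex (- 1 - real n) y)) = (LBINT y. h (Complex \<sigma> y)) - 2 * pi * t" for n
    proof -
      have "(LBINT y. h (Complex \<sigma> y)) - (LBINT y. h (Complex (- 1 - real n) y)) = 2 * pi * (\<Sum>p\<in>{0}. residue h p)"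
        by (rule vertical_line_shift[where A=UNIV and T=1 and C="exp (\<bar>t\<bar> * (\<sigma> + 1 + real n))"])
           (use \<open>\<sigma> > 0\<close> hol in \<open>auto intro!: hb intg\<close>)
      then show ?thesis using res by (simp add: algebra_simps)
    qed
    moreover have "(\<lambda>n. LBINT y. h (Complex (- 1 - real n) y)) \<longlonglongrightarrow> 0"
    proof (rule lim0)
      show "filterlim (\<lambda>n. \<bar>- 1 - real n\<bar>) at_top sequentially"
        by (rule filterlim_at_top_mono[OF filterlim_real_sequentially]) auto
      show "(- 1 - real n) * t \<le> 0" for n
        using False by (intro mult_nonpos_nonneg) auto
    qed auto
    ultimately have "(\<lambda>n::nat. (LBINT y. h (Complex \<sigma> y)) - 2 * pi * t) \<longlonglongrightarrow> 0" by simp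
    from LIMSEQ_unique[OF this tendsto_const] False show ?thesis by simp
  qed
  then show ?thesis unfolding h_def .
qed

section \<open>Lower bounds in vertical strips\<close>

text \<open>If the bound failed along points \<open>z n\<close>, a limit \<open>g\<close> of the vertical translates \<open>w \<mapsto> D (w + \<i> * Im (z n))\<close>
  would have a zero to the right of \<open>c\<close>. The translates are eventually free of zeros there,
  so \<open>g\<close> vanishes identically by Hurwitz, contradicting the bound on the line \<open>Re z = c\<close>.\<close>

lemma vertical_strip_lower_bound:
  fixes D :: "complex \<Rightarrow> complex"
  assumes hol: "D holomorphic_on {z. Re z > l}" and "l < c" "c < a"
    and bdd: "\<And>x. l < x \<Longrightarrow> \<exists>B. \<forall>z. x \<le> Re z \<longrightarrow> norm (D z) \<le> B"
    and low: "m > 0" "\<And>y. m \<le> norm (D (Complex c y))"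
    and fin: "finite {z. c < Re z \<and> D z = 0}"
  shows "\<exists>T m'. m' > 0 \<and> (\<forall>z. a \<le> Re z \<longrightarrow> Re z \<le> b \<longrightarrow> T \<le> \<bar>Im z\<bar> \<longrightarrow> m' \<le> norm (D z))"
proof (rule ccontr)
  assume neg: "\<not> ?thesis"
  have "\<exists>z. a \<le> Re z \<and> Re z \<le> b \<and> real n \<le> \<bar>Im z\<bar> \<and> norm (D z) < 1 / real (Suc n)" for n
  proof -
    have "1 / real (Suc n) > 0" by simp
    with neg show ?thesis by (auto simp: not_le)
  qed
  then obtain z where z: "\<And>n. a \<le> Re (z n)" "\<And>n. Re (z n) \<le> b" "\<And>n. real n \<le> \<bar>Im (z n)\<bar>"
    "\<And>n. norm (D (z n)) < 1 / real (Suc n)" by metis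
  define F where "F n w = D (w + \<i> * Im (z n))" for n w
  define S where "S = {w. Re w > l}"
  have S: "open S" "connected S"
    by (auto simp: S_def open_halfspace_Re_gt convex_halfspace_Re_gt convex_connected)
  have holF: "F n holomorphic_on S" for n
    unfolding F_def
    by (rule holomorphic_on_compose_gen[of "\<lambda>w. w + \<i> * Im (z n)" _ D, unfolded o_def, OF _ hol])
       (auto intro!: holomorphic_intros simp: S_def)
  obtain g r where g: "g holomorphic_on S" and r: "strict_mono (r :: nat \<Rightarrow> nat)"
    and lim: "\<And>x. x \<in> S \<Longrightarrow> (\<lambda>n. F (r n) x) \<longlonglongrightarrow> g x"
    and ulim: "\<And>K. compact K \<Longrightarrow> K \<subseteq> S \<Longrightarrow> uniform_limit K (F \<circ> r) g sequentially"
  \<comment> \<open>Local boundedness holds for all translates at once, because the bound on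
    \<open>D\<close> over a right half-plane is invariant under vertical translation.\<close>
  proof (rule Montel[OF S(1), of "range F" F])
    fix K assume K: "compact K" "K \<subseteq> S"
    show "\<exists>B. \<forall>h\<in>range F. \<forall>w\<in>K. norm (h w) \<le> B"
    proof (cases "K = {}")
      case False
      have "continuous_on K Re" by (intro continuous_intros)
      from continuous_attains_inf[OF K(1) False this] obtain k where k: "k \<in> K" "\<And>w. w \<in> K \<Longrightarrow> Re k \<le> Re w"
        by blast
      with K have "l < Re k" by (auto simp: S_def)
      from bdd[OF this] obtain B where "\<And>w. Re k \<le> Re w \<Longrightarrow> norm (D w) \<le> B" by blast
      with k(2) have "norm (F n w) \<le> B" if "w \<in> K" for n w using that by (simp add: F_def)
      then show ?thesis by blast
    qed auto
  qed (use holF in auto)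
  \<comment> \<open>The imaginary part of \<open>z n\<close> is built into the translate, so only
    the real parts remain, and these lie in the compact interval [a,b].\<close>
  have ab: "\<forall>n. Re (z (r n)) \<in> {a..b}" using z by auto
  obtain x s where x: "x \<in> {a..b}" and s: "strict_mono (s :: nat \<Rightarrow> nat)"
    and lx: "((\<lambda>n. Re (z (r n))) \<circ> s) \<longlonglongrightarrow> x"
    by (rule seq_compactE[OF compact_imp_seq_compact[OF compact_Icc] ab])
  define x' where "x' n = complex_of_real (Re (z (r (s n))))" for n
  have lx': "x' \<longlonglongrightarrow> complex_of_real x"
    using tendsto_of_real[OF lx] unfolding x'_def o_def .
  define K where "K = complex_of_real ` {a..b}"
  have K: "compact K" "K \<subseteq> S" "complex_of_real x \<in> K" "\<And>n. x' n \<in> K"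
    using assms(2,3) x z by (auto simp: K_def S_def x'_def intro!: compact_continuous_image continuous_intros)
  have gx: "g x = 0"
  proof -
    have "(\<lambda>n. g (x' n)) \<longlonglongrightarrow> g x"
      by (rule continuous_on_tendsto_compose[OF holomorphic_on_imp_continuous_on[OF holomorphic_on_subset[OF g K(2)]] lx' K(3)])
         (simp add: K(4))
    moreover have "(\<lambda>n. F (r (s n)) (x' n)) \<longlonglongrightarrow> 0"
    proof (rule Lim_null_comparison)
      show "\<forall>\<^sub>F n in sequentially. norm (F (r (s n)) (x' n)) \<le> 1 / real (Suc n)"
      proof (intro always_eventually allI)
        fix n
        have "F (r (s n)) (x' n) = D (z (r (s n)))"
          unfolding F_def x'_def by (rule arg_cong[of _ _ D]) (simp add: complex_eq_iff)
        moreover have "n \<le> r (s n)"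
          using seq_suble[OF s, of n] seq_suble[OF r, of "s n"] by linarith
        then have "1 / real (Suc (r (s n))) \<le> 1 / real (Suc n)" by (simp add: frac_le)
        ultimately show "norm (F (r (s n)) (x' n)) \<le> 1 / real (Suc n)"
          using z(4)[of "r (s n)"] by simp
      qed
      show "(\<lambda>n. 1 / real (Suc n)) \<longlonglongrightarrow> 0" by (rule LIMSEQ_Suc[OF lim_1_over_n])
    qed
    moreover have "(\<lambda>n. F (r (s n)) (x' n) - g (x' n)) \<longlonglongrightarrow> 0"
    proof (rule LIMSEQ_I)
      fix e :: real assume "e > 0"
      from uniform_limitD[OF ulim[OF K(1,2)] this]
      obtain N where N: "\<And>n w. n \<ge> N \<Longrightarrow> w \<in> K \<Longrightarrow> dist (F (r n) w) (g w) < e"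
        by (auto simp: eventually_sequentially)
      show "\<exists>N. \<forall>n\<ge>N. norm (F (r (s n)) (x' n) - g (x' n) - 0) < e"
      proof (intro exI[of _ N] allI impI)
        fix n assume "n \<ge> N"
        then have "s n \<ge> N" using seq_suble[OF s, of n] by linarith
        from N[OF this K(4)] show "norm (F (r (s n)) (x' n) - g (x' n) - 0) < e" by (simp add: dist_norm)
      qed
    qed
    ultimately have "(\<lambda>n. F (r (s n)) (x' n) - (F (r (s n)) (x' n) - g (x' n))) \<longlonglongrightarrow> 0 - 0"
      by (intro tendsto_diff)
    then have "(\<lambda>n. g (x' n)) \<longlonglongrightarrow> 0" by simp
    from LIMSEQ_unique[OF \<open>(\<lambda>n. g (x' n)) \<longlonglongrightarrow> g x\<close> this] show ?thesis .
  qed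
  \<comment> \<open>In this band a zero of a translate comes from a zero of \<open>D\<close> whose
    imaginary part has modulus at least |Im (z n)| - 1. As \<open>D\<close> has finitely many zeros
    to the right of c, this is impossible for large n.\<close>
  define W where "W = {w. c < Re w} \<inter> {w. \<bar>Im w\<bar> < 1}"
  have W: "open W" "connected W" "W \<subseteq> S" "complex_of_real x \<in> W"
  proof -
    have W_eq: "W = {w. c < Re w} \<inter> {w. Im w < 1} \<inter> {w. Im w > - 1}" by (auto simp: W_def)
    show "open W" unfolding W_eq
      by (intro open_Int open_halfspace_Re_gt open_halfspace_Im_gt open_halfspace_Im_lt)
    show "connected W" unfolding W_eq
      by (intro convex_connected convex_Int convex_halfspace_Re_gt convex_halfspace_Im_gt convex_halfspace_Im_lt)
    show "W \<subseteq> S" "complex_of_real x \<in> W"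
      using assms(2,3) x by (auto simp: W_def S_def)
  qed
  obtain N :: nat where N: "\<And>w. c < Re w \<Longrightarrow> D w = 0 \<Longrightarrow> \<bar>Im w\<bar> \<le> real N"
  proof -
    obtain N :: nat where "Max (insert 0 ((\<lambda>w. \<bar>Im w\<bar>) ` {w. c < Re w \<and> D w = 0})) \<le> real N"
      using real_arch_simple by blast
    with fin have "\<bar>Im w\<bar> \<le> real N" if "c < Re w" "D w = 0" for w using that by simp
    then show ?thesis by (rule that)
  qed
  have nz: "F (r (n + Suc N)) w \<noteq> 0" if "w \<in> W" for n w
  proof
    assume "F (r (n + Suc N)) w = 0"
    then have "\<bar>Im (w + \<i> * Im (z (r (n + Suc N))))\<bar> \<le> real N"
      using that by (intro N) (auto simp: F_def W_def)
    moreover have "n + Suc N \<le> r (n + Suc N)" by (rule seq_suble[OF r])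
    then have "real (n + Suc N) \<le> \<bar>Im (z (r (n + Suc N)))\<bar>"
      using z(3)[of "r (n + Suc N)"] by linarith
    ultimately show False using that by (auto simp: W_def)
  qed
  have nonconst: "\<not> g constant_on W"
  proof
    assume "g constant_on W"
    then have g0: "g w = 0" if "w \<in> W" for w using gx W(4) that by (auto simp: constant_on_def)
    \<comment> \<open>The point c lies on the boundary of \<open>W\<close> but inside the larger
      domain \<open>S\<close>, so the identity theorem carries the vanishing of g to it.\<close>
    have "g (Complex c 0) = 0"
      by (rule analytic_continuation_open[of W S g "\<lambda>_. 0"])
         (use W S g g0 \<open>l < c\<close> in \<open>auto simp: S_def simp del: complex_eq_iff\<close>)
    moreover have "m \<le> norm (g (Complex c 0))"
    proof (rule LIMSEQ_le_const)
      show "(\<lambda>n. norm (F (r n) (Complex c 0))) \<longlonglongrightarrow> norm (g (Complex c 0))"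
        using \<open>l < c\<close> by (intro tendsto_norm lim) (auto simp: S_def)
      have "F n (Complex c 0) = D (Complex c (Im (z n)))" for n
        unfolding F_def by (rule arg_cong[of _ _ D]) (simp add: complex_eq_iff)
      then show "\<exists>N. \<forall>n\<ge>N. m \<le> norm (F (r n) (Complex c 0))" using low(2) by auto
    qed
    ultimately show False using low(1) by simp
  qed
  have "g x \<noteq> 0"
  proof (rule Hurwitz_no_zeros[OF W(1,2) _ _ _ nonconst nz W(4)])
    show "F (r (n + Suc N)) holomorphic_on W" for n by (rule holomorphic_on_subset[OF holF W(3)])
    show "g holomorphic_on W" by (rule holomorphic_on_subset[OF g W(3)])
    fix Q assume "compact Q" "Q \<subseteq> W"
    then have "uniform_limit Q (F \<circ> r) g sequentially" using W(3) by (intro ulim) auto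
    then show "uniform_limit Q (\<lambda>n. F (r (n + Suc N))) g sequentially"
      unfolding uniform_limit_iff o_def by (simp add: eventually_sequentially_seg[of "\<lambda>n. \<forall>x\<in>Q. dist (F (r n) x) (g x) < _" "Suc N"] del: add_Suc_right)
  qed
  with gx show False by simp
qed

section \<open>Laplace transforms\<close>

lemma mult_exp_neg_le:
  fixes x d :: real
  assumes "d > 0" "x \<ge> 0"
  shows "x * exp (- d * x) \<le> 1 / d"
proof -
  have "d * x \<le> exp (d * x)" using exp_ge_add_one_self[of "d * x"] by linarith
  then show ?thesis using assms by (simp add: exp_minus divide_simps mult.commute)
qed

lemma norm_exp_diff_le:
  fixes w :: complex
  shows "norm (exp w - 1) \<le> norm w * exp (norm w)"
proof -
  have "norm (exp w - exp 0) \<le> exp (norm w) * norm (w - 0)"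
  proof (rule field_differentiable_bound[of "cball 0 (norm w)" exp exp])
    fix z :: complex assume "z \<in> cball 0 (norm w)"
    then show "norm (exp z) \<le> exp (norm w)"
      using complex_Re_le_cmod[of z] by (auto intro: order_trans)
  qed (auto intro!: derivative_eq_intros)
  then show ?thesis by (simp add: mult.commute)
qed

text \<open>Differentiation under the integral sign. The distance from z to the line Re z = a is
  halved: one half is left to the increment, the other absorbs the factor x through x exp(-d x)
  \<le> 1/d.\<close>

lemma laplace_transform_holomorphic:
  fixes N :: "real measure" and a :: real
  assumes sets: "sets N = sets borel" and neg: "AE x in N. x \<ge> 0"
    and int: "integrable N (\<lambda>x. exp (- a * x))"
  shows "(\<lambda>z. LINT x|N. exp (- z * complex_of_real x)) holomorphic_on {z. Re z > a}"
proof -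
  have m[measurable]: "f \<in> borel_measurable N" if "f \<in> borel_measurable borel" for f :: "real \<Rightarrow> complex"
    using that sets measurable_cong_sets by blast
  have intz: "integrable N (\<lambda>x. exp (- z * complex_of_real x))" if "Re z > a" for z
  proof (rule Bochner_Integration.integrable_bound[OF int])
    show "AE x in N. norm (exp (- z * complex_of_real x)) \<le> norm (exp (- a * x))"
      using neg by eventually_elim (use that in \<open>auto simp: mult_right_mono\<close>)
  qed measurable
  have "((\<lambda>z. LINT x|N. exp (- z * complex_of_real x)) has_field_derivative
      (LINT x|N. - complex_of_real x * exp (- z * complex_of_real x))) (at z)" if z: "Re z > a" for z
  proof -
    define d where "d = (Re z - a) / 2"
    have d: "d > 0" using z by (simp add: d_def)
    have "((\<lambda>h. ((LINT x|N. exp (- (z + h) * complex_of_real x)) - (LINT x|N. exp (- z * complex_of_real x))) / h) \<longlongrightarrow>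
       (LINT x|N. - complex_of_real x * exp (- z * complex_of_real x))) (at 0)"
      unfolding tendsto_at_iff_sequentially
    proof (intro allI impI)
      fix X :: "nat \<Rightarrow> complex" assume X: "\<forall>i. X i \<in> UNIV - {0}" "X \<longlonglongrightarrow> 0"
      have X0: "X i \<noteq> 0" for i using X by auto
      from X(2) d obtain n0 where n0: "\<And>n. n \<ge> n0 \<Longrightarrow> norm (X n) < d"
        by (auto simp: lim_sequentially dist_norm)
      \<comment> \<open>On this tail the increments stay below \<open>d\<close>, so that
        \<open>z + Y n\<close> remains to the right of a and one majorant serves for all n.\<close>
      define Y where "Y n = X (n + n0)" for n
      have Y: "Y n \<noteq> 0" "norm (Y n) < d" "Re (z + Y n) > a" for n
      proof -
        show "Y n \<noteq> 0" "norm (Y n) < d" using X0 n0 by (auto simp: Y_def)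
        then have "\<bar>Re (Y n)\<bar> < (Re z - a) / 2" using abs_Re_le_cmod[of "Y n"] unfolding d_def by linarith
        then show "Re (z + Y n) > a" using z by (auto simp: field_simps abs_if split: if_splits)
      qed
      have Ylim: "Y \<longlonglongrightarrow> 0" unfolding Y_def by (rule LIMSEQ_ignore_initial_segment[OF X(2)])
      define G where "G n x = exp (- z * complex_of_real x) * ((exp (- Y n * complex_of_real x) - 1) / Y n)" for n x
      have Geq: "(exp (- (z + Y n) * complex_of_real x) - exp (- z * complex_of_real x)) / Y n = G n x" for n x
        by (simp add: G_def algebra_simps exp_add exp_diff divide_simps exp_minus)
      have "(\<lambda>n. LINT x|N. G n x) \<longlonglongrightarrow> (LINT x|N. - complex_of_real x * exp (- z * complex_of_real x))"
      proof (rule integral_dominated_convergence[where w="\<lambda>x. 1 / d * exp (- a * x)"])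
        show "(\<lambda>x. - complex_of_real x * exp (- z * complex_of_real x)) \<in> borel_measurable N" by measurable
        show "(\<lambda>x. G n x) \<in> borel_measurable N" for n unfolding G_def by measurable
        show "AE x in N. (\<lambda>n. G n x) \<longlonglongrightarrow> - complex_of_real x * exp (- z * complex_of_real x)"
        proof (rule AE_I2)
          fix x
          have "((\<lambda>h. exp (- h * complex_of_real x)) has_field_derivative - complex_of_real x) (at 0)"
            by (auto intro!: derivative_eq_intros)
          then have "((\<lambda>h. (exp (- h * complex_of_real x) - 1) / h) \<longlongrightarrow> - complex_of_real x) (at 0)"
            by (simp add: has_field_derivative_iff)
          from this[unfolded tendsto_at_iff_sequentially, rule_format, of Y] Ylim Y(1)
          have "(\<lambda>n. (exp (- Y n * complex_of_real x) - 1) / Y n) \<longlonglongrightarrow> - complex_of_real x"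
            by (simp add: o_def)
          then show "(\<lambda>n. G n x) \<longlonglongrightarrow> - complex_of_real x * exp (- z * complex_of_real x)"
            unfolding G_def by (subst mult.commute) (intro tendsto_intros)
        qed
        show "AE x in N. norm (G n x) \<le> 1 / d * exp (- a * x)" for n
          using neg
        proof eventually_elim
          case (elim x)
          have "norm (exp (- Y n * complex_of_real x) - 1) \<le> norm (- Y n * complex_of_real x) * exp (norm (- Y n * complex_of_real x))"
            by (rule norm_exp_diff_le)
          also have "\<dots> \<le> norm (Y n) * (x * exp (d * x))"
            using elim Y(2)[of n] by (auto simp: norm_mult mult.assoc intro!: mult_left_mono mult_right_mono)
          finally have 1: "norm ((exp (- Y n * complex_of_real x) - 1) / Y n) \<le> x * exp (d * x)"
            using Y(1)[of n] by (simp add: norm_divide divide_simps mult.commute)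
          have "norm (G n x) \<le> exp (- Re z * x) * (x * exp (d * x))"
            unfolding G_def norm_mult using 1 by (intro mult_mono) auto
          also have "\<dots> = (x * exp (- d * x)) * exp (- a * x)"
          proof -
            have "- Re z * x + d * x = - d * x + - a * x" by (simp add: d_def field_simps)
            then show ?thesis by (simp add: exp_add[symmetric] ac_simps)
          qed
          also have "\<dots> \<le> 1 / d * exp (- a * x)"
            using mult_exp_neg_le[OF d elim] by (intro mult_right_mono) auto
          finally show ?case .
        qed
      qed (use int in simp)
      moreover have "(LINT x|N. G n x) = ((LINT x|N. exp (- (z + Y n) * complex_of_real x)) - (LINT x|N. exp (- z * complex_of_real x))) / Y n" for n
      proof -
        have "(LINT x|N. G n x) = (LINT x|N. (exp (- (z + Y n) * complex_of_real x) - exp (- z * complex_of_real x)) / Y n)"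
          by (simp only: Geq)
        also have "\<dots> = ((LINT x|N. exp (- (z + Y n) * complex_of_real x)) - (LINT x|N. exp (- z * complex_of_real x))) / Y n"
          using intz[OF Y(3)[of n]] intz[OF z] by (simp only: integral_divide_zero Bochner_Integration.integral_diff)
        finally show ?thesis .
      qed
      ultimately have "(\<lambda>n. ((LINT x|N. exp (- (z + X (n + n0)) * complex_of_real x)) - (LINT x|N. exp (- z * complex_of_real x))) / X (n + n0))
         \<longlonglongrightarrow> (LINT x|N. - complex_of_real x * exp (- z * complex_of_real x))"
        by (simp add: Y_def)
      then show "((\<lambda>h. ((LINT x|N. exp (- (z + h) * complex_of_real x)) - (LINT x|N. exp (- z * complex_of_real x))) / h) \<circ> X)
         \<longlonglongrightarrow> (LINT x|N. - complex_of_real x * exp (- z * complex_of_real x))"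
        unfolding o_def by (rule LIMSEQ_offset)
    qed
    then show ?thesis unfolding DERIV_def .
  qed
  then show ?thesis
    by (subst holomorphic_on_open) (auto simp: open_halfspace_Re_gt)
qed

section \<open>Matrices\<close>

lemma matrix_inv_inverse:
  fixes A :: "'a::field ^ 'n ^ 'n"
  assumes "det A \<noteq> 0"
  shows "A ** matrix_inv A = mat 1" "matrix_inv A ** A = mat 1"
proof -
  have "\<exists>B. A ** B = mat 1 \<and> B ** A = mat 1" using assms by (simp add: invertible_det_nz[symmetric] invertible_def)
  from someI_ex[OF this] show "A ** matrix_inv A = mat 1" "matrix_inv A ** A = mat 1"
    unfolding matrix_inv_def by blast+
qed

lemma matrix_inv_unique_left:
  fixes A :: "'a::field ^ 'n ^ 'n"
  assumes "B ** A = mat 1"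
  shows "matrix_inv A = B"
proof -
  have "det B * det A = 1" using arg_cong[OF assms, of det] by (simp add: det_mul)
  then have "det A \<noteq> 0" by auto
  then have "matrix_inv A = (B ** A) ** matrix_inv A" by (simp add: assms)
  also have "\<dots> = B" using matrix_inv_inverse(1)[OF \<open>det A \<noteq> 0\<close>] by (simp add: matrix_mul_assoc[symmetric])
  finally show ?thesis .
qed

lemma det_eq_0_kernel:
  fixes A :: "'a::field ^ 'n ^ 'n"
  shows "det A = 0 \<longleftrightarrow> (\<exists>v. v \<noteq> 0 \<and> A *v v = 0)"
proof -
  have "det A \<noteq> 0 \<longleftrightarrow> (\<forall>v. A *v v = 0 \<longrightarrow> v = 0)"
    by (simp only: invertible_det_nz[symmetric] invertible_left_inverse matrix_left_invertible_ker)
  then show ?thesis by blast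
qed

text \<open>Cramer's rule with the j-th unit vector as right-hand side. It exhibits the entries of
  the resolvent as quotients of functions that are holomorphic wherever the matrix is, with poles
  only at zeros of the determinant.\<close>

lemma matrix_inv_entry:
  fixes A :: "'a::field ^ 'n ^ 'n"
  assumes "det A \<noteq> 0"
  shows "matrix_inv A $ i $ j = det (\<chi> k l. if l = i then (if k = j then 1 else 0) else A $ k $ l) / det A"
proof -
  define x where "x = (\<chi> k. matrix_inv A $ k $ j)"
  define b :: "'a ^ 'n" where "b = (\<chi> k. if k = j then 1 else 0)"
  have "A *v x = b"
  proof (rule vec_eq_iff[THEN iffD2], rule allI)
    fix k
    have "(A *v x) $ k = (A ** matrix_inv A) $ k $ j"
      by (simp add: matrix_vector_mult_def matrix_matrix_mult_def x_def)
    then show "(A *v x) $ k = b $ k" by (simp add: matrix_inv_inverse[OF assms] mat_def b_def)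
  qed
  then have "x = (\<chi> k. det (\<chi> r s. if s = k then b $ r else A $ r $ s) / det A)"
    using cramer[OF assms] by blast
  then have "x $ i = det (\<chi> r s. if s = i then b $ r else A $ r $ s) / det A" by simp
  moreover have "(\<chi> r s. if s = i then b $ r else A $ r $ s) = (\<chi> k l. if l = i then (if k = j then 1 else 0) else A $ k $ l)"
    by (simp add: vec_eq_iff b_def)
  ultimately show ?thesis by (simp add: x_def)
qed

lemma det_holomorphic:
  fixes A :: "complex \<Rightarrow> complex ^ 'n ^ 'n"
  assumes "\<And>i j. (\<lambda>z. A z $ i $ j) holomorphic_on S"
  shows "(\<lambda>z. det (A z)) holomorphic_on S"
  unfolding det_def
  by (intro holomorphic_on_sum holomorphic_on_mult holomorphic_on_const holomorphic_on_prod assms)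

lemma norm_det_le:
  fixes A :: "complex ^ 'n ^ 'n"
  assumes "\<And>i j. norm (A $ i $ j) \<le> B"
  shows "norm (det A) \<le> real (card {p. p permutes (UNIV :: 'n set)}) * B ^ CARD('n)"
proof -
  have "norm (det A) \<le> (\<Sum>p\<in>{p. p permutes (UNIV :: 'n set)}. norm (of_int (sign p) * (\<Prod>i\<in>UNIV. A $ i $ p i)))"
    unfolding det_def by (rule norm_sum)
  also have "\<dots> \<le> (\<Sum>p\<in>{p. p permutes (UNIV :: 'n set)}. B ^ CARD('n))"
  proof (rule sum_mono)
    fix p :: "'n \<Rightarrow> 'n"
    have "norm (of_int (sign p) * (\<Prod>i\<in>UNIV. A $ i $ p i)) = (\<Prod>i\<in>UNIV. norm (A $ i $ p i))"
      by (simp add: norm_mult sign_def prod_norm[symmetric])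
    also have "\<dots> \<le> (\<Prod>i\<in>(UNIV :: 'n set). B)"
      by (rule prod_mono) (use assms in auto)
    finally show "norm (of_int (sign p) * (\<Prod>i\<in>UNIV. A $ i $ p i)) \<le> B ^ CARD('n)" by simp
  qed
  finally show ?thesis by simp
qed

text \<open>\<open>cspectral_radius\<close> is a \<open>Max\<close>, which bounds the eigenvalues
  only if their set is finite. They are zeros of the entire function det (A - c) in a disc, and this
  function is not constant once it has a zero.\<close>

lemma finite_eigenvalues:
  fixes A :: "complex ^ 'n ^ 'n"
  shows "finite {c. \<exists>v. v \<noteq> 0 \<and> A *v v = c *s v}"
proof -
  define E where "E = {c. \<exists>v. v \<noteq> 0 \<and> A *v v = c *s v}"
  define K where "K = (\<Sum>i\<in>UNIV. \<Sum>j\<in>UNIV. norm (A $ i $ j))"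
  define d where "d c = det (A - mat c)" for c
  have matv: "mat c *v v = c *s v" for c and v :: "complex ^ 'n"
    by (simp add: vec_eq_iff matrix_vector_mult_def mat_def if_distrib if_distribR sum.delta' cong: if_cong)
  have E_iff: "c \<in> E \<longleftrightarrow> d c = 0" for c
    unfolding E_def d_def det_eq_0_kernel by (simp add: matrix_vector_mult_diff_rdistrib matv)
  have bound: "norm c \<le> K" if "c \<in> E" for c
  proof -
    from that obtain v where v: "v \<noteq> 0" "A *v v = c *s v" by (auto simp: E_def)
    \<comment> \<open>A coordinate of largest modulus, as in Gershgorin's theorem: row i of the
      eigenvalue equation then bounds |c|.\<close>
    obtain i where i: "\<And>j. norm (v $ j) \<le> norm (v $ i)"
    proof -
      let ?N = "range (\<lambda>j. norm (v $ j))"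
      have f: "finite ?N" by simp
      then have "Max ?N \<in> ?N" by (rule Max_in) simp
      then obtain i where "Max ?N = norm (v $ i)" by (elim rangeE)
      with Max_ge[OF f] have "norm (v $ j) \<le> norm (v $ i)" for j by (simp add: rangeI)
      then show ?thesis by (rule that)
    qed
    have vi: "norm (v $ i) > 0"
    proof (rule ccontr)
      assume "\<not> norm (v $ i) > 0"
      then have "v $ j = 0" for j using i[of j] by simp
      with v(1) show False by (simp add: vec_eq_iff)
    qed
    have "norm c * norm (v $ i) = norm ((A *v v) $ i)" by (simp add: v norm_mult)
    also have "\<dots> \<le> (\<Sum>j\<in>UNIV. norm (A $ i $ j * v $ j))"
      by (simp add: matrix_vector_mult_def norm_sum)
    also have "\<dots> \<le> (\<Sum>j\<in>UNIV. norm (A $ i $ j) * norm (v $ i))"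
      by (intro sum_mono) (simp add: norm_mult i mult_left_mono)
    also have "\<dots> = (\<Sum>j\<in>UNIV. norm (A $ i $ j)) * norm (v $ i)" by (simp add: sum_distrib_right)
    also have "\<dots> \<le> K * norm (v $ i)"
      unfolding K_def by (intro mult_right_mono member_le_sum) (auto intro: sum_nonneg)
    finally show ?thesis using vi by simp
  qed
  have "K \<ge> 0" by (simp add: K_def sum_nonneg)
  have "finite E"
  proof (cases "E = {}")
    case False
    then obtain c0 where c0: "d c0 = 0" using E_iff by blast
    \<comment> \<open>A point outside the disc that contains all eigenvalues, where \<open>d\<close>
      is therefore nonzero.\<close>
    have "complex_of_real (K + 1) \<notin> E" using bound \<open>K \<ge> 0\<close> by force
    then have c1: "d (complex_of_real (K + 1)) \<noteq> 0" by (simp add: E_iff)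
    have "finite {c \<in> cball 0 K. d c = 0}"
    proof (rule holomorphic_compact_finite_zeros[of d UNIV])
      show "d holomorphic_on UNIV"
        unfolding d_def
      proof (intro det_holomorphic)
        show "(\<lambda>c. (A - mat c) $ i $ j) holomorphic_on UNIV" for i j
          by (cases "i = j") (auto simp: mat_def intro!: holomorphic_intros)
      qed
      show "\<not> d constant_on UNIV" using c0 c1 unfolding constant_on_def by (metis UNIV_I)
    qed auto
    then show ?thesis
      by (rule finite_subset[rotated]) (use bound E_iff in \<open>auto simp: dist_norm\<close>)
  qed auto
  then show ?thesis by (simp add: E_def)
qed

lemma eigenvalue_le_cspectral_radius:
  assumes "v \<noteq> 0" "A *v v = c *s v"
  shows "norm c \<le> cspectral_radius A"
  unfolding cspectral_radius_def using assms by (intro Max_ge finite_imageI finite_eigenvalues) blast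

text \<open>The vector \<open>v = (1 - A)\<^sup>-\<^sup>1 1\<close>. It is positive since \<open>x t = (1 - t A)\<^sup>-\<^sup>1 1\<close> starts at \<open>x 0 = 1\<close>
  and satisfies \<open>x t = 1 + t A x t\<close>, so that it cannot leave the cone of positive vectors.\<close>

lemma supersolution:
  fixes A :: "'p::finite \<Rightarrow> 'p \<Rightarrow> real"
  assumes nonneg: "\<And>i j. A i j \<ge> 0" and rad: "cspectral_radius (\<chi> i j. complex_of_real (A i j)) < 1"
  shows "\<exists>v. \<forall>i. v i \<ge> 1 \<and> v i = 1 + (\<Sum>j\<in>UNIV. A i j * v j)"
proof -
  define M :: "real \<Rightarrow> real ^ 'p ^ 'p" where "M t = mat 1 - t *\<^sub>R (\<chi> i j. A i j)" for t
  have Mv: "(M t *v w) $ i = w $ i - t * (\<Sum>j\<in>UNIV. A i j * w $ j)" for t w i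
  proof -
    have "(M t *v w) $ i = (\<Sum>j\<in>UNIV. (if i = j then w $ j else 0) - t * (A i j * w $ j))"
      unfolding M_def matrix_vector_mult_def by (auto simp: mat_def algebra_simps intro!: sum.cong)
    then show ?thesis by (simp add: sum_subtractf sum_distrib_left)
  qed
  \<comment> \<open>For t > 0 a kernel vector of 1 - t A would be an eigenvector of A for 1/t \<ge>
    1, against \<open>rad\<close>.\<close>
  have nz: "det (M t) \<noteq> 0" if "t \<in> {0..1}" for t
  proof
    assume "det (M t) = 0"
    then obtain w where w: "w \<noteq> 0" "M t *v w = 0" unfolding det_eq_0_kernel by blast
    then have w2: "w $ i = t * (\<Sum>j\<in>UNIV. A i j * w $ j)" for i using Mv[of t w i] by simp
    have "t \<noteq> 0"
    proof
      assume t0: "t = 0"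
      have "w $ i = 0" for i by (subst w2) (simp add: t0)
      with w(1) show False by (simp add: vec_eq_iff)
    qed
    define w' where "w' = (\<chi> i. complex_of_real (w $ i))"
    have "w' \<noteq> 0" using w(1) by (simp add: w'_def vec_eq_iff)
    moreover have "(\<chi> i j. complex_of_real (A i j)) *v w' = complex_of_real (1 / t) *s w'"
    proof (rule vec_eq_iff[THEN iffD2], rule allI)
      fix i
      have "((\<chi> i j. complex_of_real (A i j)) *v w') $ i = complex_of_real (\<Sum>j\<in>UNIV. A i j * w $ j)"
        by (simp add: matrix_vector_mult_def w'_def)
      also have "(\<Sum>j\<in>UNIV. A i j * w $ j) = 1 / t * w $ i" by (subst w2) (simp add: \<open>t \<noteq> 0\<close>)
      finally show "((\<chi> i j. complex_of_real (A i j)) *v w') $ i = (complex_of_real (1 / t) *s w') $ i"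
        by (simp add: w'_def)
    qed
    ultimately have "norm (complex_of_real (1 / t)) \<le> cspectral_radius (\<chi> i j. complex_of_real (A i j))"
      by (rule eigenvalue_le_cspectral_radius)
    also note rad
    finally have "norm (complex_of_real (1 / t)) < 1" .
    with that \<open>t \<noteq> 0\<close> show False by (auto simp: norm_divide divide_simps split: if_splits)
  qed
  define x where "x t = matrix_inv (M t) *v 1" for t
  have x: "x t $ i = 1 + t * (\<Sum>j\<in>UNIV. A i j * x t $ j)" if "t \<in> {0..1}" for t i
  proof -
    have "M t *v x t = 1"
      unfolding x_def matrix_vector_mul_assoc matrix_inv_inverse[OF nz[OF that]] by simp
    then have "(M t *v x t) $ i = 1" by simp
    then show ?thesis unfolding Mv by simp
  qed
  have cont: "continuous_on {0..1} (\<lambda>t. x t $ i)" for i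
  proof -
    have detc: "continuous_on {0..1} (\<lambda>t. det (B t))"
      if "\<And>i j. continuous_on {0..1} (\<lambda>t. B t $ i $ j)" for B :: "real \<Rightarrow> real ^ 'p ^ 'p"
      unfolding det_def by (intro continuous_on_sum continuous_on_mult continuous_on_const continuous_on_prod that)
    have Mc: "continuous_on {0..1} (\<lambda>t. M t $ i $ j)" for i j
      unfolding M_def by (auto intro!: continuous_intros)
    have c: "continuous_on {0..1} (\<lambda>t. \<Sum>j\<in>UNIV. det (\<chi> k l. if l = i then (if k = j then 1 else 0) else M t $ k $ l) / det (M t))"
    proof (rule continuous_on_sum)
      fix j
      have "continuous_on {0..1} (\<lambda>t. det (\<chi> k l. if l = i then (if k = j then 1 else 0) else M t $ k $ l))"
      proof (rule detc)
        show "continuous_on {0..1} (\<lambda>t. (\<chi> k l. if l = i then if k = j then 1 else 0 else M t $ k $ l) $ i' $ j')" for i' j'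
          by (cases "j' = i") (simp_all add: Mc)
      qed
      then show "continuous_on {0..1} (\<lambda>t. det (\<chi> k l. if l = i then (if k = j then 1 else 0) else M t $ k $ l) / det (M t))"
        by (rule continuous_on_divide[OF _ detc[OF Mc]]) (use nz in blast)
    qed
    show ?thesis
      by (rule continuous_on_eq[OF c]) (simp add: x_def matrix_vector_mult_def matrix_inv_entry nz)
  qed
  define Q where "Q = {t \<in> {0..1}. \<forall>i. x t $ i > 0}"
  \<comment> \<open>As A is nonnegative, the equation x = 1 + t A x lifts positivity to the lower
    bound 1. The same set is thus given by an open and by a closed condition, and connectedness of
    [0,1] does the rest.\<close>
  have Q_eq: "Q = {t \<in> {0..1}. \<forall>i. x t $ i \<ge> 1}"
  proof -
    have "x t $ i \<ge> 1" if "t \<in> Q" for t i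
    proof -
      have "t * (\<Sum>j\<in>UNIV. A i j * x t $ j) \<ge> 0"
        using that nonneg by (intro mult_nonneg_nonneg sum_nonneg) (auto simp: Q_def less_imp_le)
      then show ?thesis using x[of t i] that by (simp add: Q_def)
    qed
    moreover have "x t $ i > 0" if "x t $ i \<ge> 1" for t i using that by linarith
    ultimately show ?thesis unfolding Q_def by blast
  qed
  have "openin (top_of_set {0..1}) Q"
  proof -
    have "Q = {0..1} \<inter> (\<Inter>i\<in>UNIV. {t \<in> {0..1}. x t $ i \<in> {0<..}})" by (auto simp: Q_def)
    moreover have "openin (top_of_set {0..1}) {t \<in> {0..1}. x t $ i \<in> {0<..}}" for i
    proof -
      have "{t \<in> {0..1}. x t $ i \<in> {0<..}} = {0..1} \<inter> (\<lambda>t. x t $ i) -` {0<..}" by blast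
      then show ?thesis using continuous_openin_preimage_gen[OF cont[of i], of "{0<..}"] by (simp only: open_greaterThan)
    qed
    ultimately show ?thesis using openin_INT[of UNIV "top_of_set {0..1}" "\<lambda>i. {t \<in> {0..1}. x t $ i \<in> {0<..}}"] by (simp add: Int_commute)
  qed
  moreover have "closedin (top_of_set {0..1}) Q"
  proof -
    have "Q = (\<Inter>i\<in>UNIV. {t \<in> {0..1}. x t $ i \<in> {1..}})" by (auto simp: Q_eq)
    moreover have "closedin (top_of_set {0..1}) {t \<in> {0..1}. x t $ i \<in> {1..}}" for i
    proof -
      have "{t \<in> {0..1}. x t $ i \<in> {1..}} = {0..1} \<inter> (\<lambda>t. x t $ i) -` {1..}" by blast
      then show ?thesis using continuous_closedin_preimage[OF cont[of i], of "{1..}"] by (simp only: closed_atLeast)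
    qed
    ultimately show ?thesis using closedin_INT[of UNIV "top_of_set {0..1}" "\<lambda>i. {t \<in> {0..1}. x t $ i \<in> {1..}}"] by simp
  qed
  moreover have "0 \<in> Q" using x[of 0] by (simp add: Q_def)
  ultimately have "Q = {0..1}"
    using connected_Icc[of 0 "1::real", unfolded connected_clopen, rule_format, of Q] by auto
  then have "1 \<in> Q" by simp
  then have "x 1 $ i \<ge> 1 \<and> x 1 $ i = 1 + (\<Sum>j\<in>UNIV. A i j * x 1 $ j)" for i
    using x[of 1 i] unfolding Q_eq by (metis (mono_tags, lifting) mem_Collect_eq mult_1)
  then show ?thesis by (intro exI[of _ "\<lambda>i. x 1 $ i"]) blast
qed

section \<open>Exponential polynomials as residues\<close>

text \<open>The argument is complex although only real times are inserted, so that bounds by complex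
  derivatives apply. \<open>K p\<close> counts coefficients, so degrees stay below
  \<open>K p\<close>.\<close>

definition exppoly :: "complex set \<Rightarrow> (complex \<Rightarrow> nat) \<Rightarrow> (complex \<Rightarrow> nat \<Rightarrow> complex) \<Rightarrow> complex \<Rightarrow> complex" where
  "exppoly P K c z = (\<Sum>p\<in>P. exp (p * z) * (\<Sum>k<K p. c p k * z ^ k))"

text \<open>Coefficients of the derivative in the same format: \<open>P\<close> and \<open>K\<close>
  are unchanged, because the leading coefficient has no successor and is only multiplied by p. This
  keeps the number of terms at a root equal to the order of the pole.\<close>

definition exppoly_deriv :: "(complex \<Rightarrow> nat) \<Rightarrow> (complex \<Rightarrow> nat \<Rightarrow> complex) \<Rightarrow> complex \<Rightarrow> nat \<Rightarrow> complex" where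
  "exppoly_deriv K c p k = p * c p k + (if Suc k < K p then of_nat (Suc k) * c p (Suc k) else 0)"

lemma poly_deriv_shift:
  fixes z :: complex
  shows "(\<Sum>k<n. c k * (of_nat k * z ^ (k - Suc 0))) = (\<Sum>k<n. (if Suc k < n then of_nat (Suc k) * c (Suc k) else 0) * z ^ k)"
proof (cases n)
  case (Suc m)
  have "(\<Sum>k<Suc m. c k * (of_nat k * z ^ (k - Suc 0))) = (\<Sum>k<m. c (Suc k) * (of_nat (Suc k) * z ^ k))"
    by (subst sum.lessThan_Suc_shift) simp
  also have "\<dots> = (\<Sum>k<Suc m. (if Suc k < Suc m then of_nat (Suc k) * c (Suc k) else 0) * z ^ k)"
    by (simp add: mult_ac)
  finally show ?thesis using Suc by simp
qed simp

lemma exppoly_has_field_derivative: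
  "(exppoly P K c has_field_derivative exppoly P K (exppoly_deriv K c) z) (at z)"
proof -
  have "((\<lambda>z. \<Sum>p\<in>P. exp (p * z) * (\<Sum>k<K p. c p k * z ^ k)) has_field_derivative
     (\<Sum>p\<in>P. exp (p * z) * p * (\<Sum>k<K p. c p k * z ^ k) + (\<Sum>k<K p. c p k * (of_nat k * z ^ (k - Suc 0))) * exp (p * z))) (at z)"
    by (auto intro!: derivative_eq_intros sum.cong simp: mult_ac)
  also have "(\<Sum>p\<in>P. exp (p * z) * p * (\<Sum>k<K p. c p k * z ^ k) + (\<Sum>k<K p. c p k * (of_nat k * z ^ (k - Suc 0))) * exp (p * z))
     = exppoly P K (exppoly_deriv K c) z"
    unfolding exppoly_def exppoly_deriv_def poly_deriv_shift
    by (intro sum.cong refl) (simp add: algebra_simps sum.distrib sum_distrib_left)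
  finally show ?thesis by (simp add: exppoly_def[abs_def])
qed

lemma power_le_fact_exp:
  fixes t :: real
  assumes "t \<ge> 0"
  shows "t ^ k \<le> fact k * exp t"
proof -
  have "(\<Sum>n\<in>{k}. t ^ n /\<^sub>R fact n) \<le> (\<Sum>n. t ^ n /\<^sub>R fact n)"
    by (rule sum_le_suminf[OF summable_exp_generic]) (use assms in auto)
  then have "t ^ k / fact k \<le> exp t" by (simp add: exp_def divide_inverse mult.commute)
  then show ?thesis by (simp add: divide_le_eq mult.commute)
qed

text \<open>The polynomial factors are paid for with a full factor exp t. This is crude, but in the
  main estimate it meets an exponentially small step that compensates the loss.\<close>

lemma exppoly_growth:
  assumes "\<And>p. p \<in> P \<Longrightarrow> Re p \<le> \<sigma>"
  shows "\<exists>C\<ge>0. \<forall>t\<ge>0. norm (exppoly P K c (complex_of_real t)) \<le> C * exp ((\<sigma> + 1) * t)"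
proof (intro exI conjI allI impI)
  let ?C = "\<Sum>p\<in>P. \<Sum>k<K p. norm (c p k) * fact k"
  show "?C \<ge> 0" by (intro sum_nonneg mult_nonneg_nonneg) auto
  fix t :: real assume t: "t \<ge> 0"
  have "norm (exppoly P K c (complex_of_real t)) \<le> (\<Sum>p\<in>P. norm (exp (p * complex_of_real t) * (\<Sum>k<K p. c p k * complex_of_real t ^ k)))"
    unfolding exppoly_def by (rule norm_sum)
  also have "\<dots> \<le> (\<Sum>p\<in>P. exp (\<sigma> * t) * (\<Sum>k<K p. norm (c p k) * fact k * exp t))"
  proof (rule sum_mono)
    fix p assume "p \<in> P"
    then have "Re p * t \<le> \<sigma> * t" using assms t by (intro mult_right_mono) auto
    moreover have "norm (\<Sum>k<K p. c p k * complex_of_real t ^ k) \<le> (\<Sum>k<K p. norm (c p k) * fact k * exp t)"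
    proof (rule sum_norm_le)
      fix k
      show "norm (c p k * complex_of_real t ^ k) \<le> norm (c p k) * fact k * exp t"
        using power_le_fact_exp[OF t, of k] t by (simp add: norm_mult norm_power mult_left_mono mult.assoc)
    qed
    ultimately show "norm (exp (p * complex_of_real t) * (\<Sum>k<K p. c p k * complex_of_real t ^ k)) \<le> exp (\<sigma> * t) * (\<Sum>k<K p. norm (c p k) * fact k * exp t)"
      unfolding norm_mult by (intro mult_mono) auto
  qed
  also have "\<dots> = ?C * (exp (\<sigma> * t) * exp t)"
    by (simp add: sum_distrib_left sum_distrib_right mult_ac)
  also have "exp (\<sigma> * t) * exp t = exp ((\<sigma> + 1) * t)" by (simp add: exp_add[symmetric] algebra_simps)
  finally show "norm (exppoly P K c (complex_of_real t)) \<le> ?C * exp ((\<sigma> + 1) * t)" .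
qed

text \<open>Taylor's formula of second order, by two applications of the mean value bound. The
  reference point w is free in [x,y], because t will be the left end of one step and the right end
  of another.\<close>

lemma exppoly_diff_quotient:
  assumes "\<And>p. p \<in> P \<Longrightarrow> Re p \<le> \<sigma>" and "\<sigma> + 1 \<ge> 0"
  shows "\<exists>C\<ge>0. \<forall>x y w. 0 \<le> x \<longrightarrow> x \<le> y \<longrightarrow> w \<in> {x..y} \<longrightarrow>
    norm (exppoly P K c (complex_of_real y) - exppoly P K c (complex_of_real x) - complex_of_real (y - x) * exppoly P K (exppoly_deriv K c) (complex_of_real w))
      \<le> C * (y - x)\<^sup>2 * exp ((\<sigma> + 1) * y)"
proof -
  let ?p = "exppoly P K (exppoly_deriv K c)" and ?q = "exppoly P K (exppoly_deriv K (exppoly_deriv K c))"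
  obtain C where C: "C \<ge> 0" "\<And>t. t \<ge> 0 \<Longrightarrow> norm (?q (complex_of_real t)) \<le> C * exp ((\<sigma> + 1) * t)"
    using exppoly_growth[OF assms(1)] by blast
  have "norm (exppoly P K c (complex_of_real y) - exppoly P K c (complex_of_real x) - complex_of_real (y - x) * ?p (complex_of_real w))
      \<le> C * (y - x)\<^sup>2 * exp ((\<sigma> + 1) * y)" if xy: "0 \<le> x" "x \<le> y" "w \<in> {x..y}" for x y w
  proof -
    define I where "I = complex_of_real ` {x..y}"
    have cI: "convex I" unfolding I_def by (intro convex_linear_image bounded_linear.linear[OF bounded_linear_of_real]) auto
    have e: "C * exp ((\<sigma> + 1) * t) \<le> C * exp ((\<sigma> + 1) * y)" if "t \<in> {x..y}" for t
      using that assms(2) C(1) by (intro mult_left_mono) (auto intro: mult_left_mono)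
    have 1: "norm (?p u - ?p v) \<le> C * exp ((\<sigma> + 1) * y) * norm (u - v)" if "u \<in> I" "v \<in> I" for u v
    proof (rule field_differentiable_bound[OF cI, of ?p ?q])
      fix z assume "z \<in> I"
      then obtain s where s: "z = complex_of_real s" "s \<in> {x..y}" by (auto simp: I_def)
      then have "norm (?q z) \<le> C * exp ((\<sigma> + 1) * s)" using C(2)[of s] xy(1) by simp
      also have "\<dots> \<le> C * exp ((\<sigma> + 1) * y)" by (rule e[OF s(2)])
      finally show "norm (?q z) \<le> C * exp ((\<sigma> + 1) * y)" .
    qed (use that in \<open>auto intro: has_field_derivative_at_within exppoly_has_field_derivative\<close>)
    define g where "g z = exppoly P K c z - z * ?p (complex_of_real w)" for z
    have "norm (g (complex_of_real y) - g (complex_of_real x)) \<le> C * exp ((\<sigma> + 1) * y) * (y - x) * norm (complex_of_real y - complex_of_real x)"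
    proof (rule field_differentiable_bound[OF cI, of g "\<lambda>z. ?p z - ?p (complex_of_real w)"])
      fix z assume z: "z \<in> I"
      show "(g has_field_derivative ?p z - ?p (complex_of_real w)) (at z within I)"
        unfolding g_def
        by (rule has_field_derivative_at_within)
           (auto intro!: derivative_eq_intros exppoly_has_field_derivative)
      have wI: "complex_of_real w \<in> I" using xy by (auto simp: I_def)
      from z obtain s where s: "z = complex_of_real s" "s \<in> {x..y}" by (auto simp: I_def)
      have "norm (z - complex_of_real w) \<le> y - x"
        using s xy by (simp add: of_real_diff[symmetric] abs_le_iff del: of_real_diff)
      then have "C * exp ((\<sigma> + 1) * y) * norm (z - complex_of_real w) \<le> C * exp ((\<sigma> + 1) * y) * (y - x)"
        by (rule mult_left_mono) (use C(1) in simp)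
      with 1[OF z wI] show "norm (?p z - ?p (complex_of_real w)) \<le> C * exp ((\<sigma> + 1) * y) * (y - x)"
        by (rule order_trans)
    qed (use xy in \<open>auto simp: I_def\<close>)
    also have "norm (complex_of_real y - complex_of_real x) = y - x"
      using xy by (simp add: of_real_diff[symmetric] del: of_real_diff)
    finally show ?thesis by (simp add: g_def algebra_simps power2_eq_square)
  qed
  with C(1) show ?thesis by blast
qed

lemma higher_deriv_exp_scaled: "(deriv ^^ i) (\<lambda>z. exp (z * a)) = (\<lambda>z::complex. a ^ i * exp (z * a))"
proof (induction i)
  case (Suc i)
  have "deriv (\<lambda>z. a ^ i * exp (z * a)) z = a ^ Suc i * exp (z * a)" for z
    by (rule DERIV_imp_deriv) (auto intro!: derivative_eq_intros)
  then show ?case by (simp add: Suc)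
qed simp

text \<open>As p is not 0, the weight 1/z^2 is holomorphic at p and merges with the regular part
  \<open>g\<close>. The residue is then a (k-1)-st derivative, and in Leibniz' rule each derivative
  of exp(z t) brings out one factor t.\<close>

lemma residue_exp_times_pole:
  assumes g: "open V" "p \<in> V" "g holomorphic_on V" "\<And>z. z \<in> V - {p} \<Longrightarrow> g z = (z - p) ^ k * R z"
    and k: "k \<ge> 1" and "p \<noteq> 0"
  shows "\<exists>c. \<forall>t. residue (\<lambda>z. exp (z * complex_of_real t) * R z / z\<^sup>2) p = exp (p * complex_of_real t) * (\<Sum>j<k. c j * complex_of_real t ^ j)"
proof -
  obtain n where n: "k = Suc n" using k by (cases k) auto
  define W where "W = V - {0}"
  have W: "open W" "p \<in> W" using g \<open>p \<noteq> 0\<close> by (auto simp: W_def open_delete)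
  define G where "G z = g z / z\<^sup>2" for z
  have G: "G holomorphic_on W"
    unfolding G_def using g(3) by (intro holomorphic_intros) (auto simp: W_def elim: holomorphic_on_subset)
  define c where "c j = of_nat (n choose j) * (deriv ^^ (n - j)) G p / fact n" for j
  have "residue (\<lambda>z. exp (z * complex_of_real t) * R z / z\<^sup>2) p = exp (p * complex_of_real t) * (\<Sum>j<k. c j * complex_of_real t ^ j)" for t
  proof -
    define E where "E z = exp (z * complex_of_real t)" for z
    have E: "E holomorphic_on W" unfolding E_def by (intro holomorphic_intros)
    have "residue (\<lambda>z. exp (z * complex_of_real t) * R z / z\<^sup>2) p = residue (\<lambda>z. (E z * G z) / (z - p) ^ Suc n) p"
    proof (rule residue_cong[OF _ refl])
      have "\<forall>\<^sub>F z in at p. z \<in> W" using W by (rule eventually_at_in_open')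
      moreover have "\<forall>\<^sub>F z in at p. z \<noteq> p" by (simp add: eventually_at_filter)
      ultimately show "\<forall>\<^sub>F z in at p. exp (z * complex_of_real t) * R z / z\<^sup>2 = (E z * G z) / (z - p) ^ Suc n"
      proof eventually_elim
        case (elim z)
        then have "g z = (z - p) ^ Suc n * R z" using g(4)[of z] n by (simp add: W_def)
        moreover have "(z - p) ^ Suc n \<noteq> 0" using elim by simp
        ultimately show ?case unfolding E_def G_def by (simp only:) (simp add: field_simps del: power_Suc)
      qed
    qed
    also have "\<dots> = (deriv ^^ n) (\<lambda>z. E z * G z) p / fact n"
      by (rule residue_holomorphic_over_power[OF W]) (intro holomorphic_intros E G)
    also have "(deriv ^^ n) (\<lambda>z. E z * G z) p = (\<Sum>i = 0..n. of_nat (n choose i) * (deriv ^^ i) E p * (deriv ^^ (n - i)) G p)"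
      by (rule higher_deriv_mult[OF E G W])
    also have "\<dots> / fact n = E p * (\<Sum>j<k. c j * complex_of_real t ^ j)"
      unfolding E_def[abs_def] higher_deriv_exp_scaled n c_def lessThan_Suc_atMost atMost_atLeast0
      by (simp add: sum_divide_distrib sum_distrib_left mult_ac)
    finally show ?thesis by (simp add: E_def)
  qed
  then show ?thesis by blast
qed

section \<open>Asymptotics of a renewal function\<close>

lemma nn_integral_reflect_even:
  fixes f :: "real \<Rightarrow> ennreal"
  assumes [measurable]: "f \<in> borel_measurable borel"
  shows "(\<integral>\<^sup>+x. f \<bar>x\<bar> \<partial>lborel) \<le> 2 * (\<integral>\<^sup>+x\<in>{0..}. f x \<partial>lborel)"
proof -
  have "(\<integral>\<^sup>+x. f \<bar>x\<bar> \<partial>lborel) \<le> (\<integral>\<^sup>+x. f x * indicator {0..} x + f (- x) * indicator {0..} (- x) \<partial>lborel)"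
    by (intro nn_integral_mono) (auto simp: indicator_def abs_if)
  also have "\<dots> = (\<integral>\<^sup>+x\<in>{0..}. f x \<partial>lborel) + (\<integral>\<^sup>+x. f (- x) * indicator {0..} (- x) \<partial>lborel)"
    by (subst nn_integral_add) auto
  also have "(\<integral>\<^sup>+x. f (- x) * indicator {0..} (- x) \<partial>lborel) = (\<integral>\<^sup>+x\<in>{0..}. f x \<partial>lborel)"
    using nn_integral_real_affine[of "\<lambda>x. f x * indicator {0..} x" "-1" 0] by simp
  finally show ?thesis by (simp add: mult_2)
qed

lemma integrable_powr_neg:
  fixes q :: real
  assumes "q > 1"
  shows "integrable lborel (\<lambda>y::real. (1 + \<bar>y\<bar>) powr (- q))"
proof (rule integrableI_bounded)
  have "(\<integral>\<^sup>+y\<in>{0..}. ennreal ((1 + y) powr (- q)) \<partial>lborel) = ennreal (0 - (1 + 0) powr (1 - q) / (1 - q))"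
  proof (rule nn_integral_FTC_atLeast)
    fix x :: real assume "0 \<le> x"
    then show "((\<lambda>y. (1 + y) powr (1 - q) / (1 - q)) has_real_derivative (1 + x) powr (- q)) (at x)"
      using assms by (auto intro!: derivative_eq_intros)
  next
    show "((\<lambda>y. (1 + y) powr (1 - q) / (1 - q)) \<longlongrightarrow> 0) at_top"
    proof -
      have "((\<lambda>y. (1 + y) powr (1 - q)) \<longlongrightarrow> 0) at_top"
        by (rule tendsto_neg_powr) (use assms in \<open>auto intro!: filterlim_tendsto_add_at_top[OF tendsto_const] filterlim_ident\<close>)
      from tendsto_divide[OF this tendsto_const, of "1 - q"] show ?thesis using assms by simp
    qed
  qed auto
  then have fin: "(\<integral>\<^sup>+y\<in>{0..}. ennreal ((1 + y) powr (- q)) \<partial>lborel) < \<infinity>" by simp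
  have "(\<integral>\<^sup>+y. ennreal (norm ((1 + \<bar>y\<bar>) powr (- q))) \<partial>lborel) = (\<integral>\<^sup>+y. (\<lambda>x. ennreal ((1 + x) powr (- q))) \<bar>y\<bar> \<partial>lborel)"
    by simp
  also have "\<dots> \<le> 2 * (\<integral>\<^sup>+y\<in>{0..}. ennreal ((1 + y) powr (- q)) \<partial>lborel)"
    by (rule nn_integral_reflect_even) measurable
  also have "\<dots> < \<infinity>" using fin by (simp add: ennreal_mult_less_top)
  finally show "(\<integral>\<^sup>+y. ennreal (norm ((1 + \<bar>y\<bar>) powr (- q))) \<partial>lborel) < \<infinity>" .
qed measurable

lemma integrable_norm_powr_vertical:
  assumes "c > 0" "q > 1"
  shows "integrable lborel (\<lambda>y. norm (Complex c y) powr (- q))"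
proof (rule Bochner_Integration.integrable_bound)
  \<comment> \<open>\<open>m\<close> serves in |c + iy| \<ge> m (1 + |y|): the modulus dominates
    both c and |y|, hence half their sum.\<close>
  define m where "m = min c 1 / 2"
  have m: "m > 0" using assms by (simp add: m_def)
  show "integrable lborel (\<lambda>y. m powr (- q) * (1 + \<bar>y\<bar>) powr (- q))"
    by (intro integrable_mult_right integrable_powr_neg assms)
  show "AE y in lborel. norm (norm (Complex c y) powr (- q)) \<le> norm (m powr (- q) * (1 + \<bar>y\<bar>) powr (- q))"
  proof (rule AE_I2)
    fix y
    have "min c 1 * (1 + \<bar>y\<bar>) \<le> c + \<bar>y\<bar>"
    proof (cases "c \<le> 1")
      case True
      then show ?thesis using assms mult_right_mono[of c 1 "\<bar>y\<bar>"] by (simp add: algebra_simps)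
    qed auto
    moreover have "c \<le> norm (Complex c y)" "\<bar>y\<bar> \<le> norm (Complex c y)"
      using abs_Re_le_cmod[of "Complex c y"] abs_Im_le_cmod[of "Complex c y"] by auto
    ultimately have "m * (1 + \<bar>y\<bar>) \<le> norm (Complex c y)" by (simp add: m_def)
    moreover have "m * (1 + \<bar>y\<bar>) > 0" using m by (simp add: add_pos_nonneg)
    ultimately have "norm (Complex c y) powr (- q) \<le> (m * (1 + \<bar>y\<bar>)) powr (- q)"
      using assms by (intro powr_mono2') auto
    then show "norm (norm (Complex c y) powr (- q)) \<le> norm (m powr (- q) * (1 + \<bar>y\<bar>) powr (- q))"
      using m by (simp add: powr_mult)
  qed
  have "continuous_on UNIV (\<lambda>y. norm (Complex c y))"
    unfolding Complex_eq by (intro continuous_intros)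
  then have [measurable]: "(\<lambda>y. norm (Complex c y)) \<in> borel_measurable borel"
    by (rule borel_measurable_continuous_onI)
  show "(\<lambda>y. norm (Complex c y) powr (- q)) \<in> borel_measurable lborel"
    by measurable
qed

text \<open>Interpolates between |w| exp |w| for small w and the boundedness of exp w - 1 on the
  line. The power \<open>g\<close> instead of 1 leaves an integrand of order |z|^(g-2), which is
  integrable along the line for \<open>g < 1\<close>.\<close>

lemma norm_exp_diff_le_powr:
  assumes "0 < c" "0 < d" "d \<le> 1" "0 < g" "g \<le> 1" "Re z = c"
  shows "norm (exp (z * complex_of_real d) - 1) \<le> (exp 1 + 1 + exp c) * (d powr g * norm z powr g)"
proof -
  define w where "w = z * complex_of_real d"
  have nw: "norm w powr g = d powr g * norm z powr g" using assms by (simp add: w_def norm_mult powr_mult mult.commute)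
  have "norm (exp w - 1) \<le> (exp 1 + 1 + exp c) * norm w powr g"
  proof (cases "norm w \<le> 1")
    case True
    have z0: "norm w > 0" using assms by (auto simp: w_def)
    have "norm (exp w - 1) \<le> norm w * exp (norm w)" by (rule norm_exp_diff_le)
    also have "\<dots> \<le> norm w powr g * exp 1"
    proof (rule mult_mono)
      have "norm w powr 1 \<le> norm w powr g" using True assms by (intro powr_mono') auto
      then show "norm w \<le> norm w powr g" using z0 by simp
    qed (use True in auto)
    also have "\<dots> \<le> norm w powr g * (exp 1 + 1 + exp c)" by (intro mult_left_mono) (auto intro: add_nonneg_nonneg)
    also have "\<dots> = (exp 1 + 1 + exp c) * norm w powr g" by (rule mult.commute)
    finally show ?thesis .
  next
    case False
    have "norm (exp w - 1) \<le> norm (exp w) + 1" using norm_triangle_ineq4[of "exp w" 1] by simp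
    also have "norm (exp w) = exp (c * d)" using assms by (simp add: w_def)
    also have "exp (c * d) + 1 \<le> exp 1 + 1 + exp c" using assms by (simp add: add_increasing)
    finally have "norm (exp w - 1) \<le> (exp 1 + 1 + exp c) * 1" by simp
    also have "\<dots> \<le> (exp 1 + 1 + exp c) * norm w powr g"
      using False assms by (intro mult_left_mono ge_one_powr_ge_zero) (auto intro: add_nonneg_nonneg)
    finally show ?thesis .
  qed
  then show ?thesis by (simp add: nw w_def[symmetric])
qed

lemma perron_integral_increment:
  fixes R :: "complex \<Rightarrow> complex"
  assumes c: "c > 0" and g: "0 < g" "g < 1"
    and bound: "\<And>y. norm (R (Complex c y)) \<le> B"
    and int: "\<And>t. integrable lborel (\<lambda>y. exp (Complex c y * complex_of_real t) * R (Complex c y) / (Complex c y)\<^sup>2)"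
  shows "\<exists>C\<ge>0. \<forall>t d. 0 < d \<longrightarrow> d \<le> 1 \<longrightarrow>
    norm ((LBINT y. exp (Complex c y * complex_of_real (t + d)) * R (Complex c y) / (Complex c y)\<^sup>2)
      - (LBINT y. exp (Complex c y * complex_of_real t) * R (Complex c y) / (Complex c y)\<^sup>2)) \<le> C * exp (c * t) * d powr g"
proof -
  define h where "h t y = exp (Complex c y * complex_of_real t) * R (Complex c y) / (Complex c y)\<^sup>2" for t y
  define A where "A = exp 1 + 1 + exp c"
  have A: "A > 0" unfolding A_def by (intro add_pos_pos) auto
  have B: "B \<ge> 0" using bound[of 0] norm_ge_zero order_trans by blast
  define I where "I = (LBINT y. norm (Complex c y) powr (- (2 - g)))"
  have iI: "integrable lborel (\<lambda>y. norm (Complex c y) powr (- (2 - g)))"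
    using c g by (intro integrable_norm_powr_vertical) auto
  have I0: "I \<ge> 0" unfolding I_def by (intro integral_nonneg_AE) simp
  have "norm ((LBINT y. h (t + d) y) - (LBINT y. h t y)) \<le> (A * B * I) * exp (c * t) * d powr g"
    if d: "0 < d" "d \<le> 1" for t d
  proof -
    have ptw: "norm (h (t + d) y - h t y) \<le> exp (c * t) * A * B * d powr g * norm (Complex c y) powr (- (2 - g))" for y
    proof -
      define z where "z = Complex c y"
      have z: "Re z = c" "norm z > 0" using c by (auto simp: z_def complex_eq_iff)
      have "h (t + d) y - h t y = exp (z * complex_of_real t) * (exp (z * complex_of_real d) - 1) * R z / z\<^sup>2"
        by (simp add: h_def z_def[symmetric] exp_add algebra_simps diff_divide_distrib)
      then have "norm (h (t + d) y - h t y) = exp (c * t) * norm (exp (z * complex_of_real d) - 1) * norm (R z) / (norm z)\<^sup>2"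
        by (simp add: norm_mult norm_divide norm_power z)
      also have "\<dots> \<le> exp (c * t) * (A * (d powr g * norm z powr g)) * B / (norm z)\<^sup>2"
        using norm_exp_diff_le_powr[OF c d g(1) less_imp_le[OF g(2)] z(1)] bound[of y] A B unfolding A_def[symmetric]
        by (intro divide_right_mono mult_mono mult_left_mono) (auto simp: z_def[symmetric])
      also have "\<dots> = exp (c * t) * A * B * d powr g * (norm z powr g / norm z powr 2)"
        using z(2) by (subst powr_numeral) auto
      also have "norm z powr g / norm z powr 2 = norm z powr (- (2 - g))"
        by (simp only: powr_diff[symmetric] minus_diff_eq)
      finally show ?thesis by (simp add: z_def)
    qed
    have "(LBINT y. h (t + d) y) - (LBINT y. h t y) = (LBINT y. h (t + d) y - h t y)"
      using int unfolding h_def by (intro Bochner_Integration.integral_diff[symmetric])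
    also have "norm \<dots> \<le> (LBINT y. norm (h (t + d) y - h t y))" by (rule integral_norm_bound)
    also have "\<dots> \<le> (LBINT y. exp (c * t) * A * B * d powr g * norm (Complex c y) powr (- (2 - g)))"
      using int unfolding h_def[symmetric]
      by (intro integral_mono integrable_norm Bochner_Integration.integrable_diff integrable_mult_right iI ptw)
    also have "\<dots> = (A * B * I) * exp (c * t) * d powr g" by (simp add: I_def)
    finally show ?thesis .
  qed
  then show ?thesis using A B I0 unfolding h_def by (intro exI[of _ "A * B * I"]) auto
qed

section \<open>Laplace inversion for measures with a finite exponential moment\<close>

lemma laplace_finite_on_bounded:
  fixes U :: "real measure"
  assumes sets: "sets U = sets borel" and int: "integrable U (\<lambda>x. exp (- \<sigma> * x))" and "\<sigma> \<ge> 0"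
  shows "emeasure U {..t} < \<infinity>"
proof -
  have "emeasure U {..t} = (\<integral>\<^sup>+x. indicator {..t} x \<partial>U)" using sets by simp
  also have "\<dots> \<le> (\<integral>\<^sup>+x. ennreal (exp (\<sigma> * t)) * ennreal (exp (- \<sigma> * x)) \<partial>U)"
  proof (rule nn_integral_mono)
    fix x
    have "1 \<le> exp (\<sigma> * t) * exp (- \<sigma> * x)" if "x \<le> t"
      using that \<open>\<sigma> \<ge> 0\<close> by (simp add: exp_add[symmetric] mult_left_mono)
    then show "indicator {..t} x \<le> ennreal (exp (\<sigma> * t)) * ennreal (exp (- \<sigma> * x))"
      by (auto simp: indicator_def ennreal_mult[symmetric])
  qed
  also have "\<dots> = ennreal (exp (\<sigma> * t)) * (\<integral>\<^sup>+x. ennreal (exp (- \<sigma> * x)) \<partial>U)"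
    using int by (intro nn_integral_cmult) auto
  also have "\<dots> < \<infinity>"
    using int by (auto simp: ennreal_mult_less_top integrable_iff_bounded)
  finally show ?thesis .
qed

lemma laplace_finite_sigma_finite:
  fixes U :: "real measure"
  assumes "sets U = sets borel" "integrable U (\<lambda>x. exp (- \<sigma> * x))" "\<sigma> \<ge> 0"
  shows "sigma_finite_measure U"
proof
  have "space U = UNIV" using sets_eq_imp_space_eq[OF assms(1)] by simp
  moreover have "\<exists>n::nat. x \<le> real n" for x :: real by (rule real_arch_simple)
  moreover have "emeasure U {..t} \<noteq> \<infinity>" for t using laplace_finite_on_bounded[OF assms, of t] by simp
  ultimately show "\<exists>A. countable A \<and> A \<subseteq> sets U \<and> \<Union> A = space U \<and> (\<forall>a\<in>A. emeasure U a \<noteq> \<infinity>)"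
    using assms(1) by (intro exI[of _ "range (\<lambda>n::nat. {..real n})"]) auto
qed

text \<open>Fubini applied to the ramp formula at t - x. The modulus of the integrand factorises
  into multiples of exp(-\<sigma> x) and 1/(\<sigma>^2 + y^2), each integrable for its own
  measure.\<close>

lemma perron_laplace:
  fixes U :: "real measure" and R :: "complex \<Rightarrow> complex"
  assumes sets: "sets U = sets borel" and int: "integrable U (\<lambda>x. exp (- \<sigma> * x))" and "\<sigma> > 0"
    and R: "\<And>y. (LINT x|U. exp (- Complex \<sigma> y * complex_of_real x)) = R (Complex \<sigma> y)"
  shows "2 * pi * (LINT x|U. max (t - x) 0) = (LBINT y. exp (Complex \<sigma> y * complex_of_real t) * R (Complex \<sigma> y) / (Complex \<sigma> y)\<^sup>2)"
    and "integrable lborel (\<lambda>y. exp (Complex \<sigma> y * complex_of_real t) * R (Complex \<sigma> y) / (Complex \<sigma> y)\<^sup>2)"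
proof -
  interpret U: sigma_finite_measure U
    using laplace_finite_sigma_finite[OF sets int] \<open>\<sigma> > 0\<close> by simp
  interpret P: pair_sigma_finite U lborel ..
  have [measurable_cong]: "sets U = sets borel" by (rule sets)
  define h where "h x y = exp (Complex \<sigma> y * complex_of_real (t - x)) / (Complex \<sigma> y)\<^sup>2" for x y
  have "continuous_on UNIV (\<lambda>p. exp (Complex \<sigma> (snd p) * complex_of_real (t - fst p)) / (Complex \<sigma> (snd p))\<^sup>2)"
  proof (intro continuous_on_divide)
    have cz: "continuous_on UNIV (\<lambda>p::real \<times> real. Complex \<sigma> (snd p))"
      unfolding Complex_eq by (intro continuous_intros)
    have "Complex \<sigma> y \<noteq> 0" for y using \<open>\<sigma> > 0\<close> by (simp add: complex_eq_iff)
    then show "\<forall>p\<in>UNIV. (Complex \<sigma> (snd p))\<^sup>2 \<noteq> 0" by simp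
    show "continuous_on UNIV (\<lambda>p::real \<times> real. (Complex \<sigma> (snd p))\<^sup>2)" by (intro continuous_intros cz)
    show "continuous_on UNIV (\<lambda>p. exp (Complex \<sigma> (snd p) * complex_of_real (t - fst p)))"
      by (intro continuous_intros cz)
  qed
  then have hb: "case_prod h \<in> borel_measurable (borel \<Otimes>\<^sub>M borel)"
    unfolding h_def case_prod_beta' borel_prod by (rule borel_measurable_continuous_onI)
  then have hm[measurable]: "case_prod h \<in> borel_measurable (U \<Otimes>\<^sub>M lborel)" by measurable
  have hm': "case_prod h \<in> borel_measurable (borel \<Otimes>\<^sub>M lborel)"
    using hb by measurable
  have nh: "norm (h x y) = exp (\<sigma> * t) * exp (- \<sigma> * x) * (1 / (\<sigma>\<^sup>2 + y\<^sup>2))" for x y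
    by (simp add: h_def norm_divide norm_power cmod_power2 exp_add[symmetric] algebra_simps)
  have i1: "integrable lborel (\<lambda>y. 1 / (\<sigma>\<^sup>2 + y\<^sup>2))"
  proof -
    have "integrable lborel (\<lambda>y. norm (Complex \<sigma> y) powr (- 2))"
      by (rule integrable_norm_powr_vertical) (use \<open>\<sigma> > 0\<close> in auto)
    moreover have "norm (Complex \<sigma> y) powr (- 2) = 1 / (\<sigma>\<^sup>2 + y\<^sup>2)" for y
    proof -
      have "norm (Complex \<sigma> y) > 0" using \<open>\<sigma> > 0\<close> by (auto simp: complex_eq_iff)
      then have "norm (Complex \<sigma> y) powr (- 2) = 1 / (norm (Complex \<sigma> y))\<^sup>2"
        by (simp add: powr_minus_divide)
      then show ?thesis by (simp add: cmod_power2)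
    qed
    ultimately show ?thesis by simp
  qed
  have ih: "integrable (U \<Otimes>\<^sub>M lborel) (case_prod h)"
  proof (rule P.Fubini_integrable[OF hm])
    show "integrable U (\<lambda>x. LBINT y. norm (case_prod h (x, y)))"
      unfolding prod.case nh integral_mult_right_zero by (intro integrable_mult_left integrable_mult_right int)
    show "AE x in U. integrable lborel (\<lambda>y. case_prod h (x, y))"
    proof (rule AE_I2)
      fix x
      have "integrable lborel (\<lambda>y. norm (h x y))" unfolding nh by (intro integrable_mult_right i1)
      then show "integrable lborel (\<lambda>y. case_prod h (x, y))"
        using measurable_Pair2[OF hb, of x] by (subst integrable_norm_iff[symmetric]) simp_all
    qed
  qed
  have hR: "(LINT x|U. h x y) = exp (Complex \<sigma> y * complex_of_real t) * R (Complex \<sigma> y) / (Complex \<sigma> y)\<^sup>2" for y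
  proof -
    have "h x y = exp (Complex \<sigma> y * complex_of_real t) / (Complex \<sigma> y)\<^sup>2 * exp (- Complex \<sigma> y * complex_of_real x)" for x
      by (simp add: h_def exp_add[symmetric] algebra_simps)
    then show ?thesis by (simp add: R[symmetric])
  qed
  have "(LBINT y. (LINT x|U. h x y)) = (LINT x|U. (LBINT y. h x y))"
    by (rule P.Fubini_integral[OF ih])
  also have "\<dots> = (LINT x|U. complex_of_real (2 * pi * max (t - x) 0))"
    unfolding h_def perron_ramp[OF \<open>\<sigma> > 0\<close>] ..
  also have "\<dots> = 2 * pi * (LINT x|U. max (t - x) 0)"
    by (simp only: integral_complex_of_real integral_mult_right_zero)
  finally show "2 * pi * (LINT x|U. max (t - x) 0) = (LBINT y. exp (Complex \<sigma> y * complex_of_real t) * R (Complex \<sigma> y) / (Complex \<sigma> y)\<^sup>2)"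
    by (simp only: hR)
  show "integrable lborel (\<lambda>y. exp (Complex \<sigma> y * complex_of_real t) * R (Complex \<sigma> y) / (Complex \<sigma> y)\<^sup>2)"
    using P.integrable_snd[OF ih] by (simp only: hR)
qed

lemma bounded_on_vertical_line:
  fixes R :: "complex \<Rightarrow> complex"
  assumes "continuous_on {z. Re z = c} R" "\<And>z. Re z = c \<Longrightarrow> T \<le> \<bar>Im z\<bar> \<Longrightarrow> norm (R z) \<le> B"
  shows "\<exists>B'. \<forall>y. norm (R (Complex c y)) \<le> B'"
proof -
  have "compact (R ` (Complex c ` {- \<bar>T\<bar>..\<bar>T\<bar>}))"
  proof (intro compact_continuous_image)
    show "continuous_on {- \<bar>T\<bar>..\<bar>T\<bar>} (Complex c)" unfolding Complex_eq[abs_def] by (intro continuous_intros)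
    show "continuous_on (Complex c ` {- \<bar>T\<bar>..\<bar>T\<bar>}) R" by (rule continuous_on_subset[OF assms(1)]) auto
  qed simp
  from compact_imp_bounded[OF this]
  obtain B1 where "\<forall>z\<in>R ` (Complex c ` {- \<bar>T\<bar>..\<bar>T\<bar>}). norm z \<le> B1"
    unfolding bounded_iff by (elim exE)
  then have B1: "norm z \<le> B1" if "z \<in> R ` (Complex c ` {- \<bar>T\<bar>..\<bar>T\<bar>})" for z using that by (rule bspec)
  have "norm (R (Complex c y)) \<le> max B B1" for y
  proof (cases "T \<le> \<bar>y\<bar>")
    case True
    then show ?thesis using assms(2)[of "Complex c y"] by (simp add: le_max_iff_disj)
  next
    case False
    then have "y \<in> {- \<bar>T\<bar>..\<bar>T\<bar>}" by auto
    then show ?thesis using B1 by (simp add: le_max_iff_disj)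
  qed
  then show ?thesis by blast
qed

text \<open>Since 0 \<le> a < c, the double pole of 1/z^2 at 0 is not crossed, and only the points
  of \<open>P\<close> leave residues. The bound on R at large height supplies the decay that the
  shift requires.\<close>

lemma laplace_inversion_shifted:
  fixes U :: "real measure" and R :: "complex \<Rightarrow> complex"
  assumes sets: "sets U = sets borel" and int: "integrable U (\<lambda>x. exp (- \<sigma> * x))"
    and R: "\<And>y. (LINT x|U. exp (- Complex \<sigma> y * complex_of_real x)) = R (Complex \<sigma> y)"
    and ac: "0 \<le> a" "a < c" "c < \<sigma>"
    and P: "finite P" "P \<subseteq> {z. c < Re z \<and> Re z < \<sigma>}"
    and holR: "R holomorphic_on {z. Re z > a} - P"
    and bR: "\<And>z. c \<le> Re z \<Longrightarrow> Re z \<le> \<sigma> \<Longrightarrow> T \<le> \<bar>Im z\<bar> \<Longrightarrow> norm (R z) \<le> B"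
  shows "2 * pi * (LINT x|U. max (t - x) 0) =
      2 * pi * (\<Sum>p\<in>P. residue (\<lambda>z. exp (z * complex_of_real t) * R z / z\<^sup>2) p)
      + (LBINT y. exp (Complex c y * complex_of_real t) * R (Complex c y) / (Complex c y)\<^sup>2)"
    and "integrable lborel (\<lambda>y. exp (Complex c y * complex_of_real t) * R (Complex c y) / (Complex c y)\<^sup>2)"
    and "\<exists>B'. \<forall>y. norm (R (Complex c y)) \<le> B'"
proof -
  define h where "h z = exp (z * complex_of_real t) * R z / z\<^sup>2" for z
  have cpos: "c > 0" "\<sigma> > 0" using ac by auto
  have "continuous_on {z. Re z = c} R"
    by (rule holomorphic_on_imp_continuous_on, rule holomorphic_on_subset[OF holR]) (use ac P in auto)
  then show ex: "\<exists>B'. \<forall>y. norm (R (Complex c y)) \<le> B'"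
    by (rule bounded_on_vertical_line[where T=T and B=B]) (use bR ac in auto)
  then obtain B' where B': "\<And>y. norm (R (Complex c y)) \<le> B'" by blast
  have hol: "h holomorphic_on {z. Re z > a} - P"
    unfolding h_def using holR ac by (intro holomorphic_intros) auto
  have intc: "integrable lborel (\<lambda>y. h (Complex c y))"
  proof (rule Bochner_Integration.integrable_bound)
    show "integrable lborel (\<lambda>y. exp (c * t) * B' * norm (Complex c y) powr (- 2))"
      by (intro integrable_mult_right integrable_norm_powr_vertical cpos) simp
    have "continuous_on {z. Re z = c} h"
      by (rule holomorphic_on_imp_continuous_on, rule holomorphic_on_subset[OF hol]) (use ac P in auto)
    then have "continuous_on UNIV (\<lambda>y. h (Complex c y))"
      by (rule continuous_on_compose2) (auto simp: Complex_eq intro!: continuous_intros)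
    then show "(\<lambda>y. h (Complex c y)) \<in> borel_measurable lborel"
      using borel_measurable_continuous_onI by simp
    show "AE y in lborel. norm (h (Complex c y)) \<le> norm (exp (c * t) * B' * norm (Complex c y) powr (- 2))"
    proof (rule AE_I2)
      fix y
      have z: "norm (Complex c y) > 0" using cpos by (auto simp: complex_eq_iff)
      have "norm (h (Complex c y)) = exp (c * t) * norm (R (Complex c y)) / (norm (Complex c y))\<^sup>2"
        by (simp add: h_def norm_mult norm_divide norm_power)
      also have "\<dots> \<le> exp (c * t) * B' / (norm (Complex c y))\<^sup>2"
        by (intro divide_right_mono mult_left_mono B') auto
      also have "\<dots> = exp (c * t) * B' * norm (Complex c y) powr (- 2)"
        using z by (simp add: powr_minus_divide)
      finally show "norm (h (Complex c y)) \<le> norm (exp (c * t) * B' * norm (Complex c y) powr (- 2))" by simp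
    qed
  qed
  then show "integrable lborel (\<lambda>y. exp (Complex c y * complex_of_real t) * R (Complex c y) / (Complex c y)\<^sup>2)"
    by (simp only: h_def)
  have "(LBINT y. h (Complex \<sigma> y)) - (LBINT y. h (Complex c y)) = 2 * pi * (\<Sum>p\<in>P. residue h p)"
  proof (rule vertical_line_shift[where A="{z. Re z > a}" and T="max 1 T" and C="exp (\<bar>t\<bar> * \<sigma>) * B"])
    show "connected {z. Re z > a}" using convex_halfspace_Re_gt convex_connected by blast
    show "{z. c \<le> Re z \<and> Re z \<le> \<sigma>} \<subseteq> {z. Re z > a}" using ac by auto
    show "integrable lborel (\<lambda>y. h (Complex \<sigma> y))"
      using perron_laplace(2)[OF sets int cpos(2) R] by (simp only: h_def)
    fix z assume z: "c \<le> Re z" "Re z \<le> \<sigma>" "max 1 T \<le> \<bar>Im z\<bar>"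
    have "Im z \<noteq> 0" using z by auto
    then have im: "(Im z)\<^sup>2 > 0" "(Im z)\<^sup>2 \<le> (norm z)\<^sup>2" by (simp_all add: cmod_power2)
    have "Re z * t \<le> \<bar>t\<bar> * \<sigma>"
    proof -
      have "Re z * t \<le> Re z * \<bar>t\<bar>" using z cpos by (intro mult_left_mono) auto
      also have "\<dots> \<le> \<bar>t\<bar> * \<sigma>" using z(2) mult_left_mono[of "Re z" \<sigma> "\<bar>t\<bar>"] by (simp add: mult.commute)
      finally show ?thesis .
    qed
    moreover have "norm (R z) \<le> B" using z by (intro bR) auto
    ultimately have le: "norm (exp (z * complex_of_real t)) * norm (R z) \<le> exp (\<bar>t\<bar> * \<sigma>) * B"
      by (intro mult_mono) auto
    then have "0 \<le> exp (\<bar>t\<bar> * \<sigma>) * B"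
      by (rule order_trans[rotated]) simp
    with le
    have "norm (exp (z * complex_of_real t)) * norm (R z) / (norm z)\<^sup>2 \<le> exp (\<bar>t\<bar> * \<sigma>) * B / (Im z)\<^sup>2"
      using im by (intro frac_le) auto
    then show "norm (h z) \<le> exp (\<bar>t\<bar> * \<sigma>) * B / (Im z)\<^sup>2"
      by (simp add: h_def norm_mult norm_divide norm_power)
  qed (use ac P hol intc in \<open>auto simp: open_halfspace_Re_gt\<close>)
  then show "2 * pi * (LINT x|U. max (t - x) 0) =
      2 * pi * (\<Sum>p\<in>P. residue (\<lambda>z. exp (z * complex_of_real t) * R z / z\<^sup>2) p)
      + (LBINT y. exp (Complex c y * complex_of_real t) * R (Complex c y) / (Complex c y)\<^sup>2)"
    using perron_laplace(1)[OF sets int cpos(2) R, of t] unfolding h_def[symmetric] by (simp add: algebra_simps)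
qed

text \<open>Moving the kink of a ramp from t to t + d adds exactly d at every x \<le> t. Moving it
  from t - d to t adds at most d, and nothing at x \<ge> t. Hence a closed interval on one side and
  a half-open one on the other.\<close>

lemma ramp_integral_bounds:
  fixes U :: "real measure"
  assumes sets: "sets U = sets borel" and pos: "AE x in U. 0 \<le> x"
    and int: "integrable U (\<lambda>x. exp (- \<sigma> * x))" and "\<sigma> \<ge> 0" and "0 < d"
  shows "d * measure U {0..t} \<le> (LINT x|U. max (t + d - x) 0) - (LINT x|U. max (t - x) 0)"
    and "(LINT x|U. max (t - x) 0) - (LINT x|U. max (t - d - x) 0) \<le> d * measure U {0..<t}"
proof -
  have [measurable_cong]: "sets U = sets borel" by (rule sets)
  have fin: "emeasure U A < \<infinity>" if "A \<subseteq> {..s}" for A s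
  proof -
    have "emeasure U A \<le> emeasure U {..s}" by (rule emeasure_mono[OF that]) (simp add: sets)
    also have "\<dots> < \<infinity>" by (rule laplace_finite_on_bounded[OF sets int \<open>\<sigma> \<ge> 0\<close>])
    finally show ?thesis .
  qed
  have ind: "integrable U (indicator A :: real \<Rightarrow> real)" if "A \<in> sets borel" "A \<subseteq> {..s}" for A s
    using that fin[OF that(2)] by (simp add: integrable_indicator_iff sets)
  have ramp: "integrable U (\<lambda>x. max (s - x) 0)" for s
  proof (rule Bochner_Integration.integrable_bound)
    show "integrable U (\<lambda>x. \<bar>s\<bar> * indicator {..s} x)" by (intro integrable_mult_right ind) auto
    show "AE x in U. norm (max (s - x) 0) \<le> norm (\<bar>s\<bar> * indicator {..s} x)"
      using pos by eventually_elim (auto simp: indicator_def max_def)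
  qed measurable
  have "d * measure U {0..t} = (LINT x|U. d * indicator {0..t} x)"
    using sets by (simp add: sets_eq_imp_space_eq[OF sets])
  also have "\<dots> \<le> (LINT x|U. max (t + d - x) 0 - max (t - x) 0)"
    by (rule integral_mono_AE[OF integrable_mult_right[OF ind[of _ t]] Bochner_Integration.integrable_diff[OF ramp ramp]])
       (use \<open>0 < d\<close> in \<open>auto simp: indicator_def max_def\<close>)
  also have "\<dots> = (LINT x|U. max (t + d - x) 0) - (LINT x|U. max (t - x) 0)"
    by (intro Bochner_Integration.integral_diff ramp)
  finally show "d * measure U {0..t} \<le> (LINT x|U. max (t + d - x) 0) - (LINT x|U. max (t - x) 0)" .
  have "(LINT x|U. max (t - x) 0) - (LINT x|U. max (t - d - x) 0) = (LINT x|U. max (t - x) 0 - max (t - d - x) 0)"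
    by (intro Bochner_Integration.integral_diff[symmetric] ramp)
  also have "\<dots> \<le> (LINT x|U. d * indicator {0..<t} x)"
  proof (rule integral_mono_AE[OF Bochner_Integration.integrable_diff[OF ramp ramp] integrable_mult_right[OF ind[of _ t]]])
    show "AE x in U. max (t - x) 0 - max (t - d - x) 0 \<le> d * indicator {0..<t} x"
      using pos by eventually_elim (use \<open>0 < d\<close> in \<open>auto simp: indicator_def max_def\<close>)
  qed auto
  also have "\<dots> = d * measure U {0..<t}"
    using sets by (simp add: sets_eq_imp_space_eq[OF sets])
  finally show "(LINT x|U. max (t - x) 0) - (LINT x|U. max (t - d - x) 0) \<le> d * measure U {0..<t}" .
qed

text \<open>The ramp integral \<open>U\<^sub>1\<close> is known up to the Perron integral along \<open>Re z = c\<close>, whose increments over a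
  step \<open>d\<close> are of order \<open>e\<^sup>c\<^sup>t d\<^sup>g\<close> for every \<open>g < 1\<close>.  By monotonicity the distribution function of \<open>U\<close> lies between the
  difference quotients of \<open>U\<^sub>1\<close> with the exponentially small step \<open>d = e\<^sup>-\<^sup>b\<^sup>t\<close>; the loss \<open>d\<^sup>g\<^sup>-\<^sup>1\<close> is absorbed by
  the gap between \<open>c\<close> and \<open>\<theta>\<close> when \<open>g\<close> is close to 1.\<close>

lemma renewal_asymptotics:
  fixes U :: "real measure" and R :: "complex \<Rightarrow> complex"
  assumes sets: "sets U = sets borel" and pos: "AE x in U. 0 \<le> x"
    and int: "integrable U (\<lambda>x. exp (- \<sigma> * x))"
    and R: "\<And>y. (LINT x|U. exp (- Complex \<sigma> y * complex_of_real x)) = R (Complex \<sigma> y)"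
    and ac: "0 \<le> a" "a < c" "c < \<theta>" "\<theta> < \<sigma>"
    and P: "finite P" "P \<subseteq> {z. c < Re z \<and> Re z < \<sigma>}"
    and holR: "R holomorphic_on {z. Re z > a} - P"
    and bR: "\<And>z. c \<le> Re z \<Longrightarrow> Re z \<le> \<sigma> \<Longrightarrow> T \<le> \<bar>Im z\<bar> \<Longrightarrow> norm (R z) \<le> B"
    and pole: "\<And>p. p \<in> P \<Longrightarrow> K p \<ge> 1 \<and> (\<exists>V g. open V \<and> p \<in> V \<and> g holomorphic_on V \<and>
        (\<forall>z\<in>V - {p}. g z = (z - p) ^ K p * R z))"
  shows "\<exists>q C. \<forall>t\<ge>0. \<forall>A\<in>{{0..t}, {0..<t}}.
    norm (complex_of_real (measure U A) - exppoly P K q (complex_of_real t)) \<le> C * exp (\<theta> * t)"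
proof -
  have cpos: "c > 0" "\<sigma> > 0" "\<theta> > 0" using ac by auto
  have "\<exists>q. \<forall>t. residue (\<lambda>z. exp (z * complex_of_real t) * R z / z\<^sup>2) p
      = exp (p * complex_of_real t) * (\<Sum>j<K p. q j * complex_of_real t ^ j)" if "p \<in> P" for p
  proof -
    from pole[OF that] obtain V g where "K p \<ge> 1" "open V" "p \<in> V" "g holomorphic_on V"
      "\<And>z. z \<in> V - {p} \<Longrightarrow> g z = (z - p) ^ K p * R z" by blast
    moreover have "p \<noteq> 0" using that P(2) cpos by auto
    ultimately show ?thesis by (intro residue_exp_times_pole)
  qed
  then obtain r where r: "\<And>p t. p \<in> P \<Longrightarrow> residue (\<lambda>z. exp (z * complex_of_real t) * R z / z\<^sup>2) p
      = exp (p * complex_of_real t) * (\<Sum>j<K p. r p j * complex_of_real t ^ j)"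
    by metis
  \<comment> \<open>\<open>r\<close> describes the integrated renewal function, so the derivative
    describes the renewal function itself.\<close>
  define q where "q = exppoly_deriv K r"
  define U1 where "U1 t = (LINT x|U. max (t - x) 0)" for t
  define J where "J t = (LBINT y. exp (Complex c y * complex_of_real t) * R (Complex c y) / (Complex c y)\<^sup>2)" for t
  have inv: "2 * pi * (LINT x|U. max (t - x) 0) =
      2 * pi * (\<Sum>p\<in>P. residue (\<lambda>z. exp (z * complex_of_real t) * R z / z\<^sup>2) p)
      + (LBINT y. exp (Complex c y * complex_of_real t) * R (Complex c y) / (Complex c y)\<^sup>2)"
    "integrable lborel (\<lambda>y. exp (Complex c y * complex_of_real t) * R (Complex c y) / (Complex c y)\<^sup>2)"
    "\<exists>B'. \<forall>y. norm (R (Complex c y)) \<le> B'" for t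
    by (rule laplace_inversion_shifted[OF sets int R ac(1,2) order.strict_trans[OF ac(3,4)] P holR, where T=T and B=B],
        erule (2) bR)+
  have U1: "complex_of_real (U1 t) = exppoly P K r (complex_of_real t) + J t / (2 * pi)" for t
  proof -
    have "(\<Sum>p\<in>P. residue (\<lambda>z. exp (z * complex_of_real t) * R z / z\<^sup>2) p) = exppoly P K r (complex_of_real t)"
      unfolding exppoly_def by (intro sum.cong refl r)
    then show ?thesis using inv(1)[of t] unfolding U1_def J_def by (simp add: field_simps)
  qed
  define b where "b = \<sigma> + 1"
  have b: "b > 0" "\<theta> - c < b" using cpos ac by (auto simp: b_def)
  \<comment> \<open>Chosen so that \<open>d powr (g - 1)\<close> equals exp((\<theta> - c) t) for d
    = exp(-b t), which lifts exp(c t) exactly to exp(\<theta> t). The rate b = \<sigma> + 1 of the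
    step matches the crude growth exponent of the exponential polynomial.\<close>
  define g where "g = 1 - (\<theta> - c) / b"
  have g: "0 < g" "g < 1" using b ac by (auto simp: g_def)
  obtain B' where B': "\<And>y. norm (R (Complex c y)) \<le> B'" using inv(3) by blast
  obtain C1 where C1: "C1 \<ge> 0" "\<And>t d. 0 < d \<Longrightarrow> d \<le> 1 \<Longrightarrow> norm (J (t + d) - J t) \<le> C1 * exp (c * t) * d powr g"
    using perron_integral_increment[OF cpos(1) g B' inv(2)] unfolding J_def by blast
  have ReP: "\<And>p. p \<in> P \<Longrightarrow> Re p \<le> \<sigma>" using P by auto
  obtain C2 where C2: "C2 \<ge> 0" "\<And>x y w. 0 \<le> x \<Longrightarrow> x \<le> y \<Longrightarrow> w \<in> {x..y} \<Longrightarrow>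
    norm (exppoly P K r (complex_of_real y) - exppoly P K r (complex_of_real x) - complex_of_real (y - x) * exppoly P K q (complex_of_real w))
      \<le> C2 * (y - x)\<^sup>2 * exp (b * y)"
  proof -
    have "\<sigma> + 1 \<ge> 0" using cpos by simp
    from exppoly_diff_quotient[of P, OF ReP this, of K r] obtain C where "C \<ge> 0" "\<forall>x y w. 0 \<le> x \<longrightarrow> x \<le> y \<longrightarrow> w \<in> {x..y} \<longrightarrow>
      norm (exppoly P K r (complex_of_real y) - exppoly P K r (complex_of_real x) - complex_of_real (y - x) * exppoly P K q (complex_of_real w))
      \<le> C * (y - x)\<^sup>2 * exp (b * y)" unfolding q_def b_def by (auto elim: exE)
    then show ?thesis by (intro that[of C]) simp_all
  qed
  define D where "D = C2 * exp b + C1"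
  \<comment> \<open>\<open>t \<ge> 1\<close> keeps the left end t - d of the backward step
    nonnegative. The forward step is the case s = t with w = s, the backward step the case s = t - d
    with w = s + d.\<close>
  have quot: "norm (complex_of_real ((U1 (s + d) - U1 s) / d) - exppoly P K q (complex_of_real w)) \<le> D * exp (\<theta> * t)"
    if t: "t \<ge> 1" and d: "d = exp (- b * t)" and s: "s \<in> {t - d..t}" and w: "w \<in> {s..s + d}" for t d s w
  proof -
    have d01: "0 < d" "d \<le> 1" using t b d by auto
    have s0: "0 \<le> s" "s \<le> t" using s t d01 by auto
    have 1: "norm ((exppoly P K r (complex_of_real (s + d)) - exppoly P K r (complex_of_real s)) / d - exppoly P K q (complex_of_real w)) \<le> C2 * exp b * exp (\<theta> * t)"
    proof -
      let ?x = "exppoly P K r (complex_of_real (s + d)) - exppoly P K r (complex_of_real s)"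
      have "norm (?x / d - exppoly P K q (complex_of_real w)) = norm (?x - complex_of_real d * exppoly P K q (complex_of_real w)) / d"
      proof -
        have "?x / d - exppoly P K q (complex_of_real w) = (?x - complex_of_real d * exppoly P K q (complex_of_real w)) / complex_of_real d"
          using d01 by (simp add: divide_simps)
        then show ?thesis using d01 by (simp only: norm_divide) simp
      qed
      also have "\<dots> \<le> (C2 * d\<^sup>2 * exp (b * (s + d))) / d"
        using C2(2)[of s "s + d" w] s0 d01 w by (intro divide_right_mono) auto
      also have "\<dots> = C2 * (d * exp (b * (s + d)))" using d01 by (simp add: power2_eq_square)
      also have "d * exp (b * (s + d)) \<le> exp b * exp (\<theta> * t)"
      proof -
        have "b * (s + d) \<le> b * (t + 1)" using s0 d01 b by (intro mult_left_mono) auto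
        moreover have "0 \<le> \<theta> * t" using cpos t by simp
        ultimately have "- b * t + b * (s + d) \<le> b + \<theta> * t" by (simp add: algebra_simps)
        then show ?thesis unfolding d exp_add[symmetric] by simp
      qed
      finally show ?thesis using C2(1) by (simp add: mult_left_mono mult.assoc)
    qed
    have 2: "norm ((J (s + d) - J s) / d) \<le> C1 * exp (\<theta> * t)"
    proof -
      have "norm ((J (s + d) - J s) / d) = norm (J (s + d) - J s) / d" using d01 by (simp add: norm_divide)
      also have "\<dots> \<le> C1 * exp (c * s) * d powr g / d"
        using C1(2)[OF d01] d01 by (intro divide_right_mono) auto
      also have "\<dots> = C1 * (exp (c * s) * d powr (g - 1))" using d01 by (simp add: powr_diff)
      also have "exp (c * s) * d powr (g - 1) \<le> exp (\<theta> * t)"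
      proof -
        have "d powr (g - 1) = exp ((\<theta> - c) * t)"
          using b by (simp add: d powr_def g_def)
        moreover have "c * s + (\<theta> - c) * t \<le> \<theta> * t" using s0 cpos by (simp add: algebra_simps)
        ultimately show ?thesis by (simp add: exp_add[symmetric])
      qed
      finally show ?thesis using C1(1) by (simp add: mult_left_mono)
    qed
    have "complex_of_real ((U1 (s + d) - U1 s) / d) - exppoly P K q (complex_of_real w)
      = ((exppoly P K r (complex_of_real (s + d)) - exppoly P K r (complex_of_real s)) / d - exppoly P K q (complex_of_real w))
        + ((J (s + d) - J s) / d) / (2 * pi)"
    proof -
      have "(a + u / k - (a' + u' / k)) / e - z = ((a - a') / e - z) + ((u - u') / e) / k" for a a' u u' k e z :: complex
        by (simp add: diff_divide_distrib add_divide_distrib mult.commute)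
      then show ?thesis unfolding of_real_divide of_real_diff U1 .
    qed
    also have "norm \<dots> \<le> C2 * exp b * exp (\<theta> * t) + norm ((J (s + d) - J s) / d) / (2 * pi)"
      using 1 by (intro order_trans[OF norm_triangle_ineq]) (simp add: norm_divide norm_mult)
    also have "norm ((J (s + d) - J s) / d) / (2 * pi) \<le> norm ((J (s + d) - J s) / d)"
    proof -
      have "x / (2 * pi) \<le> x" if "x \<ge> 0" for x :: real
      proof -
        have "x * 1 \<le> x * (2 * pi)" using that pi_ge_two by (intro mult_left_mono) auto
        then show ?thesis by (simp add: divide_simps)
      qed
      then show ?thesis by simp
    qed
    also note 2
    finally show ?thesis by (simp add: D_def algebra_simps)
  qed
  have large: "norm (complex_of_real (measure U A) - exppoly P K q (complex_of_real t)) \<le> 3 * D * exp (\<theta> * t)"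
    if t: "t \<ge> 1" and A: "A \<in> {{0..t}, {0..<t}}" for t A
  proof -
    define d where "d = exp (- b * t)"
    have d: "d > 0" by (simp add: d_def)
    define up lo where "up = (U1 (t + d) - U1 t) / d" and "lo = (U1 (t - d + d) - U1 (t - d)) / d"
    have fin: "emeasure U {0..t} \<noteq> \<infinity>"
    proof -
      have "emeasure U {0..t} \<le> emeasure U {..t}" by (rule emeasure_mono) (auto simp: sets)
      then show ?thesis using laplace_finite_on_bounded[OF sets int, of t] cpos by auto
    qed
    have sub: "measure U {0..<t} \<le> measure U {0..t}"
      by (rule measure_mono_fmeasurable) (use fin in \<open>auto simp: sets fmeasurable_def less_top\<close>)
    have "measure U {0..t} \<le> up"
      using ramp_integral_bounds(1)[OF sets pos int _ d, of t] d cpos by (simp add: up_def U1_def field_simps)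
    moreover have "lo \<le> measure U {0..<t}"
      using ramp_integral_bounds(2)[OF sets pos int _ d, of t] d cpos by (simp add: lo_def U1_def field_simps)
    ultimately have between: "lo \<le> measure U A" "measure U A \<le> up" using A sub by auto
    have n: "norm (complex_of_real up - exppoly P K q (complex_of_real t)) \<le> D * exp (\<theta> * t)"
      "norm (complex_of_real lo - exppoly P K q (complex_of_real t)) \<le> D * exp (\<theta> * t)"
      unfolding up_def lo_def by (rule quot[OF t d_def]; use d in simp)+
    have "up - lo = norm (complex_of_real up - complex_of_real lo)"
      using between by (simp add: of_real_diff[symmetric] del: of_real_diff)
    also have "\<dots> \<le> 2 * D * exp (\<theta> * t)"
      using norm_diff_triangle_le[OF n(1) n(2)[unfolded norm_minus_commute[of "complex_of_real lo"]]] by simp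
    finally have "up - lo \<le> 2 * D * exp (\<theta> * t)" .
    then have "norm (complex_of_real (measure U A) - complex_of_real up) \<le> 2 * D * exp (\<theta> * t)"
      using between by (simp add: of_real_diff[symmetric] abs_le_iff del: of_real_diff)
    from norm_diff_triangle_le[OF this n(1)] show ?thesis by simp
  qed
  obtain C3 where C3: "C3 \<ge> 0" "\<And>t. t \<ge> 0 \<Longrightarrow> norm (exppoly P K q (complex_of_real t)) \<le> C3 * exp (b * t)"
    using exppoly_growth[OF ReP, of P K q] unfolding b_def by blast
  \<comment> \<open>On [0,1] all quantities are bounded and exp(\<theta> t) \<ge> 1, so a constant
    suffices.\<close>
  have small: "norm (complex_of_real (measure U A) - exppoly P K q (complex_of_real t)) \<le> (measure U {..1} + C3 * exp b) * exp (\<theta> * t)"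
    if t: "0 \<le> t" "t \<le> 1" and A: "A \<in> {{0..t}, {0..<t}}" for t A
  proof -
    have "measure U A \<le> measure U {..1}"
      by (rule measure_mono_fmeasurable)
         (use A t laplace_finite_on_bounded[OF sets int, of 1] cpos in \<open>auto simp: sets fmeasurable_def\<close>)
    moreover have "C3 * exp (b * t) \<le> C3 * exp b" using t b C3(1) by (intro mult_left_mono) auto
    ultimately have "norm (complex_of_real (measure U A) - exppoly P K q (complex_of_real t)) \<le> (measure U {..1} + C3 * exp b) * 1"
      using C3(2)[OF t(1)] by (intro order_trans[OF norm_triangle_ineq4]) auto
    also have "\<dots> \<le> (measure U {..1} + C3 * exp b) * exp (\<theta> * t)"
      using t cpos C3(1) by (intro mult_left_mono) auto
    finally show ?thesis .
  qed
  show ?thesis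
  proof (intro exI allI impI ballI)
    fix t :: real and A assume t: "t \<ge> 0" and A: "A \<in> {{0..t}, {0..<t}}"
    have D: "D \<ge> 0" unfolding D_def using C1(1) C2(1) by (intro add_nonneg_nonneg mult_nonneg_nonneg) auto
    let ?M = "3 * D + (measure U {..1} + C3 * exp b)"
    have m: "(measure U {..1} + C3 * exp b) \<le> ?M" "3 * D \<le> ?M" using D C3(1) by auto
    show "norm (complex_of_real (measure U A) - exppoly P K q (complex_of_real t)) \<le> ?M * exp (\<theta> * t)"
    proof (cases "t \<le> 1")
      case True
      show ?thesis by (rule order_trans[OF small[OF t True A] mult_right_mono[OF m(1)]]) simp
    next
      case False
      then have "1 \<le> t" by simp
      show ?thesis by (rule order_trans[OF large[OF \<open>1 \<le> t\<close> A] mult_right_mono[OF m(2)]]) simp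
    qed
  qed
qed

section \<open>Convolution with functions of bounded variation\<close>

text \<open>Writes h as the integral over levels y in [0,G) of the indicator of y < h and exchanges
  integrals. Prescribing \<open>G\<close> gives two different measures the same range of levels, so
  that their level integrals can be subtracted.\<close>

lemma layer_cake_integral:
  fixes N :: "real measure" and \<psi> :: "real \<Rightarrow> complex" and h :: "real \<Rightarrow> real"
  assumes "sigma_finite_measure N" and sets: "sets N = sets borel" and \<psi>: "integrable N \<psi>"
    and h: "h \<in> borel_measurable borel" "\<And>s. 0 \<le> h s" "\<And>s. h s \<le> G"
  shows "integrable lborel (\<lambda>y. indicator {0..<G} y *\<^sub>R (LINT s|N. indicator {s. y < h s} s *\<^sub>R \<psi> s))"
    and "(LINT s|N. h s *\<^sub>R \<psi> s) = (LBINT y. indicator {0..<G} y *\<^sub>R (LINT s|N. indicator {s. y < h s} s *\<^sub>R \<psi> s))"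
proof -
  interpret N: sigma_finite_measure N by fact
  interpret P: pair_sigma_finite N lborel ..
  have [measurable_cong]: "sets N = sets borel" by (rule sets)
  note h(1)[measurable]
  have [measurable]: "\<psi> \<in> borel_measurable N" using \<psi> by simp
  define k where "k s y = (indicator {0..<G} y * indicator {s. y < h s} s) *\<^sub>R \<psi> s" for s y
  have k_alt: "k s y = (if 0 \<le> y \<and> y < G \<and> y < h s then \<psi> s else 0)" for s y
    by (simp add: k_def indicator_def)
  have km: "case_prod k \<in> borel_measurable (N \<Otimes>\<^sub>M lborel)"
    unfolding k_alt case_prod_beta' by measurable
  have G0: "0 \<le> G" using h(2,3) order_trans by blast
  have ik: "integrable (N \<Otimes>\<^sub>M lborel) (case_prod k)"
  proof (rule P.Fubini_integrable[OF km])
    have *: "(LBINT y. norm (k s y)) = h s * norm (\<psi> s)" for s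
    proof -
      have "(LBINT y. norm (k s y)) = (LBINT y. indicator {0..<h s} y * norm (\<psi> s))"
        by (intro Bochner_Integration.integral_cong refl) (use h(3)[of s] in \<open>auto simp: k_alt indicator_def\<close>)
      then show ?thesis using h(2)[of s] by simp
    qed
    show "integrable N (\<lambda>s. LBINT y. norm (case_prod k (s, y)))"
      unfolding prod.case *
      by (rule Bochner_Integration.integrable_bound[OF integrable_mult_right[OF integrable_norm[OF \<psi>], of G]])
         (use h G0 in \<open>auto intro!: AE_I2 mult_right_mono\<close>)
    show "AE s in N. integrable lborel (\<lambda>y. case_prod k (s, y))"
    proof (rule AE_I2)
      fix s
      have "integrable lborel (\<lambda>y. indicator {0..<h s} y *\<^sub>R \<psi> s)"
        using h(2)[of s] by (intro integrable_scaleR_left integrable_real_indicator) auto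
      moreover have "indicator {0..<h s} y *\<^sub>R \<psi> s = k s y" for y
        using h(3)[of s] by (auto simp: k_alt indicator_def)
      ultimately show "integrable lborel (\<lambda>y. case_prod k (s, y))" by simp
    qed
  qed
  have kN: "(LINT s|N. k s y) = indicator {0..<G} y *\<^sub>R (LINT s|N. indicator {s. y < h s} s *\<^sub>R \<psi> s)" for y
    unfolding k_def scaleR_scaleR[symmetric] by (rule integral_scaleR_right)
  show "integrable lborel (\<lambda>y. indicator {0..<G} y *\<^sub>R (LINT s|N. indicator {s. y < h s} s *\<^sub>R \<psi> s))"
    using P.integrable_snd[OF ik] by (simp only: kN)
  have "(LINT s|N. h s *\<^sub>R \<psi> s) = (LINT s|N. (LBINT y. k s y))"
  proof (rule Bochner_Integration.integral_cong[OF refl])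
    fix s
    have "(LBINT y. k s y) = (LBINT y. indicator {0..<h s} y *\<^sub>R \<psi> s)"
      by (intro Bochner_Integration.integral_cong refl) (use h(3)[of s] in \<open>auto simp: k_alt indicator_def\<close>)
    then show "h s *\<^sub>R \<psi> s = (LBINT y. k s y)" using h(2)[of s] by simp
  qed
  also have "\<dots> = (LBINT y. (LINT s|N. k s y))" by (rule P.Fubini_integral[OF ik, symmetric])
  finally show "(LINT s|N. h s *\<^sub>R \<psi> s) = (LBINT y. indicator {0..<G} y *\<^sub>R (LINT s|N. indicator {s. y < h s} s *\<^sub>R \<psi> s))"
    by (simp only: kN)
qed

lemma exppoly_convolution_interval:
  assumes "a \<le> t"
  shows "(LBINT x. indicator {a..t} x *\<^sub>R exppoly P K (exppoly_deriv K q) (complex_of_real (t - x)))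
    = exppoly P K q (complex_of_real (t - a)) - exppoly P K q 0"
proof -
  have "has_bochner_integral lborel (\<lambda>x. indicator {a..t} x *\<^sub>R exppoly P K (exppoly_deriv K q) (complex_of_real (t - x)))
      (- exppoly P K q (complex_of_real (t - t)) - - exppoly P K q (complex_of_real (t - a)))"
  proof (rule has_bochner_integral_FTC_Icc[OF assms])
    fix x
    have "((\<lambda>x. complex_of_real (t - x)) has_vector_derivative - 1) (at x within {a..t})"
      unfolding has_vector_derivative_def
      by (auto intro!: derivative_eq_intros simp: fun_eq_iff scaleR_conv_of_real)
    from field_vector_diff_chain_within[OF this has_field_derivative_at_within[OF exppoly_has_field_derivative[of P K q]]]
    show "((\<lambda>x. - exppoly P K q (complex_of_real (t - x))) has_vector_derivative
        exppoly P K (exppoly_deriv K q) (complex_of_real (t - x))) (at x within {a..t})"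
      by (auto simp: o_def dest: has_vector_derivative_minus)
  next
    show "continuous_on {a..t} (\<lambda>x. exppoly P K (exppoly_deriv K q) (complex_of_real (t - x)))"
      unfolding exppoly_def by (intro continuous_intros)
  qed
  from has_bochner_integral_integral_eq[OF this] show ?thesis by simp
qed

lemma nn_integral_exp_atLeast:
  fixes a b :: real
  assumes "b > 0"
  shows "(\<integral>\<^sup>+x\<in>{a..}. ennreal (exp (- b * x)) \<partial>lborel) = ennreal (exp (- b * a) / b)"
proof -
  have "(\<integral>\<^sup>+x\<in>{a..}. ennreal (exp (- b * x)) \<partial>lborel) = ennreal (0 - (- exp (- b * a) / b))"
  proof (rule nn_integral_FTC_atLeast)
    show "((\<lambda>x. - exp (- b * x) / b) has_real_derivative exp (- b * x)) (at x)" for x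
      using \<open>b > 0\<close> by (auto intro!: derivative_eq_intros)
    have "((\<lambda>x. exp (- b * x)) \<longlongrightarrow> 0) at_top"
      by (rule filterlim_compose[OF exp_at_bot])
         (rule filterlim_tendsto_neg_mult_at_bot[OF tendsto_const _ filterlim_ident], use \<open>b > 0\<close> in simp)
    from tendsto_divide[OF tendsto_minus[OF this] tendsto_const[of b]] \<open>b > 0\<close>
    show "((\<lambda>x. - exp (- b * x) / b) \<longlongrightarrow> 0) at_top" by simp
  qed auto
  then show ?thesis by simp
qed

text \<open>Level sets of a nondecreasing function are half-lines \<open>[a,\<infinity>)\<close> or \<open>(a,\<infinity>)\<close>, so that the estimate for the
  distribution function of \<open>U\<close> applies to each of them; note \<open>e\<^sup>-\<^sup>\<theta>\<^sup>a = \<theta> \<integral>\<^sub>a\<^sup>\<infinity> e\<^sup>-\<^sup>\<theta>\<^sup>x dx\<close>.\<close>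

lemma renewal_level_set:
  fixes U :: "real measure"
  assumes sets: "sets U = sets borel" and pos: "AE x in U. 0 \<le> x" and "\<theta> > 0"
    and approx: "\<And>t A. t \<ge> 0 \<Longrightarrow> A \<in> {{0..t}, {0..<t}} \<Longrightarrow>
      norm (complex_of_real (measure U A) - exppoly P K q (complex_of_real t)) \<le> C * exp (\<theta> * t)"
    and L: "\<And>x y. x \<in> L \<Longrightarrow> x \<le> y \<Longrightarrow> y \<in> L" "L \<subseteq> {0..}" "t \<in> L"
  shows "ennreal (norm (complex_of_real (measure U {s \<in> {0..t}. t - s \<in> L})
      - (LBINT x. indicator ({0..t} \<inter> L) x *\<^sub>R exppoly P K (exppoly_deriv K q) (complex_of_real (t - x)))))
    \<le> ennreal ((C + norm (exppoly P K q 0)) * \<theta> * exp (\<theta> * t)) * (\<integral>\<^sup>+x\<in>L. ennreal (exp (- \<theta> * x)) \<partial>lborel)"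
proof -
  let ?Q = "exppoly P K q" and ?W = "exppoly P K (exppoly_deriv K q)"
  define a where "a = Inf L"
  have bdd: "bdd_below L" using L(2) by (auto simp: bdd_below_def)
  have a: "0 \<le> a" "a \<le> t" "\<And>x. x \<in> L \<Longrightarrow> a \<le> x"
    using L(2,3) bdd unfolding a_def by (auto intro!: cInf_greatest cInf_lower)
  \<comment> \<open>An upward closed set has no gaps above its infimum. So L is one of two
    half-lines, and the only doubtful point a is a Lebesgue null set.\<close>
  have aL: "x \<in> L" if ax: "a < x" for x
  proof -
    have "L \<noteq> {}" using L(3) by blast
    then obtain y where "y \<in> L" "y < x" using ax cInf_less_iff[OF _ bdd, of x] unfolding a_def by blast
    then show ?thesis using L(1) by auto
  qed
  have C0: "C \<ge> 0"
    using approx[of 0 "{0..0}"] order_trans[OF norm_ge_zero] by fastforce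
  have M: "(LBINT x. indicator ({0..t} \<inter> L) x *\<^sub>R ?W (complex_of_real (t - x))) = ?Q (complex_of_real (t - a)) - ?Q 0"
  proof -
    have "(LBINT x. indicator ({0..t} \<inter> L) x *\<^sub>R ?W (complex_of_real (t - x))) = (LBINT x. indicator {a..t} x *\<^sub>R ?W (complex_of_real (t - x)))"
    proof (rule integral_cong_AE)
      have L_eq: "L = (if a \<in> L then {a..} else {a<..})"
        using a(3) aL by (auto simp: order_less_le)
      then have [measurable]: "L \<in> sets borel" by (metis borel_closed borel_open closed_atLeast open_greaterThan)
      have [measurable]: "(\<lambda>x. ?W (complex_of_real (t - x))) \<in> borel_measurable borel"
        unfolding exppoly_def by (intro borel_measurable_continuous_onI continuous_intros)
      show "(\<lambda>x. indicator ({0..t} \<inter> L) x *\<^sub>R ?W (complex_of_real (t - x))) \<in> borel_measurable lborel"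
        "(\<lambda>x. indicator {a..t} x *\<^sub>R ?W (complex_of_real (t - x))) \<in> borel_measurable lborel"
        by measurable
      show "AE x in lborel. indicator ({0..t} \<inter> L) x *\<^sub>R ?W (complex_of_real (t - x)) = indicator {a..t} x *\<^sub>R ?W (complex_of_real (t - x))"
        using AE_lborel_singleton[of a]
      proof eventually_elim
        case (elim x)
        have "x \<in> {0..t} \<inter> L \<longleftrightarrow> x \<in> {a..t}" using elim a aL[of x] by (auto intro: order_trans)
        then show ?case by (simp add: indicator_def)
      qed
    qed
    also have "\<dots> = ?Q (complex_of_real (t - a)) - ?Q 0" by (rule exppoly_convolution_interval[OF a(2)])
    finally show ?thesis .
  qed
  define B where "B = {s \<in> {0..t}. t - s \<in> L}"
  \<comment> \<open>The reflection x = t - s turns the closed half-line into a closed interval and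
    the open one into a half-open one, which is why \<open>approx\<close> covers both.\<close>
  have "B \<in> {{0..t - a}, {0..<t - a}}"
  proof (cases "a \<in> L")
    case True
    have "B = {0..t - a}"
      unfolding B_def using a L(1)[OF True] by (auto dest: a(3))
    then show ?thesis by simp
  next
    case False
    have "B = {0..<t - a}"
    proof (intro set_eqI iffI)
      fix s assume "s \<in> B"
      then have "t - s \<in> L" "0 \<le> s" by (auto simp: B_def)
      moreover from this a(3) False have "a < t - s" by (metis order_less_le)
      ultimately show "s \<in> {0..<t - a}" by auto
    next
      fix s assume "s \<in> {0..<t - a}"
      then show "s \<in> B" unfolding B_def using aL[of "t - s"] a by auto
    qed
    then show ?thesis by simp
  qed
  then have 1: "norm (complex_of_real (measure U B) - ?Q (complex_of_real (t - a))) \<le> C * exp (\<theta> * (t - a))"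
    using a by (intro approx) auto
  have "norm (complex_of_real (measure U B) - (?Q (complex_of_real (t - a)) - ?Q 0))
      = norm ((complex_of_real (measure U B) - ?Q (complex_of_real (t - a))) + ?Q 0)" by (simp add: algebra_simps)
  \<comment> \<open>Integrating the density from 0 loses the constant \<open>?Q 0\<close>; as
    \<theta> > 0 and a \<le> t, it is absorbed into exp(\<theta> (t - a)).\<close>
  also have "\<dots> \<le> C * exp (\<theta> * (t - a)) + norm (?Q 0) * exp (\<theta> * (t - a))"
  proof (rule order_trans[OF norm_triangle_ineq add_mono[OF 1]])
    have "norm (?Q 0) * 1 \<le> norm (?Q 0) * exp (\<theta> * (t - a))" using a \<open>\<theta> > 0\<close> by (intro mult_left_mono) auto
    then show "norm (?Q 0) \<le> norm (?Q 0) * exp (\<theta> * (t - a))" by simp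
  qed
  also have "\<dots> = (C + norm (?Q 0)) * \<theta> * exp (\<theta> * t) * (exp (- \<theta> * a) / \<theta>)"
    using \<open>\<theta> > 0\<close> by (simp add: algebra_simps exp_diff exp_minus divide_simps)
  finally have 2: "norm (complex_of_real (measure U B) - (?Q (complex_of_real (t - a)) - ?Q 0))
      \<le> (C + norm (?Q 0)) * \<theta> * exp (\<theta> * t) * (exp (- \<theta> * a) / \<theta>)" .
  have "ennreal (exp (- \<theta> * a) / \<theta>) = (\<integral>\<^sup>+x\<in>{a..}. ennreal (exp (- \<theta> * x)) \<partial>lborel)"
    by (rule nn_integral_exp_atLeast[OF \<open>\<theta> > 0\<close>, symmetric])
  also have "\<dots> \<le> (\<integral>\<^sup>+x\<in>L. ennreal (exp (- \<theta> * x)) \<partial>lborel)"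
  proof (rule nn_integral_mono_AE)
    show "AE x in lborel. ennreal (exp (- \<theta> * x)) * indicator {a..} x \<le> ennreal (exp (- \<theta> * x)) * indicator L x"
      using AE_lborel_singleton[of a] by eventually_elim (auto simp: indicator_def intro: aL)
  qed
  finally have 3: "ennreal (exp (- \<theta> * a) / \<theta>) \<le> (\<integral>\<^sup>+x\<in>L. ennreal (exp (- \<theta> * x)) \<partial>lborel)" .
  have "ennreal (norm (complex_of_real (measure U B) - (?Q (complex_of_real (t - a)) - ?Q 0)))
      \<le> ennreal ((C + norm (?Q 0)) * \<theta> * exp (\<theta> * t)) * ennreal (exp (- \<theta> * a) / \<theta>)"
    using 2 C0 \<open>\<theta> > 0\<close> by (subst ennreal_mult[symmetric]) (auto intro!: ennreal_leI mult_nonneg_nonneg add_nonneg_nonneg)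
  also have "\<dots> \<le> ennreal ((C + norm (?Q 0)) * \<theta> * exp (\<theta> * t)) * (\<integral>\<^sup>+x\<in>L. ennreal (exp (- \<theta> * x)) \<partial>lborel)"
    by (rule mult_left_mono[OF 3]) simp
  finally show ?thesis unfolding M B_def .
qed

lemma mono_nonneg:
  fixes k :: "real \<Rightarrow> real"
  assumes "mono k" "\<And>x. x < 0 \<Longrightarrow> k x = 0"
  shows "0 \<le> k x"
proof -
  have "k (min x (- 1)) \<le> k x" by (rule monoD[OF assms(1)]) simp
  then show ?thesis using assms(2)[of "min x (- 1)"] by simp
qed

text \<open>Both convolutions are integrals over the levels y in [0, g t) of the contributions of
  the level sets of g. The error of a level set is a multiple of exp(\<theta> t) times the integral
  of exp(-\<theta> x) over it. Integrating over all levels restores, by Tonelli, the finite integral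
  of exp(-\<theta> x) g x.\<close>

lemma renewal_monotone_convolution:
  fixes U :: "real measure" and g :: "real \<Rightarrow> real"
  assumes sets: "sets U = sets borel" and pos: "AE x in U. 0 \<le> x" and "\<theta> > 0"
    and fin: "\<And>t. emeasure U {..t} < \<infinity>" and sf: "sigma_finite_measure U"
    and approx: "\<And>t A. t \<ge> 0 \<Longrightarrow> A \<in> {{0..t}, {0..<t}} \<Longrightarrow>
      norm (complex_of_real (measure U A) - exppoly P K q (complex_of_real t)) \<le> C * exp (\<theta> * t)"
    and g: "mono g" "\<And>x. x < 0 \<Longrightarrow> g x = 0"
    and gint: "(\<integral>\<^sup>+x\<in>{0..}. ennreal (exp (- \<theta> * x)) * ennreal (g x) \<partial>lborel) < \<infinity>"
  shows "\<exists>C'. \<forall>t\<ge>0. norm ((LINT s|U. indicator {0..t} s *\<^sub>R complex_of_real (g (t - s)))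
      - (LBINT x. indicator {0..t} x *\<^sub>R (complex_of_real (g x) * exppoly P K (exppoly_deriv K q) (complex_of_real (t - x))))) \<le> C' * exp (\<theta> * t)"
proof -
  let ?W = "exppoly P K (exppoly_deriv K q)"
  have g0: "0 \<le> g x" for x by (rule mono_nonneg[OF g])
  have gm[measurable]: "g \<in> borel_measurable borel" by (rule borel_measurable_mono[OF g(1)])
  define I where "I = (\<integral>\<^sup>+x\<in>{0..}. ennreal (exp (- \<theta> * x)) * ennreal (g x) \<partial>lborel)"
  define D where "D = (C + norm (exppoly P K q 0)) * \<theta>"
  have C0: "C \<ge> 0"
    using approx[of 0 "{0..0}"] order_trans[OF norm_ge_zero] by fastforce
  have D0: "D \<ge> 0" unfolding D_def using C0 \<open>\<theta> > 0\<close> by (intro mult_nonneg_nonneg add_nonneg_nonneg) auto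
  have "norm ((LINT s|U. indicator {0..t} s *\<^sub>R complex_of_real (g (t - s)))
      - (LBINT x. indicator {0..t} x *\<^sub>R (complex_of_real (g x) * ?W (complex_of_real (t - x))))) \<le> D * enn2real I * exp (\<theta> * t)"
    if t: "t \<ge> 0" for t
  proof -
    define L where "L y = {x. y < g x}" for y
    define M1 where "M1 y = complex_of_real (measure U {s \<in> {0..t}. t - s \<in> L y})" for y
    define M2 where "M2 y = (LBINT x. indicator ({0..t} \<inter> L y) x *\<^sub>R ?W (complex_of_real (t - x)))" for y
    \<comment> \<open>Cut to [0,t], both integrands are bounded by g t through monotonicity. The two
      layer cake formulas therefore share the levels [0, g t), and every such level has t in its
      level set.\<close>
    define h1 where "h1 s = indicator {0..t} s * g (t - s)" for s
    define h2 where "h2 x = indicator {0..t} x * g x" for x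
    define \<psi>1 where "\<psi>1 s = complex_of_real (indicator {0..t} s)" for s
    define \<psi>2 where "\<psi>2 x = indicator {0..t} x *\<^sub>R ?W (complex_of_real (t - x))" for x
    have e1: "integrable lborel (\<lambda>y. indicator {0..<g t} y *\<^sub>R M1 y)"
      "(LINT s|U. indicator {0..t} s *\<^sub>R complex_of_real (g (t - s))) = (LBINT y. indicator {0..<g t} y *\<^sub>R M1 y)"
    proof -
      have i: "integrable U \<psi>1"
      proof -
        have "emeasure U {0..t} \<le> emeasure U {..t}" by (rule emeasure_mono) (auto simp: sets)
        then have "emeasure U {0..t} < \<infinity>" using fin[of t] by (rule order_le_less_trans)
        then show ?thesis unfolding \<psi>1_def by (intro integrable_of_real integrable_real_indicator) (auto simp: sets)
      qed
      have h: "h1 \<in> borel_measurable borel" "\<And>s. 0 \<le> h1 s" "\<And>s. h1 s \<le> g t"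
        unfolding h1_def using g0 by (auto simp: indicator_def intro: monoD[OF g(1)])
      have "(LINT s|U. indicator {s. y < h1 s} s *\<^sub>R \<psi>1 s) = M1 y" if "y \<ge> 0" for y
      proof -
        have "(LINT s|U. indicator {s. y < h1 s} s *\<^sub>R \<psi>1 s) = (LINT s|U. complex_of_real (indicator {s \<in> {0..t}. t - s \<in> L y} s))"
          by (intro Bochner_Integration.integral_cong refl)
             (use that in \<open>auto simp: h1_def \<psi>1_def L_def indicator_def split: if_splits\<close>)
        moreover have "{s \<in> {0..t}. t - s \<in> L y} \<in> sets U" unfolding sets L_def by measurable
        ultimately show ?thesis unfolding M1_def by (simp add: sets_eq_imp_space_eq[OF sets])
      qed
      then have *: "indicator {0..<g t} y *\<^sub>R (LINT s|U. indicator {s. y < h1 s} s *\<^sub>R \<psi>1 s) = indicator {0..<g t} y *\<^sub>R M1 y" for y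
        by (simp add: indicator_def)
      show "integrable lborel (\<lambda>y. indicator {0..<g t} y *\<^sub>R M1 y)"
        using layer_cake_integral(1)[OF sf sets i h] by (simp only: *)
      have "(LINT s|U. indicator {0..t} s *\<^sub>R complex_of_real (g (t - s))) = (LINT s|U. h1 s *\<^sub>R \<psi>1 s)"
        by (intro Bochner_Integration.integral_cong refl) (auto simp: h1_def \<psi>1_def indicator_def scaleR_conv_of_real)
      then show "(LINT s|U. indicator {0..t} s *\<^sub>R complex_of_real (g (t - s))) = (LBINT y. indicator {0..<g t} y *\<^sub>R M1 y)"
        using layer_cake_integral(2)[OF sf sets i h] by (simp only: *)
    qed
    have e2: "integrable lborel (\<lambda>y. indicator {0..<g t} y *\<^sub>R M2 y)"
      "(LBINT x. indicator {0..t} x *\<^sub>R (complex_of_real (g x) * ?W (complex_of_real (t - x)))) = (LBINT y. indicator {0..<g t} y *\<^sub>R M2 y)"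
    proof -
      have i: "integrable lborel \<psi>2"
      proof -
        have "continuous_on {0..t} (\<lambda>x. ?W (complex_of_real (t - x)))"
          unfolding exppoly_def by (intro continuous_intros)
        from borel_integrable_atLeastAtMost'[OF this] show ?thesis unfolding \<psi>2_def set_integrable_def .
      qed
      have h: "h2 \<in> borel_measurable borel" "\<And>s. 0 \<le> h2 s" "\<And>s. h2 s \<le> g t"
        unfolding h2_def using g0 by (auto simp: indicator_def intro: monoD[OF g(1)])
      have "(LBINT s. indicator {s. y < h2 s} s *\<^sub>R \<psi>2 s) = M2 y" if "y \<ge> 0" for y
        unfolding M2_def
        by (intro Bochner_Integration.integral_cong refl)
           (use that in \<open>auto simp: h2_def \<psi>2_def L_def indicator_def split: if_splits\<close>)
      then have *: "indicator {0..<g t} y *\<^sub>R (LBINT s. indicator {s. y < h2 s} s *\<^sub>R \<psi>2 s) = indicator {0..<g t} y *\<^sub>R M2 y" for y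
        by (simp add: indicator_def)
      show "integrable lborel (\<lambda>y. indicator {0..<g t} y *\<^sub>R M2 y)"
        using layer_cake_integral(1)[OF lborel.sigma_finite_measure_axioms _ i h] by (simp only: * sets_lborel)
      have "(LBINT x. indicator {0..t} x *\<^sub>R (complex_of_real (g x) * ?W (complex_of_real (t - x)))) = (LBINT s. h2 s *\<^sub>R \<psi>2 s)"
        by (intro Bochner_Integration.integral_cong refl) (auto simp: h2_def \<psi>2_def indicator_def scaleR_conv_of_real)
      then show "(LBINT x. indicator {0..t} x *\<^sub>R (complex_of_real (g x) * ?W (complex_of_real (t - x)))) = (LBINT y. indicator {0..<g t} y *\<^sub>R M2 y)"
        using layer_cake_integral(2)[OF lborel.sigma_finite_measure_axioms _ i h] by (simp only: * sets_lborel)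
    qed
    let ?E = "(LINT s|U. indicator {0..t} s *\<^sub>R complex_of_real (g (t - s)))
      - (LBINT x. indicator {0..t} x *\<^sub>R (complex_of_real (g x) * ?W (complex_of_real (t - x))))"
    have "?E = (LBINT y. indicator {0..<g t} y *\<^sub>R M1 y - indicator {0..<g t} y *\<^sub>R M2 y)"
      unfolding e1(2) e2(2) by (rule Bochner_Integration.integral_diff[OF e1(1) e2(1), symmetric])
    then have "ennreal (norm ?E) \<le> (\<integral>\<^sup>+y. ennreal (norm (indicator {0..<g t} y *\<^sub>R M1 y - indicator {0..<g t} y *\<^sub>R M2 y)) \<partial>lborel)"
      using integral_norm_bound_ennreal[OF Bochner_Integration.integrable_diff[OF e1(1) e2(1)]] by simp
    also have "\<dots> \<le> (\<integral>\<^sup>+y. ennreal (D * exp (\<theta> * t)) * (\<integral>\<^sup>+x. ennreal (exp (- \<theta> * x)) * indicator {0..} x * indicator {0..<g x} y \<partial>lborel) \<partial>lborel)"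
    proof (rule nn_integral_mono)
      fix y
      show "ennreal (norm (indicator {0..<g t} y *\<^sub>R M1 y - indicator {0..<g t} y *\<^sub>R M2 y))
        \<le> ennreal (D * exp (\<theta> * t)) * (\<integral>\<^sup>+x. ennreal (exp (- \<theta> * x)) * indicator {0..} x * indicator {0..<g x} y \<partial>lborel)"
      proof (cases "y \<in> {0..<g t}")
        case True
        then have "ennreal (norm (M1 y - M2 y)) \<le> ennreal ((C + norm (exppoly P K q 0)) * \<theta> * exp (\<theta> * t)) * (\<integral>\<^sup>+x\<in>L y. ennreal (exp (- \<theta> * x)) \<partial>lborel)"
          unfolding M1_def M2_def
        proof (intro renewal_level_set[OF sets pos \<open>\<theta> > 0\<close> approx])
          have "0 \<le> x" if "y < g x" for x
          proof (rule ccontr)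
            assume "\<not> 0 \<le> x"
            then have "g x = 0" by (intro g(2)) simp
            with that True show False by simp
          qed
          then show "L y \<subseteq> {0..}" by (auto simp: L_def)
          show "t \<in> L y" using True by (simp add: L_def)
          show "b \<in> L y" if "a \<in> L y" "a \<le> b" for a b
            using that monoD[OF g(1), of a b] by (simp add: L_def)
        qed
        also have "(\<integral>\<^sup>+x\<in>L y. ennreal (exp (- \<theta> * x)) \<partial>lborel) = (\<integral>\<^sup>+x. ennreal (exp (- \<theta> * x)) * indicator {0..} x * indicator {0..<g x} y \<partial>lborel)"
        proof (rule nn_integral_cong)
          fix x
          show "ennreal (exp (- \<theta> * x)) * indicator (L y) x = ennreal (exp (- \<theta> * x)) * indicator {0..} x * indicator {0..<g x} y"
            using True g(2)[of x] by (cases "x < 0") (auto simp: L_def indicator_def)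
        qed
        finally show ?thesis using True by (simp add: D_def)
      qed simp
    qed
    also have "\<dots> = ennreal (D * exp (\<theta> * t)) * (\<integral>\<^sup>+y. (\<integral>\<^sup>+x. ennreal (exp (- \<theta> * x)) * indicator {0..} x * indicator {0..<g x} y \<partial>lborel) \<partial>lborel)"
      by (rule nn_integral_cmult) (unfold indicator_def atLeastLessThan_iff, measurable)
    also have "(\<integral>\<^sup>+y. (\<integral>\<^sup>+x. ennreal (exp (- \<theta> * x)) * indicator {0..} x * indicator {0..<g x} y \<partial>lborel) \<partial>lborel)
       = (\<integral>\<^sup>+x. (\<integral>\<^sup>+y. ennreal (exp (- \<theta> * x)) * indicator {0..} x * indicator {0..<g x} y \<partial>lborel) \<partial>lborel)"
      by (rule lborel_pair.Fubini') (unfold indicator_def atLeastLessThan_iff, measurable)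
    also have "\<dots> = I"
      unfolding I_def
    proof (rule nn_integral_cong)
      fix x
      have "(\<integral>\<^sup>+y. ennreal (exp (- \<theta> * x)) * indicator {0..} x * indicator {0..<g x} y \<partial>lborel)
        = ennreal (exp (- \<theta> * x)) * indicator {0..} x * ennreal (g x)"
        using g0[of x] by (subst nn_integral_cmult_indicator) auto
      then show "(\<integral>\<^sup>+y. ennreal (exp (- \<theta> * x)) * indicator {0..} x * indicator {0..<g x} y \<partial>lborel)
        = ennreal (exp (- \<theta> * x)) * ennreal (g x) * indicator {0..} x" by (simp add: mult_ac)
    qed
    finally have "ennreal (norm ?E) \<le> ennreal (D * exp (\<theta> * t)) * I" .
    also have "\<dots> = ennreal (D * exp (\<theta> * t) * enn2real I)"
      using gint D0 unfolding I_def[symmetric] by (simp add: ennreal_mult)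
    finally have "norm ?E \<le> D * exp (\<theta> * t) * enn2real I"
      using D0 by (subst (asm) ennreal_le_iff) auto
    then show ?thesis by (simp add: mult_ac)
  qed
  then show ?thesis by blast
qed

text \<open>A partition ending at or before x can be prolonged by x, which does not lower its sum,
  and then by y, which adds |f y - f x|. From this increment bound both parts of the Jordan
  decomposition are nondecreasing.\<close>

lemma total_variation_add_le:
  assumes "x \<le> y"
  shows "total_variation f x + ennreal \<bar>f y - f x\<bar> \<le> total_variation f y"
proof (cases "x = y")
  case False
  then have xy: "x < y" using assms by simp
  define Pt where "Pt z = {(n :: nat, s :: nat \<Rightarrow> real). n \<ge> 1 \<and> (\<forall>j<n. s j < s (Suc j)) \<and> s n \<le> z}" for z :: real
  define V where "V = (\<lambda>(n :: nat, s :: nat \<Rightarrow> real). \<Sum>j=1..n. \<bar>f (s j) - f (s (j - 1))\<bar>)"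
  have tv: "total_variation f z = (SUP p\<in>Pt z. ennreal (V p))" for z
    unfolding total_variation_def Pt_def V_def by (intro SUP_cong refl) auto
  have ext: "\<exists>p'. p' \<in> Pt z \<and> snd p' (fst p') = z \<and> V p' = V p + \<bar>f z - f (snd p (fst p))\<bar>"
    if "p \<in> Pt w" "snd p (fst p) < z" for p w z
  proof -
    obtain n s where p: "p = (n, s)" by fastforce
    have ns: "n \<ge> 1" "\<And>j. j < n \<Longrightarrow> s j < s (Suc j)" "s n < z" using that by (auto simp: p Pt_def)
    define s' where "s' j = (if j \<le> n then s j else z)" for j
    have "(Suc n, s') \<in> Pt z"
      unfolding Pt_def using ns by (auto simp: s'_def less_Suc_eq Suc_le_eq)
    moreover have "V (Suc n, s') = V p + \<bar>f z - f (s n)\<bar>"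
    proof -
      have "(\<Sum>j=1..n. \<bar>f (s' j) - f (s' (j - 1))\<bar>) = (\<Sum>j=1..n. \<bar>f (s j) - f (s (j - 1))\<bar>)"
        by (intro sum.cong refl) (auto simp: s'_def)
      then show ?thesis by (simp add: V_def p s'_def)
    qed
    ultimately show ?thesis by (intro exI[of _ "(Suc n, s')"]) (auto simp: p s'_def)
  qed
  \<comment> \<open>Nonemptiness lets the constant be moved into the supremum.\<close>
  have ne: "Pt x \<noteq> {}"
  proof -
    have "(1, \<lambda>j. x - 1 + real j) \<in> Pt x" by (simp add: Pt_def)
    then show ?thesis by blast
  qed
  have "ennreal (V p) + ennreal \<bar>f y - f x\<bar> \<le> total_variation f y" if p: "p \<in> Pt x" for p
  proof -
    have "\<exists>p'. p' \<in> Pt x \<and> snd p' (fst p') = x \<and> V p \<le> V p'"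
    proof (cases "snd p (fst p) = x")
      case False
      then have "snd p (fst p) < x" using p by (auto simp: Pt_def)
      from ext[OF p this] obtain p' where "p' \<in> Pt x" "snd p' (fst p') = x" "V p' = V p + \<bar>f x - f (snd p (fst p))\<bar>"
        by (elim exE conjE)
      then show ?thesis by (intro exI[of _ p']) simp
    next
      case True
      then show ?thesis using p by (intro exI[of _ p]) simp
    qed
    then obtain p' where p': "p' \<in> Pt x" "snd p' (fst p') = x" "V p \<le> V p'" by blast
    obtain p'' where p'': "p'' \<in> Pt y" "V p'' = V p' + \<bar>f y - f x\<bar>"
      using ext[OF p'(1), of y] p'(2) xy by auto
    have V0: "V p \<ge> 0" by (auto simp: V_def split: prod.split intro: sum_nonneg)
    have "ennreal (V p) + ennreal \<bar>f y - f x\<bar> = ennreal (V p + \<bar>f y - f x\<bar>)"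
      using V0 by (simp add: ennreal_plus)
    also have "\<dots> \<le> ennreal (V p'')" using p'(3) p''(2) by (intro ennreal_leI) simp
    also have "\<dots> \<le> total_variation f y" unfolding tv by (rule SUP_upper[OF p''(1)])
    finally show ?thesis .
  qed
  then have "(SUP p\<in>Pt x. ennreal (V p) + ennreal \<bar>f y - f x\<bar>) \<le> total_variation f y" by (rule SUP_least)
  moreover have "(SUP p\<in>Pt x. ennreal (V p) + ennreal \<bar>f y - f x\<bar>) = total_variation f x + ennreal \<bar>f y - f x\<bar>"
    unfolding tv by (rule ennreal_SUP_add_left[OF ne])
  ultimately show ?thesis by simp
qed simp

lemma total_variation_eq_0:
  assumes "\<And>z. z \<le> x \<Longrightarrow> f z = 0"
  shows "total_variation f x = 0"
proof -
  have "(\<Sum>j=1..n. \<bar>f (s j) - f (s (j - 1))\<bar>) = 0" if "n \<ge> 1" "\<forall>j<n. s j < s (Suc j)" "s n \<le> x" for n s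
  proof (rule sum.neutral, rule ballI)
    fix j assume "j \<in> {1..n}"
    have le: "s i \<le> s n" if "i \<le> n" for i
      using that
    proof (induction rule: inc_induct)
      case (step i)
      then have "s i < s (Suc i)" using \<open>\<forall>j<n. s j < s (Suc j)\<close> by blast
      with step.IH show ?case by linarith
    qed simp
    then have "s j \<le> x" "s (j - 1) \<le> x" using \<open>j \<in> {1..n}\<close> that(3) by (auto intro: order_trans[OF le])
    then show "\<bar>f (s j) - f (s (j - 1))\<bar> = 0" by (simp add: assms)
  qed
  then have "total_variation f x \<le> 0"
    unfolding total_variation_def by (intro SUP_least) auto
  then show ?thesis by simp
qed

text \<open>The Jordan decomposition \<open>f = Vf - (Vf - f)\<close>.\<close>

lemma monotone_decomposition:
  fixes f :: "real \<Rightarrow> real"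
  assumes neg: "\<And>t. t < 0 \<Longrightarrow> f t = 0"
    and var: "(\<integral>\<^sup>+x\<in>{0..}. ennreal (exp (- \<theta> * x)) * total_variation f x \<partial>lborel) < \<infinity>"
  shows "\<exists>g h. mono g \<and> mono h \<and> (\<forall>x<0. g x = 0 \<and> h x = 0) \<and> (\<forall>x. f x = g x - h x) \<and>
    (\<integral>\<^sup>+x\<in>{0..}. ennreal (exp (- \<theta> * x)) * ennreal (g x) \<partial>lborel) < \<infinity> \<and>
    (\<integral>\<^sup>+x\<in>{0..}. ennreal (exp (- \<theta> * x)) * ennreal (h x) \<partial>lborel) < \<infinity>"
proof -
  define V where "V = total_variation f"
  have Vle: "V x + ennreal \<bar>f y - f x\<bar> \<le> V y" if "x \<le> y" for x y
    unfolding V_def by (rule total_variation_add_le[OF that])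
  have Vmono: "V x \<le> V y" if "x \<le> y" for x y
    using Vle[OF that] by (rule order_trans[rotated]) (rule add_increasing2, auto)
  have Vneg: "V x = 0" if "x < 0" for x
    unfolding V_def using that by (intro total_variation_eq_0 neg) auto
  \<comment> \<open>By monotonicity an infinite value would persist on an interval of length 1 and
    make the weighted integral infinite.\<close>
  have Vfin: "V x < \<infinity>" for x
  proof (rule ccontr)
    assume "\<not> V x < \<infinity>"
    then have inf: "V x = \<infinity>" by (simp add: less_top[symmetric])
    define x0 where "x0 = max x 0"
    have "\<infinity> = (\<integral>\<^sup>+y. \<infinity> * indicator {x0..x0 + 1} y \<partial>(lborel :: real measure))"
      by (subst nn_integral_cmult_indicator) (auto simp: ennreal_top_mult)
    also have "\<dots> \<le> (\<integral>\<^sup>+x\<in>{0..}. ennreal (exp (- \<theta> * x)) * V x \<partial>lborel)"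
    proof (rule nn_integral_mono)
      fix y
      show "\<infinity> * indicator {x0..x0 + 1} y \<le> ennreal (exp (- \<theta> * y)) * V y * indicator {0..} y"
      proof (cases "y \<in> {x0..x0 + 1}")
        case True
        then have "V y = \<infinity>" using Vmono[of x y] inf by (auto simp: x0_def top_unique)
        then show ?thesis using True by (simp add: ennreal_mult_top x0_def)
      qed simp
    qed
    finally show False using var unfolding V_def by simp
  qed
  define g where "g x = enn2real (V x)" for x
  have Vg: "V x = ennreal (g x)" for x using Vfin[of x] by (simp add: g_def)
  have g0: "g x \<ge> 0" for x by (simp add: g_def)
  have gle: "\<bar>f y - f x\<bar> \<le> g y - g x" if "x \<le> y" for x y
  proof -
    have "ennreal (g x + \<bar>f y - f x\<bar>) \<le> ennreal (g y)"
      using Vle[OF that] unfolding Vg by (simp add: ennreal_plus g0)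
    then have "g x + \<bar>f y - f x\<bar> \<le> g y" using g0 by (subst (asm) ennreal_le_iff) auto
    then show ?thesis by simp
  qed
  have gneg: "g x = 0" if "x < 0" for x using Vneg[OF that] by (simp add: g_def)
  have fg: "\<bar>f x\<bar> \<le> g x" for x
  proof (cases "x < 0")
    case False
    then show ?thesis using gle[of "-1" x] neg[of "-1"] gneg[of "-1"] by simp
  qed (simp add: neg gneg)
  define h where "h x = g x - f x" for x
  have mg: "mono g" using gle by (intro monoI) force
  have mh: "mono h"
  proof (rule monoI)
    fix x y :: real assume "x \<le> y"
    then show "h x \<le> h y" using gle[of x y] by (simp add: h_def abs_le_iff)
  qed
  have gi: "(\<integral>\<^sup>+x\<in>{0..}. ennreal (exp (- \<theta> * x)) * ennreal (g x) \<partial>lborel) < \<infinity>"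
    using var unfolding V_def[symmetric] Vg .
  have [measurable]: "g \<in> borel_measurable borel" by (rule borel_measurable_mono[OF mg])
  have "(\<integral>\<^sup>+x\<in>{0..}. ennreal (exp (- \<theta> * x)) * ennreal (h x) \<partial>lborel) \<le> (\<integral>\<^sup>+x. 2 * (ennreal (exp (- \<theta> * x)) * ennreal (g x) * indicator {0..} x) \<partial>lborel)"
  proof (rule nn_integral_mono)
    fix x
    have "ennreal (h x) \<le> ennreal (2 * g x)" using fg[of x] by (intro ennreal_leI) (auto simp: h_def)
    also have "\<dots> = 2 * ennreal (g x)" by (simp add: ennreal_mult g0)
    finally have "ennreal (exp (- \<theta> * x)) * ennreal (h x) \<le> ennreal (exp (- \<theta> * x)) * (2 * ennreal (g x))"
      by (rule mult_left_mono) simp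
    then show "ennreal (exp (- \<theta> * x)) * ennreal (h x) * indicator {0..} x \<le> 2 * (ennreal (exp (- \<theta> * x)) * ennreal (g x) * indicator {0..} x)"
      by (auto simp: indicator_def mult_ac)
  qed
  also have "\<dots> = 2 * (\<integral>\<^sup>+x\<in>{0..}. ennreal (exp (- \<theta> * x)) * ennreal (g x) \<partial>lborel)"
    by (rule nn_integral_cmult) measurable
  also have "\<dots> < \<infinity>" using gi by (simp add: ennreal_mult_less_top)
  finally have hi: "(\<integral>\<^sup>+x\<in>{0..}. ennreal (exp (- \<theta> * x)) * ennreal (h x) \<partial>lborel) < \<infinity>" .
  show ?thesis
    by (intro exI[of _ g] exI[of _ h] conjI mg mh gi hi) (auto simp: gneg h_def neg)
qed

section \<open>Integrals over [0,t] replaced by integrals over the half-line\<close>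

lemma has_bochner_integral_exp_atLeast:
  fixes a b :: real
  assumes "b > 0"
  shows "has_bochner_integral lborel (\<lambda>x. indicator {a..} x * exp (- b * x)) (exp (- b * a) / b)"
proof (rule has_bochner_integral_nn_integral)
  show "(\<integral>\<^sup>+x. ennreal (indicator {a..} x * exp (- b * x)) \<partial>lborel) = ennreal (exp (- b * a) / b)"
    unfolding nn_integral_exp_atLeast[OF assms, symmetric]
    by (intro nn_integral_cong) (simp add: indicator_def)
qed (use assms in auto)

lemma power_exp_le:
  fixes x b :: real
  assumes "b > 0" "x \<ge> 0"
  shows "x ^ k * exp (- b * x) \<le> (2 / b) ^ k * fact k * exp (- (b / 2) * x)"
proof -
  have "(b / 2 * x) ^ k \<le> fact k * exp (b / 2 * x)" using assms by (intro power_le_fact_exp) auto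
  then have "(2 / b) ^ k * (b / 2 * x) ^ k \<le> (2 / b) ^ k * (fact k * exp (b / 2 * x))"
    by (rule mult_left_mono) (use assms in auto)
  also have "(2 / b) ^ k * (b / 2 * x) ^ k = x ^ k" using assms by (simp add: power_mult_distrib[symmetric])
  finally have "x ^ k * exp (- b * x) \<le> (2 / b) ^ k * (fact k * exp (b / 2 * x)) * exp (- b * x)"
    by (rule mult_right_mono) simp
  also have "\<dots> = (2 / b) ^ k * fact k * (exp (b / 2 * x) * exp (- b * x))" by simp
  also have "exp (b / 2 * x) * exp (- b * x) = exp (- (b / 2) * x)" by (simp add: exp_add[symmetric])
  finally show ?thesis .
qed

text \<open>The integrals over \<open>[0,t]\<close> are replaced by integrals over \<open>[0,\<infinity>)\<close>, which leave a polynomial in \<open>t\<close>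
  after expanding \<open>(t - x)\<^sup>k\<close>.\<close>

lemma truncated_convolution_asymptotics:
  fixes f :: "real \<Rightarrow> real" and r :: complex
  assumes fm[measurable]: "f \<in> borel_measurable borel" and fb: "\<And>x. x \<ge> 0 \<Longrightarrow> \<bar>f x\<bar> \<le> C * exp (\<theta> * x)"
    and r: "Re r > \<theta>"
  shows "\<exists>d C'. \<forall>t\<ge>0. norm (exp (r * complex_of_real t) *
        (LINT x:{0..t}|lborel. complex_of_real (f x * (t - x) ^ k) * exp (- r * complex_of_real x))
      - exp (r * complex_of_real t) * (\<Sum>m\<le>k. complex_of_real (t ^ m) * d m)) \<le> C' * exp (\<theta> * t)"
proof -
  define b where "b = Re r - \<theta>"
  have b: "b > 0" using r by (simp add: b_def)
  have C0: "C \<ge> 0" using fb[of 0] by simp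
  define M where "M = (2 / b) ^ k * fact k"
  have M0: "M \<ge> 0" using b by (simp add: M_def)
  define \<psi> where "\<psi> n x = indicator {0..} x *\<^sub>R (complex_of_real (f x * x ^ n) * exp (- r * complex_of_real x))" for n x
  have \<psi>i: "integrable lborel (\<psi> n)" for n
  proof (rule Bochner_Integration.integrable_bound)
    show "integrable lborel (\<lambda>x. (C * ((2 / b) ^ n * fact n)) * (indicator {0..} x * exp (- (b / 2) * x)))"
      by (rule integrable_mult_right, rule integrable.intros, rule has_bochner_integral_exp_atLeast) (use b in simp)
    show "\<psi> n \<in> borel_measurable lborel" unfolding \<psi>_def[abs_def] by measurable
    show "AE x in lborel. norm (\<psi> n x) \<le> norm ((C * ((2 / b) ^ n * fact n)) * (indicator {0..} x * exp (- (b / 2) * x)))"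
    proof (rule AE_I2)
      fix x :: real
      show "norm (\<psi> n x) \<le> norm ((C * ((2 / b) ^ n * fact n)) * (indicator {0..} x * exp (- (b / 2) * x)))"
      proof (cases "x \<ge> 0")
        case True
        have "norm (\<psi> n x) = \<bar>f x\<bar> * (x ^ n * exp (- Re r * x))"
          using True by (simp add: \<psi>_def norm_mult norm_power power_abs)
        also have "\<dots> \<le> (C * exp (\<theta> * x)) * (x ^ n * exp (- Re r * x))"
          using True by (intro mult_right_mono fb) auto
        also have "\<dots> = C * (x ^ n * exp (- b * x))"
        proof -
          have "\<theta> * x + - Re r * x = - b * x" by (simp add: b_def algebra_simps)
          then have "exp (\<theta> * x) * exp (- Re r * x) = exp (- b * x)" by (simp only: exp_add[symmetric])
          then show ?thesis by (simp add: mult_ac)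
        qed
        also have "\<dots> \<le> C * ((2 / b) ^ n * fact n * exp (- (b / 2) * x))"
          by (intro mult_left_mono power_exp_le b True C0)
        finally show ?thesis using True C0 b by (simp add: mult.assoc)
      qed (simp add: \<psi>_def)
    qed
  qed
  \<comment> \<open>The coefficient of t^m in the binomial expansion of (t - x)^k, integrated over
    the whole half-line.\<close>
  define d where "d m = of_nat (k choose m) * ((- 1) ^ (k - m) * (LBINT x. \<psi> (k - m) x))" for m
  have "norm (exp (r * complex_of_real t) *
        (LINT x:{0..t}|lborel. complex_of_real (f x * (t - x) ^ k) * exp (- r * complex_of_real x))
      - exp (r * complex_of_real t) * (\<Sum>m\<le>k. complex_of_real (t ^ m) * d m)) \<le> (C * M * 2 / b) * exp (\<theta> * t)"
    if t: "t \<ge> 0" for t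
  proof -
    define \<rho> where "\<rho> x = indicator {0..} x *\<^sub>R (complex_of_real (f x * (t - x) ^ k) * exp (- r * complex_of_real x))" for x
    have \<rho>_sum: "\<rho> x = (\<Sum>m\<le>k. complex_of_real (t ^ m) * (of_nat (k choose m) * ((- 1) ^ (k - m) * \<psi> (k - m) x)))" for x
    proof -
      have "(t - x) ^ k = (\<Sum>m\<le>k. of_nat (k choose m) * t ^ m * (- x) ^ (k - m))"
        using binomial_ring[of t "- x" k] by simp
      also have "\<dots> = (\<Sum>m\<le>k. of_nat (k choose m) * t ^ m * ((- 1) ^ (k - m) * x ^ (k - m)))"
        by (intro sum.cong refl) (simp add: power_minus[of x])
      finally have e: "(t - x) ^ k = (\<Sum>m\<le>k. of_nat (k choose m) * t ^ m * ((- 1) ^ (k - m) * x ^ (k - m)))" .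
      show ?thesis unfolding \<rho>_def \<psi>_def e
        by (simp add: sum_distrib_left sum_distrib_right scaleR_sum_right mult_ac)
    qed
    have \<rho>i: "integrable lborel \<rho>"
      unfolding \<rho>_sum[abs_def] by (intro Bochner_Integration.integrable_sum integrable_mult_right \<psi>i)
    have "(LBINT x. \<rho> x) = (\<Sum>m\<le>k. complex_of_real (t ^ m) * d m)"
      unfolding \<rho>_sum d_def by (simp add: Bochner_Integration.integral_sum \<psi>i)
    moreover have "(LBINT x. \<rho> x) - (LINT x:{0..t}|lborel. complex_of_real (f x * (t - x) ^ k) * exp (- r * complex_of_real x))
      = (LBINT x. indicator {t<..} x *\<^sub>R \<rho> x)"
    proof -
      have "(LINT x:{0..t}|lborel. complex_of_real (f x * (t - x) ^ k) * exp (- r * complex_of_real x)) = (LBINT x. indicator {..t} x *\<^sub>R \<rho> x)"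
        unfolding set_lebesgue_integral_def
      proof (intro Bochner_Integration.integral_cong refl)
        fix x
        show "indicator {0..t} x *\<^sub>R (complex_of_real (f x * (t - x) ^ k) * exp (- r * complex_of_real x)) = indicator {..t} x *\<^sub>R \<rho> x"
          by (cases "0 \<le> x"; cases "x \<le> t") (simp_all add: \<rho>_def)
      qed
      moreover have "integrable lborel (\<lambda>x. indicator {..t} x *\<^sub>R \<rho> x)"
        by (rule integrable_mult_indicator[OF _ \<rho>i]) simp
      ultimately have "(LBINT x. \<rho> x) - (LINT x:{0..t}|lborel. complex_of_real (f x * (t - x) ^ k) * exp (- r * complex_of_real x))
        = (LBINT x. \<rho> x - indicator {..t} x *\<^sub>R \<rho> x)"
        by (simp only: Bochner_Integration.integral_diff[OF \<rho>i])
      also have "\<dots> = (LBINT x. indicator {t<..} x *\<^sub>R \<rho> x)"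
        by (intro Bochner_Integration.integral_cong refl) (simp add: indicator_def)
      finally show ?thesis .
    qed
    ultimately have diff: "exp (r * complex_of_real t) *
        (LINT x:{0..t}|lborel. complex_of_real (f x * (t - x) ^ k) * exp (- r * complex_of_real x))
      - exp (r * complex_of_real t) * (\<Sum>m\<le>k. complex_of_real (t ^ m) * d m)
      = - (exp (r * complex_of_real t) * (LBINT x. indicator {t<..} x *\<^sub>R \<rho> x))"
      by (simp add: algebra_simps)
    have I: "has_bochner_integral lborel (\<lambda>x. (C * M * exp ((\<theta> - Re r) * t) * exp (b / 2 * t)) * (indicator {t..} x * exp (- (b / 2) * x)))
        ((C * M * exp ((\<theta> - Re r) * t) * exp (b / 2 * t)) * (exp (- (b / 2) * t) / (b / 2)))"
      by (intro has_bochner_integral_mult_right has_bochner_integral_exp_atLeast) (use b in auto)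
    have "norm (LBINT x. indicator {t<..} x *\<^sub>R \<rho> x) \<le> (LBINT x. (C * M * exp ((\<theta> - Re r) * t) * exp (b / 2 * t)) * (indicator {t..} x * exp (- (b / 2) * x)))"
    proof (rule order_trans[OF integral_norm_bound integral_mono])
      show "integrable lborel (\<lambda>x. norm (indicator {t<..} x *\<^sub>R \<rho> x))"
        by (intro integrable_norm integrable_mult_indicator[OF _ \<rho>i]) simp
      show "integrable lborel (\<lambda>x. (C * M * exp ((\<theta> - Re r) * t) * exp (b / 2 * t)) * (indicator {t..} x * exp (- (b / 2) * x)))"
        using I by (rule integrable.intros)
      fix x
      show "norm (indicator {t<..} x *\<^sub>R \<rho> x) \<le> (C * M * exp ((\<theta> - Re r) * t) * exp (b / 2 * t)) * (indicator {t..} x * exp (- (b / 2) * x))"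
      proof (cases "x > t")
        case True
        have "norm (indicator {t<..} x *\<^sub>R \<rho> x) = \<bar>f x\<bar> * ((x - t) ^ k * exp (- Re r * x))"
        proof -
          have "norm (complex_of_real (f x * (t - x) ^ k)) = \<bar>f x\<bar> * (x - t) ^ k"
            using True by (simp only: norm_of_real abs_mult power_abs) simp
          then show ?thesis using True t by (simp add: \<rho>_def norm_mult del: of_real_mult)
        qed
        also have "\<dots> \<le> (C * exp (\<theta> * x)) * ((x - t) ^ k * exp (- Re r * x))"
          using True t by (intro mult_right_mono fb) auto
        \<comment> \<open>Seen from t, the tail decays in x - t at the rate b = Re r - \<theta>;
          half of this rate then pays for the power of x - t.\<close>
        also have "\<dots> = C * exp ((\<theta> - Re r) * t) * ((x - t) ^ k * exp (- b * (x - t)))"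
        proof -
          have "\<theta> * x + - Re r * x = (\<theta> - Re r) * t + - b * (x - t)" by (simp add: b_def algebra_simps)
          then have "exp (\<theta> * x) * exp (- Re r * x) = exp ((\<theta> - Re r) * t) * exp (- b * (x - t))"
            by (simp only: exp_add[symmetric])
          then show ?thesis by (simp add: mult_ac)
        qed
        also have "\<dots> \<le> C * exp ((\<theta> - Re r) * t) * (M * exp (- (b / 2) * (x - t)))"
          unfolding M_def using True C0 by (intro mult_left_mono power_exp_le b) auto
        also have "exp (- (b / 2) * (x - t)) = exp (b / 2 * t) * exp (- (b / 2) * x)"
          by (simp add: exp_add[symmetric] algebra_simps diff_divide_distrib)
        finally show ?thesis using True by (simp add: mult_ac)
      next
        case False
        then show ?thesis using C0 M0 by (simp add: indicator_def)
      qed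
    qed
    also have "\<dots> = (C * M * exp ((\<theta> - Re r) * t) * exp (b / 2 * t)) * (exp (- (b / 2) * t) / (b / 2))"
      using I by (rule has_bochner_integral_integral_eq)
    also have "\<dots> = C * M * 2 / b * exp ((\<theta> - Re r) * t) * (exp (b / 2 * t) * exp (- (b / 2) * t))" by simp
    also have "exp (b / 2 * t) * exp (- (b / 2) * t) = 1" by (simp add: exp_add[symmetric])
    finally have n: "norm (LBINT x. indicator {t<..} x *\<^sub>R \<rho> x) \<le> C * M * 2 / b * exp ((\<theta> - Re r) * t)" by simp
    have "norm (exp (r * complex_of_real t) * (LBINT x. indicator {t<..} x *\<^sub>R \<rho> x)) \<le> exp (Re r * t) * (C * M * 2 / b * exp ((\<theta> - Re r) * t))"
      unfolding norm_mult using n by (intro mult_mono) auto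
    also have "\<dots> = (C * M * 2 / b) * (exp (Re r * t) * exp ((\<theta> - Re r) * t))" by (simp only: mult_ac)
    also have "exp (Re r * t) * exp ((\<theta> - Re r) * t) = exp (\<theta> * t)" by (simp add: exp_add[symmetric] algebra_simps)
    finally show ?thesis unfolding diff norm_minus_cancel .
  qed
  then show ?thesis by blast
qed

text \<open>A nondecreasing g is at least g x on [x,\<infinity>), where the weight has mass
  exp(-\<theta> x)/\<theta>.\<close>

lemma mono_exp_bound:
  fixes g :: "real \<Rightarrow> real"
  assumes g: "mono g" "\<And>x. 0 \<le> g x" and "\<theta> > 0"
    and int: "(\<integral>\<^sup>+x\<in>{0..}. ennreal (exp (- \<theta> * x)) * ennreal (g x) \<partial>lborel) < \<infinity>"
  shows "\<exists>C. \<forall>x\<ge>0. g x \<le> C * exp (\<theta> * x)"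
proof -
  define I where "I = (\<integral>\<^sup>+x\<in>{0..}. ennreal (exp (- \<theta> * x)) * ennreal (g x) \<partial>lborel)"
  have "g x \<le> (\<theta> * enn2real I) * exp (\<theta> * x)" if x: "x \<ge> 0" for x
  proof -
    have "ennreal (exp (- \<theta> * x) / \<theta> * g x) = (\<integral>\<^sup>+y\<in>{x..}. ennreal (exp (- \<theta> * y)) \<partial>lborel) * ennreal (g x)"
      unfolding nn_integral_exp_atLeast[OF \<open>\<theta> > 0\<close>] using g(2) \<open>\<theta> > 0\<close> by (intro ennreal_mult) auto
    also have "\<dots> = (\<integral>\<^sup>+y. ennreal (exp (- \<theta> * y)) * indicator {x..} y * ennreal (g x) \<partial>lborel)"
      by (rule nn_integral_multc[symmetric]) measurable
    also have "\<dots> \<le> I"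
      unfolding I_def
    proof (rule nn_integral_mono)
      fix y
      show "ennreal (exp (- \<theta> * y)) * indicator {x..} y * ennreal (g x) \<le> ennreal (exp (- \<theta> * y)) * ennreal (g y) * indicator {0..} y"
        using x monoD[OF g(1), of x y] by (auto simp: indicator_def intro!: mult_left_mono ennreal_leI)
    qed
    finally have "exp (- \<theta> * x) / \<theta> * g x \<le> enn2real I"
      using int unfolding I_def[symmetric] by (metis enn2real_mono enn2real_ennreal g(2) mult_nonneg_nonneg exp_ge_zero divide_nonneg_nonneg less_imp_le[OF \<open>\<theta> > 0\<close>] infinity_ennreal_def)
    then show ?thesis using \<open>\<theta> > 0\<close> by (simp add: field_simps exp_minus)
  qed
  then show ?thesis by blast
qed

text \<open>For \<theta> \<le> 0 the weight is at least 1 on the half-line, so a single positive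
  value of a nondecreasing g would make the integral infinite.\<close>

lemma mono_exp_integrable_imp_0:
  fixes g :: "real \<Rightarrow> real"
  assumes g: "mono g" "\<And>x. 0 \<le> g x" and "\<theta> \<le> 0"
    and int: "(\<integral>\<^sup>+x\<in>{0..}. ennreal (exp (- \<theta> * x)) * ennreal (g x) \<partial>lborel) < \<infinity>"
  shows "g x = 0"
proof (rule ccontr)
  assume "g x \<noteq> 0"
  then have gx: "g x > 0" using g(2)[of x] by simp
  define x0 where "x0 = max x 0"
  have "(\<integral>\<^sup>+y. ennreal (g x) * indicator {x0..} y \<partial>lborel) \<le> (\<integral>\<^sup>+x\<in>{0..}. ennreal (exp (- \<theta> * x)) * ennreal (g x) \<partial>lborel)"
  proof (rule nn_integral_mono)
    fix y
    show "ennreal (g x) * indicator {x0..} y \<le> ennreal (exp (- \<theta> * y)) * ennreal (g y) * indicator {0..} y"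
    proof (cases "y \<ge> x0")
      case True
      then have y: "y \<ge> 0" "g x \<le> g y" using monoD[OF g(1), of x y] by (auto simp: x0_def)
      then have "1 * g y \<le> exp (- \<theta> * y) * g y" using \<open>\<theta> \<le> 0\<close> g(2) by (intro mult_right_mono) (auto intro: mult_nonpos_nonneg)
      then have "ennreal (g x) \<le> ennreal (exp (- \<theta> * y) * g y)" using y by (intro ennreal_leI) simp
      then show ?thesis using True y g(2) by (simp add: ennreal_mult)
    qed simp
  qed
  moreover have "(\<integral>\<^sup>+y. ennreal (g x) * indicator {x0..} y \<partial>lborel) = \<infinity>"
  proof -
    have "of_nat n \<le> emeasure lborel {x0..}" for n
    proof -
      have "of_nat n = emeasure lborel {x0..x0 + real n}" by (simp add: ennreal_of_nat_eq_real_of_nat)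
      also have "\<dots> \<le> emeasure lborel {x0..}" by (rule emeasure_mono) auto
      finally show ?thesis .
    qed
    then have "emeasure lborel {x0..} = \<infinity>"
      using ennreal_Ex_less_of_nat[of "emeasure lborel {x0..}"] by (auto simp: less_top[symmetric] not_less[symmetric])
    then show ?thesis using gx by (simp add: nn_integral_cmult_indicator ennreal_mult_top)
  qed
  ultimately show False using int by simp
qed

section \<open>Point processes and independence\<close>

text \<open>Evaluations at Borel sets are measurable by construction of the sigma-algebra; the usual
  induction over nonnegative functions carries this over to integrals.\<close>

lemma nn_integral_measurable_point_measure_algebra:
  assumes "g \<in> borel_measurable borel"
  shows "(\<lambda>\<nu>. \<integral>\<^sup>+x. g x \<partial>\<nu>) \<in> borel_measurable point_measure_algebra"
proof -
  have sp: "sets \<nu> = sets borel" if "\<nu> \<in> space point_measure_algebra" for \<nu>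
    using that by (simp add: space_point_measure_algebra locally_finite_point_measure_def)
  have m: "h \<in> borel_measurable \<nu>" if "\<nu> \<in> space point_measure_algebra" "h \<in> borel_measurable borel" for h \<nu>
    using that(2) by (simp add: measurable_cong_sets[OF sp[OF that(1)] refl])
  show ?thesis
    using assms
  proof (induction rule: borel_measurable_induct)
    case (cong f g)
    then have "f = g" by (auto simp: fun_eq_iff)
    with cong.IH show ?case by (simp only:)
  next
    case (set A)
    have eq: "(\<integral>\<^sup>+x. indicator A x \<partial>\<nu>) = emeasure \<nu> A" if "\<nu> \<in> space point_measure_algebra" for \<nu>
      using set by (intro nn_integral_indicator) (simp add: sp[OF that])
    show ?case
      using measurable_emeasure_point_measure_algebra[OF set] by (simp only: measurable_cong[OF eq])
  next
    case (mult u c)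
    have eq: "(\<integral>\<^sup>+x. c * u x \<partial>\<nu>) = c * (\<integral>\<^sup>+x. u x \<partial>\<nu>)" if "\<nu> \<in> space point_measure_algebra" for \<nu>
      by (rule nn_integral_cmult[OF m[OF that mult(2)]])
    have "(\<lambda>\<nu>. c * (\<integral>\<^sup>+x. u x \<partial>\<nu>)) \<in> borel_measurable point_measure_algebra"
      by (rule borel_measurable_times_ennreal[OF measurable_const mult.IH]) simp
    then show ?case by (simp only: measurable_cong[OF eq])
  next
    case (add u v)
    have eq: "(\<integral>\<^sup>+x. v x + u x \<partial>\<nu>) = (\<integral>\<^sup>+x. v x \<partial>\<nu>) + (\<integral>\<^sup>+x. u x \<partial>\<nu>)" if "\<nu> \<in> space point_measure_algebra" for \<nu>
      by (rule nn_integral_add[OF m[OF that] m[OF that]]) (rule add)+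
    have "(\<lambda>\<nu>. (\<integral>\<^sup>+x. v x \<partial>\<nu>) + (\<integral>\<^sup>+x. u x \<partial>\<nu>)) \<in> borel_measurable point_measure_algebra"
      by (rule borel_measurable_add[OF add.IH(2) add.IH(1)])
    then show ?case by (simp only: measurable_cong[OF eq])
  next
    case (seq U)
    have eq: "(\<integral>\<^sup>+x. (SUP i. U i) x \<partial>\<nu>) = (SUP i. \<integral>\<^sup>+x. U i x \<partial>\<nu>)" if "\<nu> \<in> space point_measure_algebra" for \<nu>
      unfolding SUP_apply by (rule nn_integral_monotone_convergence_SUP[OF \<open>incseq U\<close> m[OF that]]) (rule seq)
    have "(\<lambda>\<nu>. SUP i. \<integral>\<^sup>+x. U i x \<partial>\<nu>) \<in> borel_measurable point_measure_algebra"
      by (rule borel_measurable_SUP[OF _ seq.IH]) simp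
    then show ?case by (simp only: measurable_cong[OF eq])
  qed
qed

lemma sets_intensity [simp]: "sets (intensity M \<xi> i j) = sets borel"
  unfolding intensity_def using sets.sigma_sets_eq[of "borel :: real measure"] by simp

lemma measurable_repro_component:
  assumes "\<xi> \<in> measurable M repro_algebra"
  shows "(\<lambda>\<omega>. \<xi> \<omega> i j) \<in> measurable M point_measure_algebra"
proof -
  have "(\<lambda>x. x i) \<in> measurable repro_algebra (\<Pi>\<^sub>M j\<in>UNIV. point_measure_algebra)"
    unfolding repro_algebra_def by (rule measurable_component_singleton) simp
  moreover have "(\<lambda>x. x j) \<in> measurable (\<Pi>\<^sub>M j\<in>UNIV. point_measure_algebra) point_measure_algebra"
    by (rule measurable_component_singleton) simp
  ultimately show ?thesis
    using measurable_compose[OF measurable_compose[OF assms]] by blast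
qed

text \<open>Campbell's formula: for indicators it is the definition of the intensity, and linearity
  and monotone convergence extend it.\<close>

lemma nn_integral_intensity:
  assumes \<xi>: "\<xi> \<in> measurable M repro_algebra" and "g \<in> borel_measurable borel"
  shows "(\<integral>\<^sup>+x. g x \<partial>intensity M \<xi> i j) = (\<integral>\<^sup>+\<omega>. (\<integral>\<^sup>+x. g x \<partial>\<xi> \<omega> i j) \<partial>M)"
proof -
  note c = measurable_repro_component[OF \<xi>, of i j]
  have sp: "sets (\<xi> \<omega> i j) = sets borel" if "\<omega> \<in> space M" for \<omega>
    using measurable_space[OF c that] by (simp add: space_point_measure_algebra locally_finite_point_measure_def)
  have m: "h \<in> borel_measurable (\<xi> \<omega> i j)" if "\<omega> \<in> space M" "h \<in> borel_measurable borel" for h :: "real \<Rightarrow> ennreal" and \<omega>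
    using that(2) by (simp add: measurable_cong_sets[OF sp[OF that(1)] refl])
  have mi: "h \<in> borel_measurable (intensity M \<xi> i j)" if "h \<in> borel_measurable borel" for h :: "real \<Rightarrow> ennreal"
    using that by (simp add: measurable_cong_sets[OF sets_intensity refl])
  have mn: "(\<lambda>\<omega>. \<integral>\<^sup>+x. h x \<partial>\<xi> \<omega> i j) \<in> borel_measurable M" if "h \<in> borel_measurable borel" for h
    by (rule measurable_compose[OF c nn_integral_measurable_point_measure_algebra[OF that]])
  show ?thesis
    using assms(2)
  proof (induction rule: borel_measurable_induct)
    case (cong f g)
    then have "f = g" by (simp add: fun_eq_iff)
    with cong show ?case by simp
  next
    case (set A)
    then have "(\<integral>\<^sup>+\<omega>. (\<integral>\<^sup>+x. indicator A x \<partial>\<xi> \<omega> i j) \<partial>M) = (\<integral>\<^sup>+\<omega>. emeasure (\<xi> \<omega> i j) A \<partial>M)"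
      by (intro nn_integral_cong) (simp add: sp)
    then show ?case using set by (simp add: emeasure_intensity[OF \<xi>])
  next
    case (mult u c)
    have "(\<integral>\<^sup>+\<omega>. (\<integral>\<^sup>+x. c * u x \<partial>\<xi> \<omega> i j) \<partial>M) = (\<integral>\<^sup>+\<omega>. c * (\<integral>\<^sup>+x. u x \<partial>\<xi> \<omega> i j) \<partial>M)"
      by (intro nn_integral_cong nn_integral_cmult m mult)
    then show ?case using mult by (simp add: nn_integral_cmult mi mn)
  next
    case (add u v)
    have "(\<integral>\<^sup>+\<omega>. (\<integral>\<^sup>+x. v x + u x \<partial>\<xi> \<omega> i j) \<partial>M) = (\<integral>\<^sup>+\<omega>. (\<integral>\<^sup>+x. v x \<partial>\<xi> \<omega> i j) + (\<integral>\<^sup>+x. u x \<partial>\<xi> \<omega> i j) \<partial>M)"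
      by (intro nn_integral_cong nn_integral_add m add)
    then show ?case using add by (simp add: nn_integral_add mi mn)
  next
    case (seq U)
    have "(\<integral>\<^sup>+\<omega>. (\<integral>\<^sup>+x. (SUP n. U n x) \<partial>\<xi> \<omega> i j) \<partial>M) = (\<integral>\<^sup>+\<omega>. (SUP n. \<integral>\<^sup>+x. U n x \<partial>\<xi> \<omega> i j) \<partial>M)"
      using seq by (intro nn_integral_cong nn_integral_monotone_convergence_SUP m) auto
    also have "\<dots> = (SUP n. \<integral>\<^sup>+\<omega>. (\<integral>\<^sup>+x. U n x \<partial>\<xi> \<omega> i j) \<partial>M)"
      using seq by (intro nn_integral_monotone_convergence_SUP mn)
        (auto simp: incseq_def le_fun_def intro!: nn_integral_mono)
    also have "\<dots> = (SUP n. \<integral>\<^sup>+x. U n x \<partial>intensity M \<xi> i j)" by (simp add: seq)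
    also have "\<dots> = (\<integral>\<^sup>+x. (SUP n. U n x) \<partial>intensity M \<xi> i j)"
      using seq by (intro nn_integral_monotone_convergence_SUP[symmetric] mi) auto
    finally show ?case by (simp add: image_comp)
  qed
qed

section \<open>Generated sigma-algebras and independence\<close>

lemma sets_vimage_algebra_subset:
  assumes "f \<in> measurable N K"
  shows "sets (vimage_algebra (space N) f K) \<subseteq> sets N"
proof -
  have "f \<in> space N \<rightarrow> space K" using assms by (auto dest: measurable_space)
  then have "sets (vimage_algebra (space N) f K) = {f -` A \<inter> space N |A. A \<in> sets K}"
    by (rule sets_vimage_algebra2)
  then show ?thesis using measurable_sets[OF assms] by auto
qed

text \<open>Identity maps into the two sub-sigma-algebras serve as random variables. Their
  independence is a product law for the diagonal map, and no generating variables have to be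
  named.\<close>

lemma (in prob_space) indep_subalgebras_distr:
  assumes A: "subalgebra M A" and B: "subalgebra M B" and ind: "indep_set (sets A) (sets B)"
  shows "distr M A (\<lambda>\<omega>. \<omega>) \<Otimes>\<^sub>M distr M B (\<lambda>\<omega>. \<omega>) = distr M (A \<Otimes>\<^sub>M B) (\<lambda>\<omega>. (\<omega>, \<omega>))"
proof -
  have id: "(\<lambda>\<omega>. \<omega>) \<in> measurable M A" "(\<lambda>\<omega>. \<omega>) \<in> measurable M B"
    using A B by (auto simp: subalgebra_def measurable_def)
  have eq: "sigma_sets (space M) {(\<lambda>\<omega>. \<omega>) -` X \<inter> space M |X. X \<in> sets N} = sets N" if "subalgebra M N" for N
  proof -
    have sp: "space N = space M" using that by (simp add: subalgebra_def)
    have "(\<lambda>\<omega>. \<omega>) -` X \<inter> space M = X" if "X \<in> sets N" for X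
      using sets.sets_into_space[OF that] by (auto simp: sp)
    then have "(\<lambda>X. (\<lambda>\<omega>. \<omega>) -` X \<inter> space M) ` sets N = sets N" by simp
    then have "{(\<lambda>\<omega>. \<omega>) -` X \<inter> space M |X. X \<in> sets N} = sets N" by (simp only: Setcompr_eq_image)
    then show ?thesis using sets.sigma_sets_eq[of N] by (simp only: sp)
  qed
  have "indep_var A (\<lambda>\<omega>. \<omega>) B (\<lambda>\<omega>. \<omega>)"
    unfolding indep_var_eq eq[OF A] eq[OF B] using id ind by simp
  then show ?thesis by (simp add: indep_var_distribution_eq)
qed

lemma (in prob_space) indep_subalgebras_nn_integral_mult:
  fixes X Y :: "'a \<Rightarrow> ennreal"
  assumes A: "subalgebra M A" and B: "subalgebra M B" and ind: "indep_set (sets A) (sets B)"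
    and X: "X \<in> borel_measurable A" and Y: "Y \<in> borel_measurable B"
  shows "(\<integral>\<^sup>+\<omega>. X \<omega> * Y \<omega> \<partial>M) = (\<integral>\<^sup>+\<omega>. X \<omega> \<partial>M) * (\<integral>\<^sup>+\<omega>. Y \<omega> \<partial>M)"
proof -
  have id: "(\<lambda>\<omega>. \<omega>) \<in> measurable M A" "(\<lambda>\<omega>. \<omega>) \<in> measurable M B"
    using A B by (auto simp: subalgebra_def measurable_def)
  note [measurable] = X Y
  interpret DB: prob_space "distr M B (\<lambda>\<omega>. \<omega>)" by (rule prob_space_distr[OF id(2)])
  have diag: "(\<lambda>\<omega>. (\<omega>, \<omega>)) \<in> measurable M (A \<Otimes>\<^sub>M B)" by (rule measurable_Pair[OF id])
  have XY: "(\<lambda>(a, b). X a * Y b) \<in> borel_measurable (A \<Otimes>\<^sub>M B)" by measurable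
  have "(\<integral>\<^sup>+\<omega>. X \<omega> * Y \<omega> \<partial>M) = (\<integral>\<^sup>+p. (\<lambda>(a, b). X a * Y b) p \<partial>distr M (A \<Otimes>\<^sub>M B) (\<lambda>\<omega>. (\<omega>, \<omega>)))"
    by (subst nn_integral_distr[OF diag]) (simp_all add: XY)
  also have "\<dots> = (\<integral>\<^sup>+a. (\<integral>\<^sup>+b. X a * Y b \<partial>distr M B (\<lambda>\<omega>. \<omega>)) \<partial>distr M A (\<lambda>\<omega>. \<omega>))"
    unfolding indep_subalgebras_distr[OF A B ind, symmetric]
    by (subst DB.nn_integral_fst[symmetric]) (simp_all add: measurable_cong_sets[OF sets_pair_measure_cong[OF sets_distr sets_distr] refl] XY)
  also have "\<dots> = (\<integral>\<^sup>+\<omega>. X \<omega> \<partial>M) * (\<integral>\<^sup>+\<omega>. Y \<omega> \<partial>M)"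
    by (simp add: nn_integral_cmult nn_integral_multc nn_integral_distr[OF id(1)] nn_integral_distr[OF id(2)])
  finally show ?thesis .
qed

text \<open>The freezing lemma: the second argument is held fixed while the first is averaged. Joint
  measurability of H is what permits inserting a random time into an independent random
  function.\<close>

lemma (in prob_space) indep_subalgebras_integral:
  fixes H :: "'a \<Rightarrow> 'a \<Rightarrow> real"
  assumes A: "subalgebra M A" and B: "subalgebra M B" and ind: "indep_set (sets A) (sets B)"
    and H: "case_prod H \<in> borel_measurable (A \<Otimes>\<^sub>M B)" and int: "integrable M (\<lambda>\<omega>. H \<omega> \<omega>)"
  shows "(LINT \<omega>|M. H \<omega> \<omega>) = (LINT b|M. (LINT a|M. H a b))"
proof -
  have id: "(\<lambda>\<omega>. \<omega>) \<in> measurable M A" "(\<lambda>\<omega>. \<omega>) \<in> measurable M B"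
    using A B by (auto simp: subalgebra_def measurable_def)
  let ?A = "distr M A (\<lambda>\<omega>. \<omega>)" and ?B = "distr M B (\<lambda>\<omega>. \<omega>)"
  interpret DA: prob_space ?A by (rule prob_space_distr[OF id(1)])
  interpret DB: prob_space ?B by (rule prob_space_distr[OF id(2)])
  interpret P: pair_sigma_finite ?A ?B ..
  have diag: "(\<lambda>\<omega>. (\<omega>, \<omega>)) \<in> measurable M (A \<Otimes>\<^sub>M B)" by (rule measurable_Pair[OF id])
  have i: "integrable (?A \<Otimes>\<^sub>M ?B) (case_prod H)"
    unfolding indep_subalgebras_distr[OF A B ind] by (subst integrable_distr_eq[OF diag H]) (simp add: int)
  have "(LINT \<omega>|M. H \<omega> \<omega>) = (LINT p|distr M (A \<Otimes>\<^sub>M B) (\<lambda>\<omega>. (\<omega>, \<omega>)). case_prod H p)"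
    by (subst integral_distr[OF diag H]) simp
  also have "\<dots> = (LINT b|?B. (LINT a|?A. H a b))"
    unfolding indep_subalgebras_distr[OF A B ind, symmetric] using P.integral_snd[OF i] by simp
  also have "\<dots> = (LINT b|M. (LINT a|?A. H a b))"
  proof (rule integral_distr[OF id(2)])
    show "(\<lambda>b. LINT a|?A. H a b) \<in> borel_measurable B"
      using P.integrable_snd[OF i] by (auto dest!: borel_measurable_integrable)
  qed
  also have "\<dots> = (LINT b|M. (LINT a|M. H a b))"
  proof (rule Bochner_Integration.integral_cong[OF refl])
    fix b assume "b \<in> space M"
    then have "b \<in> space B" using B by (simp add: subalgebra_def)
    from measurable_compose[OF measurable_Pair2'[OF this] H]
    show "(LINT a|?A. H a b) = (LINT a|M. H a b)" by (intro integral_distr[OF id(1)]) simp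
  qed
  finally show ?thesis .
qed

text \<open>Every word is the root or arises uniquely by appending a last letter, so that the sum is
  organised by parents.\<close>

lemma nn_integral_count_space_snoc:
  fixes f :: "nat list \<Rightarrow> ennreal"
  shows "(\<integral>\<^sup>+u. f u \<partial>count_space UNIV) = f [] + (\<integral>\<^sup>+u. (\<integral>\<^sup>+k. f (u @ [k]) \<partial>count_space UNIV) \<partial>count_space UNIV)"
proof -
  have "(\<integral>\<^sup>+u. f u \<partial>count_space UNIV) = (\<integral>\<^sup>+u. f u * indicator {[]} u + f u * indicator (- {[]}) u \<partial>count_space UNIV)"
    by (intro nn_integral_cong) (auto simp: indicator_def)
  also have "\<dots> = (\<integral>\<^sup>+u. f u * indicator {[]} u \<partial>count_space UNIV) + (\<integral>\<^sup>+u. f u * indicator (- {[]}) u \<partial>count_space UNIV)"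
    by (rule nn_integral_add) auto
  also have "(\<integral>\<^sup>+u. f u * indicator {[]} u \<partial>count_space UNIV) = f []"
    by (subst nn_integral_indicator_singleton) auto
  also have "(\<integral>\<^sup>+u. f u * indicator (- {[]}) u \<partial>count_space UNIV) = (\<integral>\<^sup>+u. f u \<partial>count_space (- {[]}))"
    by (subst nn_integral_count_space_indicator) (auto simp: nn_integral_count_space_indicator)
  also have "\<dots> = (\<integral>\<^sup>+p. f ((\<lambda>(u, k). u @ [k]) p) \<partial>count_space UNIV)"
  proof (rule nn_integral_bij_count_space[symmetric])
    show "bij_betw (\<lambda>(u, k). u @ [k]) UNIV (- {[] :: nat list})"
      unfolding bij_betw_def
    proof
      show "inj (\<lambda>(u, k). u @ [k] :: nat list)" by (auto simp: inj_def)
      show "range (\<lambda>(u, k). u @ [k]) = - {[] :: nat list}"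
      proof (intro set_eqI iffI)
        fix w :: "nat list" assume "w \<in> - {[]}"
        then have "w = (\<lambda>(u, k). u @ [k]) (butlast w, last w)" by simp
        then show "w \<in> range (\<lambda>(u, k). u @ [k])" by blast
      qed auto
    qed
  qed
  also have "\<dots> = (\<integral>\<^sup>+u. (\<integral>\<^sup>+k. f (u @ [k]) \<partial>count_space UNIV) \<partial>count_space UNIV)"
    by (subst nn_integral_fst_count_space[symmetric]) simp
  finally show ?thesis .
qed

section \<open>The renewal measure of the branching process\<close>

context cmj_process
begin

lemma measurable_repro: "\<xi> u \<in> measurable M repro_algebra"
proof -
  have "(\<lambda>\<omega>. (\<xi> u \<omega>, \<zeta> u \<omega>)) \<in> measurable M (repro_algebra \<Otimes>\<^sub>M lifetime_algebra)"
    using repro_indep by (simp add: indep_vars_def)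
  from measurable_compose[OF this measurable_fst] show ?thesis by simp
qed

lemma locally_finite_repro:
  assumes "\<omega> \<in> space M"
  shows "locally_finite_point_measure (\<xi> u \<omega> i j)"
  using measurable_space[OF measurable_repro_component[OF measurable_repro] assms]
  by (simp add: space_point_measure_algebra)

lemma space_repro_past [simp]: "space (repro_past M \<xi> n) = space M"
  by (simp add: repro_past_def)

lemma repro_past_subset:
  assumes "space N = space M" "\<And>v. length v < n \<Longrightarrow> \<xi> v \<in> measurable N repro_algebra"
  shows "sets (repro_past M \<xi> n) \<subseteq> sets N"
proof -
  have "(\<lambda>\<omega>. \<lambda>v\<in>{v. length v < n}. \<xi> v \<omega>) \<in> measurable N (\<Pi>\<^sub>M v\<in>{v. length v < n}. repro_algebra)"
    using assms(2) by (intro measurable_restrict) auto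
  from sets_vimage_algebra_subset[OF this] show ?thesis by (simp add: repro_past_def assms(1))
qed

lemma subalgebra_repro_past: "subalgebra M (repro_past M \<xi> n)"
  unfolding subalgebra_def using repro_past_subset[OF refl measurable_repro] by simp

lemma repro_past_subset_full_past: "sets (repro_past M \<xi> n) \<subseteq> sets (full_past M \<xi> \<zeta> \<phi> n)"
proof (rule repro_past_subset)
  show "space (full_past M \<xi> \<zeta> \<phi> n) = space M" by (simp add: full_past_def)
  fix v :: "nat list" assume v: "length v < n"
  let ?K = "\<Pi>\<^sub>M v\<in>{v :: nat list. length v < n}. repro_algebra \<Otimes>\<^sub>M lifetime_algebra \<Otimes>\<^sub>M (path_algebra :: (real \<Rightarrow> real ^ 'p) measure)"
  have "\<xi> v \<omega> \<in> space repro_algebra" if "\<omega> \<in> space M" for v \<omega>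
    by (rule measurable_space[OF measurable_repro that])
  then have "(\<lambda>\<omega>. \<lambda>v\<in>{v. length v < n}. (\<xi> v \<omega>, \<zeta> v \<omega>, \<phi> v \<omega>)) \<in> space M \<rightarrow> space ?K"
    by (auto simp: space_PiM space_pair_measure lifetime_algebra_def path_algebra_def)
  then have "(\<lambda>\<omega>. \<lambda>v\<in>{v. length v < n}. (\<xi> v \<omega>, \<zeta> v \<omega>, \<phi> v \<omega>)) \<in> measurable (full_past M \<xi> \<zeta> \<phi> n) ?K"
    unfolding full_past_def by (rule measurable_vimage_algebra1)
  from measurable_compose[OF measurable_compose[OF this measurable_component_singleton[of v]] measurable_fst]
  show "\<xi> v \<in> measurable (full_past M \<xi> \<zeta> \<phi> n) repro_algebra" using v by simp
qed

definition type_event :: "'p \<Rightarrow> 'p \<Rightarrow> nat list \<Rightarrow> 'a set" where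
  "type_event i j u = {\<omega> \<in> space M. u \<in> \<T> i \<omega> \<and> \<tau> i u \<omega> = j}"

lemma type_event_repro_past: "type_event i j u \<in> sets (repro_past M \<xi> (length u))"
proof -
  have "type_event i j u = {\<omega> \<in> space M. u \<in> \<T> i \<omega>} \<inter> (\<tau> i u -` {j} \<inter> space (repro_past M \<xi> (length u)))"
    by (auto simp: type_event_def)
  then show ?thesis using adapted(1) measurable_sets[OF adapted(3), of "{j}"] by auto
qed

lemma sets_type_event [measurable]: "type_event i j u \<in> sets M"
  using subsetD[OF conjunct2[OF subalgebra_repro_past[unfolded subalgebra_def]] type_event_repro_past] .

lemma measurable_birth_time [measurable]: "S i u \<in> borel_measurable M"
  using measurable_from_subalg[OF subalgebra_repro_past adapted(2)] .

text \<open>Children born before their parent are counted by the mass of the negative half-line,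
  which a reproduction point measure does not charge.\<close>

lemma birth_time_nonneg:
  assumes "\<omega> \<in> space M"
  shows "u \<in> \<T> i \<omega> \<Longrightarrow> 0 \<le> S i u \<omega>"
proof (induction u rule: rev_induct)
  case Nil
  then show ?case using ancestor(2)[OF assms] by simp
next
  case (snoc k u)
  have u: "u \<in> \<T> i \<omega>" by (rule parent[OF assms snoc.prems])
  define K where "K = {k'. u @ [k'] \<in> \<T> i \<omega> \<and> \<tau> i (u @ [k']) \<omega> = \<tau> i (u @ [k]) \<omega> \<and> S i (u @ [k']) \<omega> - S i u \<omega> \<in> {..<0}}"
  have "emeasure (count_space UNIV) K = 0"
    unfolding K_def using reproduction[OF assms u, of "{..<0}" "\<tau> i (u @ [k]) \<omega>"] locally_finite_repro[OF assms]
    by (simp add: locally_finite_point_measure_def)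
  then have "K = {}" by (simp add: emeasure_count_space split: if_splits)
  then have "k \<notin> K" by simp
  then have "\<not> S i (u @ [k]) \<omega> < S i u \<omega>" using snoc.prems by (simp add: K_def)
  then show ?case using snoc.IH[OF u] by simp
qed

text \<open>Read for all Borel sets, \<open>reproduction\<close> says that the reproduction measure
  is the image of counting measure on the children under their delay of birth; this passes to
  integrals.\<close>

lemma nn_integral_children:
  assumes \<omega>: "\<omega> \<in> space M" and u: "u \<in> \<T> i \<omega>" and g[measurable]: "g \<in> borel_measurable borel"
  shows "(\<integral>\<^sup>+k. indicator (type_event i j (u @ [k])) \<omega> * g (S i (u @ [k]) \<omega> - S i u \<omega>) \<partial>count_space UNIV)
    = (\<integral>\<^sup>+x. g x \<partial>\<xi> u \<omega> (\<tau> i u \<omega>) j)"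
proof -
  define K where "K = {k. u @ [k] \<in> \<T> i \<omega> \<and> \<tau> i (u @ [k]) \<omega> = j}"
  define h where "h k = S i (u @ [k]) \<omega> - S i u \<omega>" for k
  define N where "N = distr (density (count_space UNIV) (indicator K)) borel h"
  have sets\<xi>: "sets (\<xi> u \<omega> (\<tau> i u \<omega>) j) = sets borel"
    using locally_finite_repro[OF \<omega>] by (simp add: locally_finite_point_measure_def)
  have hm: "h \<in> measurable (density (count_space UNIV) (indicator K)) borel" by simp
  have "N = \<xi> u \<omega> (\<tau> i u \<omega>) j"
  proof (rule measure_eqI)
    show "sets N = sets (\<xi> u \<omega> (\<tau> i u \<omega>) j)" by (simp add: N_def sets\<xi>)
    fix A assume "A \<in> sets N"
    then have A: "A \<in> sets borel" by (simp add: N_def)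
    have "emeasure N A = emeasure (density (count_space UNIV) (indicator K)) (h -` A)"
      unfolding N_def by (subst emeasure_distr[OF hm A]) simp
    also have "\<dots> = (\<integral>\<^sup>+k. indicator K k * indicator (h -` A) k \<partial>count_space UNIV)"
      by (rule emeasure_density) auto
    also have "\<dots> = (\<integral>\<^sup>+k. indicator (K \<inter> h -` A) k \<partial>count_space UNIV)"
      by (intro nn_integral_cong) (simp add: indicator_def)
    also have "\<dots> = emeasure (count_space UNIV) (K \<inter> h -` A)" by (rule nn_integral_indicator) simp
    also have "K \<inter> h -` A = {k. u @ [k] \<in> \<T> i \<omega> \<and> \<tau> i (u @ [k]) \<omega> = j \<and> S i (u @ [k]) \<omega> - S i u \<omega> \<in> A}"
      by (auto simp: K_def h_def)
    also have "emeasure (count_space UNIV) \<dots> = emeasure (\<xi> u \<omega> (\<tau> i u \<omega>) j) A"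
      by (rule reproduction[OF \<omega> u A])
    finally show "emeasure N A = emeasure (\<xi> u \<omega> (\<tau> i u \<omega>) j) A" .
  qed
  then have "(\<integral>\<^sup>+x. g x \<partial>\<xi> u \<omega> (\<tau> i u \<omega>) j) = (\<integral>\<^sup>+x. g x \<partial>N)" by simp
  also have "\<dots> = (\<integral>\<^sup>+k. g (h k) \<partial>density (count_space UNIV) (indicator K))"
    unfolding N_def by (rule nn_integral_distr[OF hm]) simp
  also have "\<dots> = (\<integral>\<^sup>+k. indicator K k * g (h k) \<partial>count_space UNIV)"
    by (rule nn_integral_density) auto
  also have "\<dots> = (\<integral>\<^sup>+k. indicator (type_event i j (u @ [k])) \<omega> * g (S i (u @ [k]) \<omega> - S i u \<omega>) \<partial>count_space UNIV)"
    by (intro nn_integral_cong) (simp add: K_def h_def type_event_def indicator_def \<omega>)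
  finally show ?thesis by simp
qed

text \<open>Independence is assumed for the pairs with lifetimes. Grouping the indices into u and
  all shorter words, and then dropping the lifetimes, yields it here; the witness is the
  sigma-algebra generated by \<open>\<xi> u\<close>.\<close>

lemma repro_independent_of_past:
  "\<exists>A. subalgebra M A \<and> \<xi> u \<in> measurable A repro_algebra \<and> indep_set (sets A) (sets (repro_past M \<xi> (length u)))"
proof (intro exI conjI)
  let ?R = "repro_algebra \<Otimes>\<^sub>M lifetime_algebra :: (('p \<Rightarrow> 'p \<Rightarrow> real measure) \<times> ('p \<Rightarrow> ennreal)) measure"
  let ?B = "{v :: nat list. length v < length u}"
  let ?X = "\<lambda>\<omega>. restrict (\<lambda>v. (\<xi> v \<omega>, \<zeta> v \<omega>)) {u}" and ?Y = "\<lambda>\<omega>. restrict (\<lambda>v. (\<xi> v \<omega>, \<zeta> v \<omega>)) ?B"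
  let ?f = "\<lambda>I x. \<lambda>v\<in>I. fst (x v)"
  let ?W = "\<lambda>I \<omega>. \<lambda>v\<in>I. \<xi> v \<omega>"
  have ind: "indep_var (PiM {u} (\<lambda>_. ?R)) ?X (PiM ?B (\<lambda>_. ?R)) ?Y"
    by (rule indep_var_restrict[OF repro_indep]) auto
  have fm: "?f I \<in> measurable (PiM I (\<lambda>_. ?R)) (PiM I (\<lambda>_. repro_algebra))" for I :: "nat list set"
  proof (rule measurable_restrict)
    fix v assume "v \<in> I"
    then have "(\<lambda>x. x v) \<in> measurable (PiM I (\<lambda>_. ?R)) ?R" by (rule measurable_component_singleton)
    from measurable_compose[OF this measurable_fst]
    show "(\<lambda>x. fst (x v)) \<in> measurable (PiM I (\<lambda>_. ?R)) repro_algebra" .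
  qed
  have "indep_var (PiM {u} (\<lambda>_. repro_algebra)) (?f {u} \<circ> ?X) (PiM ?B (\<lambda>_. repro_algebra)) (?f ?B \<circ> ?Y)"
    by (rule indep_var_compose[OF ind fm fm])
  moreover have "?f {u} \<circ> ?X = ?W {u}" "?f ?B \<circ> ?Y = ?W ?B" by (auto simp: fun_eq_iff restrict_def)
  ultimately have iv: "indep_var (PiM {u} (\<lambda>_. repro_algebra)) (?W {u}) (PiM ?B (\<lambda>_. repro_algebra)) (?W ?B)"
    by simp
  have Wm: "?W I \<in> measurable M (PiM I (\<lambda>_. repro_algebra))" for I
    by (intro measurable_restrict measurable_repro)
  define A where "A = vimage_algebra (space M) (?W {u}) (PiM {u} (\<lambda>_. repro_algebra))"
  have s: "sets (vimage_algebra (space M) f K) = sigma_sets (space M) {f -` A \<inter> space M |A. A \<in> sets K}"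
    if "f \<in> measurable M K" for f and K :: "'x measure"
  proof -
    have "f \<in> space M \<rightarrow> space K" using that by (auto dest: measurable_space)
    then have "sets (vimage_algebra (space M) f K) = {f -` A \<inter> space M |A. A \<in> sets K}" by (rule sets_vimage_algebra2)
    then show ?thesis using sets.sigma_sets_eq[of "vimage_algebra (space M) f K"] by simp
  qed
  show "indep_set (sets A) (sets (repro_past M \<xi> (length u)))"
    using iv unfolding indep_var_eq A_def repro_past_def by (simp only: s[OF Wm])
  show "subalgebra M A"
    unfolding A_def subalgebra_def using sets_vimage_algebra_subset[OF Wm] by simp
  have "?W {u} \<in> measurable A (PiM {u} (\<lambda>_. repro_algebra))"
    unfolding A_def by (rule measurable_vimage_algebra1) (use measurable_space[OF Wm[of "{u}"]] in auto)
  from measurable_compose[OF this measurable_component_singleton[of u]]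
  show "\<xi> u \<in> measurable A repro_algebra" by simp
qed

lemma repro_distr: "distr M repro_algebra (\<xi> u) = distr M repro_algebra (\<xi> [])"
proof -
  have 1: "(\<lambda>\<omega>. (\<xi> u \<omega>, \<zeta> u \<omega>)) \<in> measurable M (repro_algebra \<Otimes>\<^sub>M lifetime_algebra)" for u
    using repro_indep by (simp add: indep_vars_def)
  have "distr M repro_algebra (\<xi> u) = distr (distr M (repro_algebra \<Otimes>\<^sub>M lifetime_algebra) (\<lambda>\<omega>. (\<xi> u \<omega>, \<zeta> u \<omega>))) repro_algebra fst" for u
    by (subst distr_distr[OF _ 1]) (simp_all add: o_def)
  from this[of u] this[of "[]"] show ?thesis by (simp only: repro_ident[of u])
qed

lemma nn_integral_repro:
  assumes "g \<in> borel_measurable borel"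
  shows "(\<integral>\<^sup>+\<omega>. (\<integral>\<^sup>+x. g x \<partial>\<xi> u \<omega> l j) \<partial>M) = (\<integral>\<^sup>+x. g x \<partial>intensity M (\<xi> []) l j)"
proof -
  have id: "(\<lambda>x. x) \<in> measurable repro_algebra repro_algebra" by simp
  have m: "(\<lambda>y. \<integral>\<^sup>+x. g x \<partial>y l j) \<in> borel_measurable repro_algebra"
    using measurable_compose[OF measurable_repro_component[OF id] nn_integral_measurable_point_measure_algebra[OF assms]] .
  have "(\<integral>\<^sup>+\<omega>. (\<integral>\<^sup>+x. g x \<partial>\<xi> v \<omega> l j) \<partial>M) = (\<integral>\<^sup>+y. (\<integral>\<^sup>+x. g x \<partial>y l j) \<partial>distr M repro_algebra (\<xi> v))" for v
    by (rule nn_integral_distr[symmetric]) (simp_all add: measurable_repro m)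
  from this[of u] this[of "[]"] show ?thesis
    by (simp only: repro_distr[of u] nn_integral_intensity[OF measurable_repro assms])
qed

text \<open>\<open>renewal_measure i j A\<close> is the expected number of individuals of type \<open>j\<close> born during \<open>A\<close>
  when the ancestor has type \<open>i\<close>.\<close>

definition renewal_measure :: "'p \<Rightarrow> 'p \<Rightarrow> real measure" where
  "renewal_measure i j = distr (density (count_space UNIV \<Otimes>\<^sub>M M) (\<lambda>(u, \<omega>). indicator (type_event i j u) \<omega>))
     borel (\<lambda>(u, \<omega>). S i u \<omega>)"

lemma sets_renewal_measure [simp]: "sets (renewal_measure i j) = sets borel"
  by (simp add: renewal_measure_def)

lemma measurable_type_event_pair:
  "(\<lambda>(u, \<omega>). indicator (type_event i j u) \<omega> :: ennreal) \<in> borel_measurable (count_space UNIV \<Otimes>\<^sub>M M)"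
  "(\<lambda>(u, \<omega>). indicator (type_event i j u) \<omega> :: real) \<in> borel_measurable (count_space UNIV \<Otimes>\<^sub>M M)"
  by (rule measurable_pair_measure_countable1; simp)+

lemma measurable_birth_time_pair:
  "(\<lambda>(u, \<omega>). S i u \<omega>) \<in> borel_measurable (count_space UNIV \<Otimes>\<^sub>M M)"
  by (rule measurable_pair_measure_countable1) auto

lemma nn_integral_renewal_measure:
  assumes [measurable]: "g \<in> borel_measurable borel"
  shows "(\<integral>\<^sup>+x. g x \<partial>renewal_measure i j)
    = (\<integral>\<^sup>+u. (\<integral>\<^sup>+\<omega>. indicator (type_event i j u) \<omega> * g (S i u \<omega>) \<partial>M) \<partial>count_space UNIV)"
proof -
  note [measurable] = measurable_type_event_pair(1)[of i j] measurable_birth_time_pair[of i]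
  have gm: "(\<lambda>(u, \<omega>). g (S i u \<omega>)) \<in> borel_measurable (count_space UNIV \<Otimes>\<^sub>M M)"
    using measurable_compose[OF measurable_birth_time_pair assms] by (simp add: case_prod_beta')
  note [measurable] = gm
  have "(\<integral>\<^sup>+x. g x \<partial>renewal_measure i j) = (\<integral>\<^sup>+p. g ((\<lambda>(u, \<omega>). S i u \<omega>) p) \<partial>density (count_space UNIV \<Otimes>\<^sub>M M) (\<lambda>(u, \<omega>). indicator (type_event i j u) \<omega>))"
    unfolding renewal_measure_def by (rule nn_integral_distr) (simp_all add: measurable_birth_time_pair)
  also have "\<dots> = (\<integral>\<^sup>+p. (\<lambda>(u, \<omega>). indicator (type_event i j u) \<omega>) p * g ((\<lambda>(u, \<omega>). S i u \<omega>) p) \<partial>(count_space UNIV \<Otimes>\<^sub>M M))"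
    by (rule nn_integral_density[OF measurable_type_event_pair(1)]) (use gm in \<open>simp add: case_prod_beta'\<close>)
  also have "\<dots> = (\<integral>\<^sup>+p. (\<lambda>(u, \<omega>). indicator (type_event i j u) \<omega> * g (S i u \<omega>)) p \<partial>(count_space UNIV \<Otimes>\<^sub>M M))"
    by (intro nn_integral_cong) (simp add: case_prod_beta')
  also have "\<dots> = (\<integral>\<^sup>+u. (\<integral>\<^sup>+\<omega>. indicator (type_event i j u) \<omega> * g (S i u \<omega>) \<partial>M) \<partial>count_space UNIV)"
    by (subst nn_integral_fst[symmetric])
       (use borel_measurable_times_ennreal[OF measurable_type_event_pair(1) gm] in \<open>simp_all add: case_prod_beta'\<close>)
  finally show ?thesis .
qed

lemma renewal_measure_nonneg: "AE x in renewal_measure i j. 0 \<le> x"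
proof -
  have "emeasure (renewal_measure i j) {..<0} = (\<integral>\<^sup>+x. indicator {..<0} x \<partial>renewal_measure i j)"
    by (rule nn_integral_indicator[symmetric]) simp
  also have "\<dots> = (\<integral>\<^sup>+u. (\<integral>\<^sup>+\<omega>. indicator (type_event i j u) \<omega> * indicator {..<0} (S i u \<omega>) \<partial>M) \<partial>count_space UNIV)"
    by (rule nn_integral_renewal_measure) simp
  also have "\<dots> = (\<integral>\<^sup>+u. (\<integral>\<^sup>+\<omega>. 0 \<partial>M) \<partial>count_space (UNIV :: nat list set))"
  proof (intro nn_integral_cong)
    fix u \<omega> assume "\<omega> \<in> space M"
    then have "u \<in> \<T> i \<omega> \<Longrightarrow> 0 \<le> S i u \<omega>" by (rule birth_time_nonneg)
    then show "indicator (type_event i j u) \<omega> * indicator {..<0} (S i u \<omega>) = (0 :: ennreal)"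
      by (auto simp: indicator_def type_event_def)
  qed
  finally have "{..<0} \<in> null_sets (renewal_measure i j)" by (simp add: null_setsI)
  from AE_not_in[OF this] show ?thesis by eventually_elim simp
qed

definition exp_moment :: "real \<Rightarrow> 'p \<Rightarrow> 'p \<Rightarrow> nat list \<Rightarrow> ennreal" where
  "exp_moment \<sigma> i j u = (\<integral>\<^sup>+\<omega>. indicator (type_event i j u) \<omega> * ennreal (exp (- \<sigma> * S i u \<omega>)) \<partial>M)"

lemma exp_moment_Nil: "exp_moment \<sigma> i j [] = (if i = j then 1 else 0)"
proof -
  have "exp_moment \<sigma> i j [] = (\<integral>\<^sup>+\<omega>. (if i = j then 1 else 0) \<partial>M)"
    unfolding exp_moment_def
    by (intro nn_integral_cong) (simp add: type_event_def indicator_def ancestor)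
  then show ?thesis by (simp add: emeasure_space_1)
qed

text \<open>The branching property: a parent of type l has children of type j according to the
  intensity of l. Type and birth time of the parent are determined by the past, so independence
  factors the mean, and exp(-\<sigma> S) is multiplicative along a line of descent.\<close>

lemma exp_moment_children:
  "(\<integral>\<^sup>+k. exp_moment \<sigma> i j (u @ [k]) \<partial>count_space UNIV)
    = (\<Sum>l\<in>UNIV. exp_moment \<sigma> i l u * (\<integral>\<^sup>+x. ennreal (exp (- \<sigma> * x)) \<partial>intensity M (\<xi> []) l j))"
proof -
  let ?e = "\<lambda>x. ennreal (exp (- \<sigma> * x))"
  have em: "?e \<in> borel_measurable borel" by measurable
  define X where "X l \<omega> = (\<integral>\<^sup>+x. ?e x \<partial>\<xi> u \<omega> l j)" for l \<omega>
  define Y where "Y l \<omega> = indicator (type_event i l u) \<omega> * ?e (S i u \<omega>)" for l \<omega>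
  have Xm[measurable]: "X l \<in> borel_measurable M" for l
    unfolding X_def[abs_def]
    using measurable_compose[OF measurable_repro_component[OF measurable_repro] nn_integral_measurable_point_measure_algebra[OF em]] .
  have Ym[measurable]: "Y l \<in> borel_measurable M" for l unfolding Y_def[abs_def] by measurable
  have "(\<integral>\<^sup>+k. exp_moment \<sigma> i j (u @ [k]) \<partial>count_space UNIV)
    = (\<integral>\<^sup>+\<omega>. (\<integral>\<^sup>+k. indicator (type_event i j (u @ [k])) \<omega> * ?e (S i (u @ [k]) \<omega>) \<partial>count_space UNIV) \<partial>M)"
    unfolding exp_moment_def
    by (subst nn_integral_count_space_nat, subst nn_integral_suminf[symmetric])
       (auto simp: nn_integral_count_space_nat)
  also have "\<dots> = (\<integral>\<^sup>+\<omega>. (\<Sum>l\<in>UNIV. X l \<omega> * Y l \<omega>) \<partial>M)"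
  proof (rule nn_integral_cong)
    fix \<omega> assume \<omega>: "\<omega> \<in> space M"
    show "(\<integral>\<^sup>+k. indicator (type_event i j (u @ [k])) \<omega> * ?e (S i (u @ [k]) \<omega>) \<partial>count_space UNIV) = (\<Sum>l\<in>UNIV. X l \<omega> * Y l \<omega>)"
    proof (cases "u \<in> \<T> i \<omega>")
      case True
      have "(\<Sum>l\<in>UNIV. X l \<omega> * Y l \<omega>) = (\<Sum>l\<in>UNIV. if l = \<tau> i u \<omega> then X l \<omega> * ?e (S i u \<omega>) else 0)"
        by (intro sum.cong refl) (auto simp: Y_def indicator_def type_event_def \<omega> True)
      also have "\<dots> = X (\<tau> i u \<omega>) \<omega> * ?e (S i u \<omega>)" by simp
      also have "\<dots> = ?e (S i u \<omega>) * (\<integral>\<^sup>+k. indicator (type_event i j (u @ [k])) \<omega> * ?e (S i (u @ [k]) \<omega> - S i u \<omega>) \<partial>count_space UNIV)"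
        unfolding X_def nn_integral_children[OF \<omega> True em] by (rule mult.commute)
      also have "\<dots> = (\<integral>\<^sup>+k. ?e (S i u \<omega>) * (indicator (type_event i j (u @ [k])) \<omega> * ?e (S i (u @ [k]) \<omega> - S i u \<omega>)) \<partial>count_space UNIV)"
        by (rule nn_integral_cmult[symmetric]) simp
      also have "\<dots> = (\<integral>\<^sup>+k. indicator (type_event i j (u @ [k])) \<omega> * ?e (S i (u @ [k]) \<omega>) \<partial>count_space UNIV)"
      proof (rule nn_integral_cong)
        fix k
        have "?e (S i u \<omega>) * ?e (S i (u @ [k]) \<omega> - S i u \<omega>) = ?e (S i (u @ [k]) \<omega>)"
          by (simp add: ennreal_mult[symmetric] exp_add[symmetric] algebra_simps)
        then show "?e (S i u \<omega>) * (indicator (type_event i j (u @ [k])) \<omega> * ?e (S i (u @ [k]) \<omega> - S i u \<omega>))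
          = indicator (type_event i j (u @ [k])) \<omega> * ?e (S i (u @ [k]) \<omega>)"
          by (simp only: mult.left_commute[of "?e (S i u \<omega>)"])
      qed
      finally show ?thesis by simp
    next
      case False
      then have "u @ [k] \<notin> \<T> i \<omega>" for k using parent[OF \<omega>] by blast
      then show ?thesis using False by (simp add: type_event_def Y_def)
    qed
  qed
  also have "\<dots> = (\<Sum>l\<in>UNIV. \<integral>\<^sup>+\<omega>. X l \<omega> * Y l \<omega> \<partial>M)" by (rule nn_integral_sum) measurable
  also have "\<dots> = (\<Sum>l\<in>UNIV. exp_moment \<sigma> i l u * (\<integral>\<^sup>+x. ?e x \<partial>intensity M (\<xi> []) l j))"
  proof (rule sum.cong[OF refl])
    fix l
    obtain A where A: "subalgebra M A" "\<xi> u \<in> measurable A repro_algebra"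
      "indep_set (sets A) (sets (repro_past M \<xi> (length u)))" using repro_independent_of_past by blast
    have XA: "X l \<in> borel_measurable A"
      unfolding X_def[abs_def]
      using measurable_compose[OF measurable_repro_component[OF A(2)] nn_integral_measurable_point_measure_algebra[OF em]] .
    have YP: "Y l \<in> borel_measurable (repro_past M \<xi> (length u))"
      unfolding Y_def[abs_def]
      by (intro borel_measurable_times_ennreal borel_measurable_indicator type_event_repro_past measurable_compose[OF adapted(2) em])
    have "(\<integral>\<^sup>+\<omega>. X l \<omega> * Y l \<omega> \<partial>M) = (\<integral>\<^sup>+\<omega>. X l \<omega> \<partial>M) * (\<integral>\<^sup>+\<omega>. Y l \<omega> \<partial>M)"
      by (rule indep_subalgebras_nn_integral_mult[OF A(1) subalgebra_repro_past A(3) XA YP])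
    then show "(\<integral>\<^sup>+\<omega>. X l \<omega> * Y l \<omega> \<partial>M) = exp_moment \<sigma> i l u * (\<integral>\<^sup>+x. ?e x \<partial>intensity M (\<xi> []) l j)"
      unfolding X_def nn_integral_repro[OF em] Y_def exp_moment_def by (simp add: mult.commute)
  qed
  finally show ?thesis .
qed

text \<open>Individuals are sorted by their parent, that is, by the last step of the line of
  descent. The intensity thus appears as a right factor, U = I + U \<mu> at the level of transforms,
  with infinite values allowed.\<close>

lemma renewal_equation:
  "(\<integral>\<^sup>+x. ennreal (exp (- \<sigma> * x)) \<partial>renewal_measure i j) = (if i = j then 1 else 0)
    + (\<Sum>l\<in>UNIV. (\<integral>\<^sup>+x. ennreal (exp (- \<sigma> * x)) \<partial>renewal_measure i l) * (\<integral>\<^sup>+x. ennreal (exp (- \<sigma> * x)) \<partial>intensity M (\<xi> []) l j))"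
proof -
  have r: "(\<integral>\<^sup>+x. ennreal (exp (- \<sigma> * x)) \<partial>renewal_measure i l) = (\<integral>\<^sup>+u. exp_moment \<sigma> i l u \<partial>count_space UNIV)" for l
    unfolding exp_moment_def by (rule nn_integral_renewal_measure) measurable
  show ?thesis
    unfolding r
    by (subst nn_integral_count_space_snoc)
       (simp add: exp_moment_Nil exp_moment_children nn_integral_sum nn_integral_multc)
qed

text \<open>The vector \<open>v\<close> is a supersolution, so that the weighted \<open>n\<close>-th generation decays like \<open>r\<^sup>n\<close>.\<close>

lemma renewal_measure_finite_moment:
  fixes v :: "'p \<Rightarrow> real"
  assumes v: "\<And>l. v l \<ge> 1" and r: "0 \<le> r" "r < 1"
    and super: "\<And>l. (\<Sum>j\<in>UNIV. (\<integral>\<^sup>+x. ennreal (exp (- \<sigma> * x)) \<partial>intensity M (\<xi> []) l j) * ennreal (v j)) \<le> ennreal (r * v l)"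
  shows "(\<integral>\<^sup>+x. ennreal (exp (- \<sigma> * x)) \<partial>renewal_measure i j) < \<infinity>"
proof -
  let ?A = "\<lambda>l j. \<integral>\<^sup>+x. ennreal (exp (- \<sigma> * x)) \<partial>intensity M (\<xi> []) l j"
  define w where "w u = (\<Sum>j\<in>UNIV. exp_moment \<sigma> i j u * ennreal (v j))" for u
  \<comment> \<open>Only generations before n: these partial sums obey
    \<open>b (Suc n) \<le> v i + r * b n\<close>, and the fixed point v i / (1 - r) bounds them
    before the full sum is known to be finite.\<close>
  define b where "b n = (\<integral>\<^sup>+u. indicator {u. length u < n} u * w u \<partial>count_space UNIV)" for n :: nat
  have w_children: "(\<integral>\<^sup>+k. w (u @ [k]) \<partial>count_space UNIV) \<le> ennreal r * w u" for u
  proof -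
    have "(\<integral>\<^sup>+k. w (u @ [k]) \<partial>count_space UNIV) = (\<Sum>j\<in>UNIV. (\<Sum>l\<in>UNIV. exp_moment \<sigma> i l u * ?A l j) * ennreal (v j))"
      unfolding w_def by (simp add: nn_integral_sum nn_integral_multc exp_moment_children)
    also have "\<dots> = (\<Sum>l\<in>UNIV. exp_moment \<sigma> i l u * (\<Sum>j\<in>UNIV. ?A l j * ennreal (v j)))"
      unfolding sum_distrib_left sum_distrib_right by (subst sum.swap) (simp add: mult.assoc)
    also have "\<dots> \<le> (\<Sum>l\<in>UNIV. exp_moment \<sigma> i l u * ennreal (r * v l))"
      by (intro sum_mono mult_left_mono super) simp
    also have "\<dots> = ennreal r * w u"
      using r v by (simp add: w_def sum_distrib_left ennreal_mult' mult.left_commute order_trans[OF zero_le_one])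
    finally show ?thesis .
  qed
  have b_bound: "b n \<le> ennreal (v i / (1 - r))" for n
  proof (induction n)
    case 0
    show ?case by (simp add: b_def)
  next
    case (Suc n)
    have vi: "v i \<ge> 0" using v[of i] by simp
    have "b (Suc n) = w [] + (\<integral>\<^sup>+u. (\<integral>\<^sup>+k. indicator {u. length u < n} u * w (u @ [k]) \<partial>count_space UNIV) \<partial>count_space UNIV)"
      unfolding b_def by (subst nn_integral_count_space_snoc) (simp add: indicator_def)
    also have "w [] = ennreal (v i)"
      unfolding w_def by (subst sum.remove[of _ i]) (auto simp: exp_moment_Nil)
    also have "(\<integral>\<^sup>+u. (\<integral>\<^sup>+k. indicator {u. length u < n} u * w (u @ [k]) \<partial>count_space UNIV) \<partial>count_space UNIV)
       \<le> (\<integral>\<^sup>+u. ennreal r * (indicator {u. length u < n} u * w u) \<partial>count_space UNIV)"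
      by (intro nn_integral_mono) (use w_children in \<open>auto simp: indicator_def\<close>)
    also have "\<dots> = ennreal r * b n" unfolding b_def by (rule nn_integral_cmult) simp
    also have "ennreal r * b n \<le> ennreal r * ennreal (v i / (1 - r))" by (rule mult_left_mono[OF Suc.IH]) simp
    also have "ennreal (v i) + ennreal r * ennreal (v i / (1 - r)) = ennreal (v i + r * (v i / (1 - r)))"
      using r vi by (simp add: ennreal_mult[symmetric] ennreal_plus[symmetric] del: ennreal_plus)
    also have "v i + r * (v i / (1 - r)) = v i / (1 - r)" using r by (simp add: field_simps)
    finally show ?case by (simp add: add_left_mono)
  qed
  have "(\<integral>\<^sup>+u. w u \<partial>count_space UNIV) = (\<integral>\<^sup>+u. (SUP n. indicator {u. length u < n} u * w u) \<partial>count_space UNIV)"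
  proof (rule nn_integral_cong)
    fix u
    show "w u = (SUP n. indicator {u. length u < n} u * w u)"
    proof (rule antisym)
      have "w u = indicator {v. length v < Suc (length u)} u * w u" by simp
      also have "\<dots> \<le> (SUP n. indicator {u. length u < n} u * w u)" by (rule SUP_upper) simp
      finally show "w u \<le> (SUP n. indicator {u. length u < n} u * w u)" .
    qed (auto intro!: SUP_least simp: indicator_def)
  qed
  also have "\<dots> = (SUP n. b n)"
    unfolding b_def
    by (rule nn_integral_monotone_convergence_SUP) (auto simp: incseq_def le_fun_def indicator_def)
  also have "\<dots> \<le> ennreal (v i / (1 - r))" by (intro SUP_least b_bound)
  also have "\<dots> < \<infinity>" by simp
  finally have fin: "(\<integral>\<^sup>+u. w u \<partial>count_space UNIV) < \<infinity>" .
  have "(\<integral>\<^sup>+x. ennreal (exp (- \<sigma> * x)) \<partial>renewal_measure i j) = (\<integral>\<^sup>+u. exp_moment \<sigma> i j u \<partial>count_space UNIV)"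
    unfolding exp_moment_def by (rule nn_integral_renewal_measure) measurable
  also have "\<dots> \<le> (\<integral>\<^sup>+u. w u \<partial>count_space UNIV)"
  proof (rule nn_integral_mono)
    fix u
    have "exp_moment \<sigma> i j u * ennreal 1 \<le> exp_moment \<sigma> i j u * ennreal (v j)"
      by (intro mult_left_mono ennreal_leI v) simp
    also have "\<dots> \<le> w u" unfolding w_def by (rule member_le_sum) auto
    finally show "exp_moment \<sigma> i j u \<le> w u" by simp
  qed
  finally show ?thesis using fin by (rule order_le_less_trans)
qed

section \<open>Means of the contributions and of the process\<close>

lemma measurable_characteristic: "\<phi> u \<in> measurable M path_algebra"
proof -
  obtain \<G> where G: "subalgebra M (\<G> u)" "case_prod (\<phi> u) \<in> borel_measurable (\<G> u \<Otimes>\<^sub>M (borel :: real measure))"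
    using characteristic by blast
  have "(\<lambda>\<omega>. \<phi> u \<omega> s) \<in> borel_measurable M" for s
    using measurable_from_subalg[OF G(1) measurable_compose[OF measurable_Pair2'[of s borel] G(2)]] by simp
  then show ?thesis unfolding path_algebra_def by (intro measurable_PiM_single') auto
qed

lemma expectation_characteristic:
  "(LINT \<omega>|M. \<phi> u \<omega> s $ j) = (LINT \<omega>|M. \<phi> [] \<omega> s $ j)"
proof -
  have "(\<lambda>y. y s) \<in> measurable path_algebra (borel :: (real ^ 'p) measure)"
    unfolding path_algebra_def by (rule measurable_component_singleton) simp
  moreover have "(\<lambda>x. x $ j) \<in> borel_measurable (borel :: (real ^ 'p) measure)"
    by (intro borel_measurable_continuous_onI continuous_intros)
  ultimately have m: "(\<lambda>y. y s $ j) \<in> borel_measurable path_algebra" by (rule measurable_compose)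
  have "(LINT \<omega>|M. \<phi> v \<omega> s $ j) = (LINT y|distr M path_algebra (\<phi> v). y s $ j)" for v
    by (rule integral_distr[OF measurable_characteristic m, symmetric])
  from this[of u] this[of "[]"] show ?thesis by (simp only: phi_ident[of u])
qed

text \<open>The type event and \<open>S i u\<close> depend on the reproduction of earlier
  generations only, and the random function is independent of it, so it may be averaged at a frozen
  time. The sum over j resolves the random component \<open>\<tau> i u\<close>.\<close>

lemma expectation_contribution:
  assumes int: "integrable M (contribution \<phi> \<T> S \<tau> i t u)"
  shows "(LINT \<omega>|M. contribution \<phi> \<T> S \<tau> i t u \<omega>)
    = (\<Sum>j\<in>UNIV. LINT \<omega>|M. indicator (type_event i j u) \<omega> * (LINT a|M. \<phi> [] a (t - S i u \<omega>) $ j))"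
proof -
  let ?P = "repro_past M \<xi> (length u)" and ?X = "contribution \<phi> \<T> S \<tau> i t u"
  obtain \<G> where G: "\<And>v. subalgebra M (\<G> v)" "\<And>v. case_prod (\<phi> v) \<in> borel_measurable (\<G> v \<Otimes>\<^sub>M (borel :: real measure))"
    and ind: "\<And>n. indep_sets (\<lambda>w. case w of None \<Rightarrow> sets (full_past M \<xi> \<zeta> \<phi> n) | Some u \<Rightarrow> sets (\<G> u))
                (insert None (Some ` {u. length u = n}))"
    using characteristic by blast
  \<comment> \<open>Two members of the independent family of generation \<open>length u\<close>
    suffice: \<open>u\<close> itself and the full past, which contains the reproduction
    past.\<close>
  have indep: "indep_set (sets (\<G> u)) (sets ?P)"
    unfolding indep_sets2_eq
  proof (intro conjI ballI)
    show "sets (\<G> u) \<subseteq> events" "sets ?P \<subseteq> events"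
      using G(1) subalgebra_repro_past by (auto simp: subalgebra_def)
    fix a b assume a: "a \<in> sets (\<G> u)" and b: "b \<in> sets ?P"
    let ?A = "\<lambda>w. case w of None \<Rightarrow> b | Some (_ :: nat list) \<Rightarrow> a"
    have "prob (\<Inter>w\<in>{None, Some u}. ?A w) = (\<Prod>w\<in>{None, Some u}. prob (?A w))"
      by (rule indep_setsD[OF ind[of "length u"]]) (use a b repro_past_subset_full_past in auto)
    then show "prob (a \<inter> b) = prob a * prob b" by (simp add: Int_commute mult.commute)
  qed
  define H where "H j a \<omega> = indicator (type_event i j u) \<omega> * (\<phi> u a (t - S i u \<omega>) $ j)" for j a \<omega>
  have Hm: "case_prod (H j) \<in> borel_measurable (\<G> u \<Otimes>\<^sub>M ?P)" for j
  proof -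
    have "(\<lambda>p. S i u (snd p)) \<in> borel_measurable (\<G> u \<Otimes>\<^sub>M ?P)"
      by (rule measurable_compose[OF measurable_snd adapted(2)])
    then have "(\<lambda>p. (fst p, t - S i u (snd p))) \<in> measurable (\<G> u \<Otimes>\<^sub>M ?P) (\<G> u \<Otimes>\<^sub>M borel)"
      by (intro measurable_Pair measurable_fst borel_measurable_diff measurable_const) simp_all
    from measurable_compose[OF this G(2)]
    have "(\<lambda>p. \<phi> u (fst p) (t - S i u (snd p))) \<in> borel_measurable (\<G> u \<Otimes>\<^sub>M ?P)" by simp
    moreover have "(\<lambda>x. x $ j) \<in> borel_measurable (borel :: (real ^ 'p) measure)"
      by (intro borel_measurable_continuous_onI continuous_intros)
    ultimately have "(\<lambda>p. \<phi> u (fst p) (t - S i u (snd p)) $ j) \<in> borel_measurable (\<G> u \<Otimes>\<^sub>M ?P)"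
      by (rule measurable_compose)
    moreover have "(\<lambda>p. indicator (type_event i j u) (snd p) :: real) \<in> borel_measurable (\<G> u \<Otimes>\<^sub>M ?P)"
      by (rule measurable_compose[OF measurable_snd]) (intro borel_measurable_indicator type_event_repro_past)
    ultimately show ?thesis unfolding H_def case_prod_beta' by (rule borel_measurable_times[rotated])
  qed
  \<comment> \<open>Integrability is known for the contribution only; \<open>H\<close> inherits it
    as the contribution cut to a type event.\<close>
  have XH: "indicator (type_event i j u) \<omega> * ?X \<omega> = H j \<omega> \<omega>" for j \<omega>
    by (auto simp: H_def contribution_def type_event_def indicator_def)
  have Hint: "integrable M (\<lambda>\<omega>. H j \<omega> \<omega>)" for j
    unfolding XH[symmetric] using integrable_mult_indicator[OF sets_type_event int] by simp
  have "(LINT \<omega>|M. ?X \<omega>) = (LINT \<omega>|M. (\<Sum>j\<in>UNIV. H j \<omega> \<omega>))"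
  proof (rule Bochner_Integration.integral_cong[OF refl])
    fix \<omega> assume \<omega>: "\<omega> \<in> space M"
    have "(\<Sum>j\<in>UNIV. H j \<omega> \<omega>) = (\<Sum>j\<in>UNIV. if j = \<tau> i u \<omega> then ?X \<omega> else 0)"
      unfolding XH[symmetric]
      by (intro sum.cong refl) (auto simp: type_event_def indicator_def contribution_def \<omega>)
    then show "?X \<omega> = (\<Sum>j\<in>UNIV. H j \<omega> \<omega>)" by simp
  qed
  also have "\<dots> = (\<Sum>j\<in>UNIV. LINT \<omega>|M. H j \<omega> \<omega>)" by (rule Bochner_Integration.integral_sum[OF Hint])
  also have "\<dots> = (\<Sum>j\<in>UNIV. LINT \<omega>|M. indicator (type_event i j u) \<omega> * (LINT a|M. \<phi> [] a (t - S i u \<omega>) $ j))"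
  proof (rule sum.cong[OF refl])
    fix j
    have "(LINT \<omega>|M. H j \<omega> \<omega>) = (LINT \<omega>|M. (LINT a|M. H j a \<omega>))"
      by (rule indep_subalgebras_integral[OF G(1) subalgebra_repro_past indep Hm Hint])
    also have "\<dots> = (LINT \<omega>|M. indicator (type_event i j u) \<omega> * (LINT a|M. \<phi> [] a (t - S i u \<omega>) $ j))"
      unfolding H_def integral_mult_right_zero expectation_characteristic[of u] ..
    finally show "(LINT \<omega>|M. H j \<omega> \<omega>) = (LINT \<omega>|M. indicator (type_event i j u) \<omega> * (LINT a|M. \<phi> [] a (t - S i u \<omega>) $ j))" .
  qed
  finally show ?thesis .
qed

text \<open>Fubini on the product of words and outcomes. The unordered \<open>has_sum\<close>
  matches the summation along finite sets of words that defines the process.\<close>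

lemma has_sum_renewal_measure:
  fixes k :: "real \<Rightarrow> real"
  assumes k: "integrable (renewal_measure i j) k" and km: "k \<in> borel_measurable borel"
  shows "((\<lambda>u. LINT \<omega>|M. indicator (type_event i j u) \<omega> * k (S i u \<omega>)) has_sum (LINT s|renewal_measure i j. k s)) UNIV"
proof -
  let ?C = "count_space (UNIV :: nat list set)"
  interpret C: sigma_finite_measure ?C by (rule sigma_finite_measure_count_space_countable) simp
  interpret P: pair_sigma_finite ?C M ..
  let ?h = "\<lambda>(u, \<omega>). indicator (type_event i j u) \<omega> * k (S i u \<omega>)"
  let ?D = "density (?C \<Otimes>\<^sub>M M) (\<lambda>(u, \<omega>). indicator (type_event i j u) \<omega>)"
  have ksm: "(\<lambda>(u, \<omega>). k (S i u \<omega>)) \<in> borel_measurable (?C \<Otimes>\<^sub>M M)"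
    using measurable_compose[OF measurable_birth_time_pair km] by (simp add: case_prod_beta')
  have Sm: "(\<lambda>(u, \<omega>). S i u \<omega>) \<in> borel_measurable ?D" using measurable_birth_time_pair[of i] by simp
  define I :: "nat list \<times> 'a \<Rightarrow> real" where "I = (\<lambda>(u, \<omega>). indicator (type_event i j u) \<omega>)"
  have Im: "I \<in> borel_measurable (?C \<Otimes>\<^sub>M M)" unfolding I_def by (rule measurable_type_event_pair(2))
  have D_eq: "?D = density (?C \<Otimes>\<^sub>M M) (\<lambda>p. ennreal (I p))"
    by (rule arg_cong[where f="density (?C \<Otimes>\<^sub>M M)"]) (auto simp: fun_eq_iff indicator_def I_def)
  have nonneg: "AE p in (?C \<Otimes>\<^sub>M M). 0 \<le> I p"
    by (rule AE_I2) (auto simp: indicator_def I_def)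
  have "integrable ?D (\<lambda>p. k ((\<lambda>(u, \<omega>). S i u \<omega>) p))"
    using k unfolding renewal_measure_def by (subst (asm) integrable_distr_eq[OF Sm km])
  then have ih: "integrable (?C \<Otimes>\<^sub>M M) ?h"
    unfolding D_eq
    by (subst (asm) integrable_real_density[OF Im nonneg])
       (use ksm in \<open>simp_all add: case_prod_beta' I_def\<close>)
  have "(LINT s|renewal_measure i j. k s) = (LINT p|?D. k ((\<lambda>(u, \<omega>). S i u \<omega>) p))"
    unfolding renewal_measure_def by (rule integral_distr[OF Sm km])
  also have "\<dots> = (LINT p|(?C \<Otimes>\<^sub>M M). I p * k ((\<lambda>(u, \<omega>). S i u \<omega>) p))"
    unfolding D_eq
    by (rule integral_real_density[OF Im nonneg]) (use ksm in \<open>simp add: case_prod_beta'\<close>)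
  also have "\<dots> = (LINT p|(?C \<Otimes>\<^sub>M M). ?h p)" by (simp add: case_prod_beta' I_def)
  also have "\<dots> = (LINT u|?C. LINT \<omega>|M. indicator (type_event i j u) \<omega> * k (S i u \<omega>))"
    using P.integral_fst'[OF ih] by simp
  finally have eq: "(LINT s|renewal_measure i j. k s) = (LINT u|?C. LINT \<omega>|M. indicator (type_event i j u) \<omega> * k (S i u \<omega>))" .
  define e where "e u = (LINT \<omega>|M. indicator (type_event i j u) \<omega> * k (S i u \<omega>))" for u
  have "integrable ?C e"
    using P.integrable_fst'[OF ih] by (simp add: e_def[abs_def])
  then have a: "Infinite_Set_Sum.abs_summable_on e UNIV"
    by (simp add: Infinite_Set_Sum.abs_summable_on_def)
  then have "e summable_on UNIV"
    using abs_summable_equivalent summable_on_iff_abs_summable_on_real by blast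
  from has_sum_infsum[OF this] have "(e has_sum (LINT u|?C. e u)) UNIV"
    unfolding infsetsum_infsum[OF a, symmetric] by (simp only: infsetsum_def)
  then show ?thesis unfolding eq e_def .
qed

text \<open>Convergence in mean implies convergence of the means along finite sets of words. Along
  the same filter the means of the contributions sum to integrals against the renewal measure, and
  limits are unique.\<close>

lemma expectation_process:
  assumes Z: "has_L1_sum M (contribution \<phi> \<T> S \<tau> i t) Z"
    and f: "\<And>j s. f j s = (LINT a|M. \<phi> [] a s $ j)"
    and fm: "\<And>j. f j \<in> borel_measurable borel"
    and int: "\<And>j. integrable (renewal_measure i j) (\<lambda>s. f j (t - s))"
  shows "(LINT \<omega>|M. Z \<omega>) = (\<Sum>j\<in>UNIV. LINT s|renewal_measure i j. f j (t - s))"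
proof -
  let ?X = "contribution \<phi> \<T> S \<tau> i t" and ?F = "finite_subsets_at_top (UNIV :: nat list set)"
  have iZ: "integrable M Z" and iX: "\<And>u. integrable M (?X u)"
    and lim: "((\<lambda>A. LINT \<omega>|M. \<bar>Z \<omega> - (\<Sum>u\<in>A. ?X u \<omega>)\<bar>) \<longlongrightarrow> 0) ?F"
    using Z by (auto simp: has_L1_sum_def)
  let ?e = "\<lambda>j u. LINT \<omega>|M. indicator (type_event i j u) \<omega> * f j (t - S i u \<omega>)"
  have "((\<lambda>A. \<Sum>u\<in>A. LINT \<omega>|M. ?X u \<omega>) \<longlongrightarrow> (LINT \<omega>|M. Z \<omega>)) ?F"
  proof (rule LIM_zero_cancel, rule Lim_null_comparison[OF _ lim], intro always_eventually allI)
    fix A :: "nat list set"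
    have "(\<Sum>u\<in>A. LINT \<omega>|M. ?X u \<omega>) - (LINT \<omega>|M. Z \<omega>) = - (LINT \<omega>|M. Z \<omega> - (\<Sum>u\<in>A. ?X u \<omega>))"
      using iZ iX by simp
    then show "norm ((\<Sum>u\<in>A. LINT \<omega>|M. ?X u \<omega>) - (LINT \<omega>|M. Z \<omega>)) \<le> (LINT \<omega>|M. \<bar>Z \<omega> - (\<Sum>u\<in>A. ?X u \<omega>)\<bar>)"
      using integral_abs_bound[of M "\<lambda>\<omega>. Z \<omega> - (\<Sum>u\<in>A. ?X u \<omega>)"] by (simp only: norm_minus_cancel real_norm_def)
  qed
  moreover have "((\<lambda>A. \<Sum>u\<in>A. LINT \<omega>|M. ?X u \<omega>) \<longlongrightarrow> (\<Sum>j\<in>UNIV. LINT s|renewal_measure i j. f j (t - s))) ?F"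
  proof -
    have "((\<lambda>A. \<Sum>j\<in>UNIV. \<Sum>u\<in>A. ?e j u) \<longlongrightarrow> (\<Sum>j\<in>UNIV. LINT s|renewal_measure i j. f j (t - s))) ?F"
    proof (rule tendsto_sum)
      fix j
      have "(\<lambda>s. f j (t - s)) \<in> borel_measurable borel" using fm by measurable
      from has_sum_renewal_measure[OF int this]
      show "((\<lambda>A. \<Sum>u\<in>A. ?e j u) \<longlongrightarrow> (LINT s|renewal_measure i j. f j (t - s))) ?F"
        by (simp add: has_sum_def)
    qed
    moreover have "(\<Sum>j\<in>UNIV. \<Sum>u\<in>A. ?e j u) = (\<Sum>u\<in>A. LINT \<omega>|M. ?X u \<omega>)" for A
      unfolding expectation_contribution[OF iX] f by (rule sum.swap)
    ultimately show ?thesis by simp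
  qed
  ultimately show ?thesis by (rule tendsto_unique[rotated]) simp
qed

end

text \<open>As s grows, exp(-s x) tends to 0 at every x > 0 and stays 1 at x = 0. Through this limit
  a condition on the atoms at 0 controls the transforms at large s.\<close>

lemma tendsto_laplace_at_top:
  fixes N :: "real measure"
  assumes sets: "sets N = sets borel" and pos: "AE x in N. 0 \<le> x"
    and int: "integrable N (\<lambda>x. exp (- a * x))"
  shows "((\<lambda>s. LINT x|N. exp (- s * x)) \<longlongrightarrow> measure N {0}) at_top"
proof -
  have [measurable_cong]: "sets N = sets borel" by (rule sets)
  have "((\<lambda>s. LINT x|N. exp (- s * x)) \<longlongrightarrow> (LINT x|N. indicator {0} x)) at_top"
  proof (rule integral_dominated_convergence_at_top[where w="\<lambda>x. exp (- a * x)"])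
    show "\<forall>\<^sub>F s in at_top. AE x in N. norm (exp (- s * x)) \<le> exp (- a * x)"
      using eventually_ge_at_top[of a]
    proof eventually_elim
      case (elim s)
      show ?case using pos by eventually_elim (use elim in \<open>auto simp: mult_right_mono\<close>)
    qed
    show "AE x in N. ((\<lambda>s. exp (- s * x)) \<longlongrightarrow> indicator {0} x) at_top"
      using pos
    proof eventually_elim
      case (elim x)
      show ?case
      proof (cases "x = 0")
        case False
        with elim have x: "x > 0" by simp
        have "filterlim (\<lambda>s. - x * s) at_bot at_top"
          by (rule filterlim_tendsto_neg_mult_at_bot[OF tendsto_const _ filterlim_ident]) (use x in simp)
        from filterlim_compose[OF exp_at_bot this] show ?thesis using False by (simp add: mult.commute)
      qed simp
    qed
  qed (use int in \<open>simp_all\<close>)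
  then show ?thesis by (simp add: sets_eq_imp_space_eq[OF sets])
qed

section \<open>Laplace transforms of the intensities and of the renewal measure\<close>

context cmj_process
begin

abbreviation "mu \<equiv> intensity M (\<xi> [])"

lemma intensity_nonneg: "AE x in mu i j. 0 \<le> x"
proof -
  have "emeasure (mu i j) {..<0} = (\<integral>\<^sup>+\<omega>. emeasure (\<xi> [] \<omega> i j) {..<0} \<partial>M)"
    by (rule emeasure_intensity[OF measurable_repro]) simp
  also have "\<dots> = (\<integral>\<^sup>+\<omega>. 0 \<partial>M)"
    by (intro nn_integral_cong) (use locally_finite_repro in \<open>simp add: locally_finite_point_measure_def\<close>)
  finally have "{..<0} \<in> null_sets (mu i j)" by (simp add: null_setsI)
  from AE_not_in[OF this] show ?thesis by eventually_elim simp
qed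

lemma integrable_intensity_exp:
  assumes "z \<in> laplace_domain mu" "Re z \<le> a"
  shows "integrable (mu i j) (\<lambda>x. exp (- a * x))"
proof (rule integrableI_bounded)
  have "(\<integral>\<^sup>+x. ennreal (norm (exp (- a * x))) \<partial>mu i j) \<le> (\<integral>\<^sup>+x. ennreal (exp (- Re z * x)) \<partial>mu i j)"
  proof (rule nn_integral_mono_AE)
    show "AE x in mu i j. ennreal (norm (exp (- a * x))) \<le> ennreal (exp (- Re z * x))"
      using intensity_nonneg by eventually_elim (use assms(2) in \<open>auto intro!: ennreal_leI mult_right_mono\<close>)
  qed
  also have "\<dots> < \<infinity>" using assms(1) by (simp add: laplace_domain_def)
  finally show "(\<integral>\<^sup>+x. ennreal (norm (exp (- a * x))) \<partial>mu i j) < \<infinity>" .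
qed (simp add: measurable_cong_sets[OF sets_intensity refl])

lemma laplace_domain_upward:
  assumes "z \<in> laplace_domain mu" "Re z \<le> Re w"
  shows "w \<in> laplace_domain mu"
  unfolding laplace_domain_def
proof (intro CollectI allI)
  fix i j
  from integrable_intensity_exp[OF assms, of i j]
  show "(\<integral>\<^sup>+x. ennreal (exp (- Re w * x)) \<partial>mu i j) < \<infinity>"
    by (simp add: integrable_iff_bounded)
qed

lemma laplace_entry: "laplace mu z $ i $ j = (LINT x|mu i j. exp (- z * complex_of_real x))"
proof -
  have m: "f \<in> borel_measurable (mu i j)" if "f \<in> borel_measurable borel" for f :: "real \<Rightarrow> complex"
    using that by (simp add: measurable_cong_sets[OF sets_intensity refl])
  have "(LINT x|mu i j. indicator {0..} x *\<^sub>R exp (- z * complex_of_real x)) = (LINT x|mu i j. exp (- z * complex_of_real x))"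
  proof (rule integral_cong_AE)
    show "AE x in mu i j. indicator {0..} x *\<^sub>R exp (- z * complex_of_real x) = exp (- z * complex_of_real x)"
      using intensity_nonneg by eventually_elim simp
  qed (auto intro!: m)
  then show ?thesis by (simp add: laplace_def set_lebesgue_integral_def)
qed

lemma laplace_holomorphic:
  assumes "z \<in> laplace_domain mu" "Re z \<le> a"
  shows "(\<lambda>z. laplace mu z $ i $ j) holomorphic_on {z. Re z > a}"
  unfolding laplace_entry
  by (rule laplace_transform_holomorphic[OF sets_intensity intensity_nonneg integrable_intensity_exp[OF assms]])

lemma norm_laplace_le:
  assumes "z \<in> laplace_domain mu" "Re z \<le> a" "a \<le> Re w"
  shows "norm (laplace mu w $ i $ j) \<le> (LINT x|mu i j. exp (- a * x))"
proof -
  have "norm (laplace mu w $ i $ j) \<le> (LINT x|mu i j. norm (exp (- w * complex_of_real x)))"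
    unfolding laplace_entry by (rule integral_norm_bound)
  also have "\<dots> = (LINT x|mu i j. exp (- Re w * x))" by simp
  also have "\<dots> \<le> (LINT x|mu i j. exp (- a * x))"
  proof (rule integral_mono_AE)
    show "AE x in mu i j. exp (- Re w * x) \<le> exp (- a * x)"
      using intensity_nonneg by eventually_elim (use assms(3) in \<open>auto intro!: mult_right_mono\<close>)
    show "integrable (mu i j) (\<lambda>x. exp (- Re w * x))" "integrable (mu i j) (\<lambda>x. exp (- a * x))"
      using assms by (intro integrable_intensity_exp[of z]; simp)+
  qed
  finally show ?thesis .
qed

text \<open>The supersolution for the atoms at 0 survives, with a rate still below 1, for the
  transforms at large real s. This makes the transforms of the renewal measure finite, and the
  renewal equation then identifies them with the inverse matrix.\<close>

proposition renewal_measure_laplace: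
  assumes dom: "z0 \<in> laplace_domain mu"
    and rad: "cspectral_radius (\<chi> i j. complex_of_real (measure (mu i j) {0})) < 1"
  shows "\<exists>s1. \<forall>z. s1 < Re z \<longrightarrow> det (mat 1 - laplace mu z) \<noteq> 0 \<and>
    (\<forall>i j. integrable (renewal_measure i j) (\<lambda>x. exp (- Re z * x)) \<and>
      matrix_inv (mat 1 - laplace mu z) $ i $ j = (LINT x|renewal_measure i j. exp (- z * complex_of_real x)))"
proof -
  define a where "a s l j = (LINT x|mu l j. exp (- s * x))" for s l j
  obtain v where "\<forall>i. v i \<ge> 1 \<and> v i = 1 + (\<Sum>j\<in>UNIV. measure (mu i j) {0} * v j)"
    using supersolution[OF measure_nonneg rad] by (elim exE)
  then have v: "v i \<ge> 1" "v i = 1 + (\<Sum>j\<in>UNIV. measure (mu i j) {0} * v j)" for i by blast+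
  define m where "m = Max (range v)"
  have m: "v i \<le> m" for i by (simp add: m_def)
  have m1: "m \<ge> 1" using order_trans[OF v(1) m] by blast
  \<comment> \<open>With A the matrix of atoms, A v = v - 1 and v \<le> m give r v = v - v/(2 m)
    \<ge> v - 1/2 > A v. The inequality is strict and hence survives the limit.\<close>
  define r where "r = 1 - 1 / (2 * m)"
  have r: "0 \<le> r" "r < 1" using m1 by (auto simp: r_def divide_simps)
  have "\<forall>\<^sub>F s in at_top. (\<Sum>j\<in>UNIV. a s l j * v j) \<le> r * v l" for l
  proof -
    have "((\<lambda>s. \<Sum>j\<in>UNIV. a s l j * v j) \<longlongrightarrow> (\<Sum>j\<in>UNIV. measure (mu l j) {0} * v j)) at_top"
      unfolding a_def
      by (intro tendsto_intros tendsto_laplace_at_top[OF sets_intensity intensity_nonneg integrable_intensity_exp[OF dom order_refl]])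
    moreover have "(\<Sum>j\<in>UNIV. measure (mu l j) {0} * v j) < r * v l"
    proof -
      have "v l / (2 * m) \<le> 1 / 2" using m[of l] m1 by (simp add: divide_simps)
      moreover have "r * v l = v l - v l / (2 * m)" by (simp add: r_def algebra_simps)
      ultimately show ?thesis using v(2)[of l] by linarith
    qed
    ultimately show ?thesis by (rule eventually_mono[OF order_tendstoD(2)]) simp
  qed
  then have "\<forall>\<^sub>F s in at_top. \<forall>l\<in>UNIV. (\<Sum>j\<in>UNIV. a s l j * v j) \<le> r * v l"
    by (intro eventually_ball_finite) auto
  then obtain s0 where s0: "\<And>s l. s \<ge> s0 \<Longrightarrow> (\<Sum>j\<in>UNIV. a s l j * v j) \<le> r * v l"
    unfolding eventually_at_top_linorder by blast
  define s1 where "s1 = max s0 (Re z0)"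
  have ai: "integrable (mu l j) (\<lambda>x. exp (- s * x))" if "s \<ge> s1" for s l j
    using that by (intro integrable_intensity_exp[OF dom]) (simp add: s1_def)
  have an: "(\<integral>\<^sup>+x. ennreal (exp (- s * x)) \<partial>mu l j) = ennreal (a s l j)" if "s \<ge> s1" for s l j
    unfolding a_def by (rule nn_integral_eq_integral[OF ai[OF that]]) simp
  have a0: "a s l j \<ge> 0" for s l j by (simp add: a_def)
  have fin: "(\<integral>\<^sup>+x. ennreal (exp (- s * x)) \<partial>renewal_measure i j) < \<infinity>" if s: "s \<ge> s1" for s i j
  proof (rule renewal_measure_finite_moment[OF v(1) r])
    fix l
    have "(\<Sum>j\<in>UNIV. (\<integral>\<^sup>+x. ennreal (exp (- s * x)) \<partial>mu l j) * ennreal (v j)) = (\<Sum>j\<in>UNIV. ennreal (a s l j * v j))"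
      unfolding an[OF s] using a0 order_trans[OF zero_le_one v(1)] by (simp add: ennreal_mult)
    also have "\<dots> = ennreal (\<Sum>j\<in>UNIV. a s l j * v j)"
      using a0 order_trans[OF zero_le_one v(1)] by (intro sum_ennreal mult_nonneg_nonneg) auto
    also have "\<dots> \<le> ennreal (r * v l)" using s by (intro ennreal_leI s0) (simp add: s1_def)
    finally show "(\<Sum>j\<in>UNIV. (\<integral>\<^sup>+x. ennreal (exp (- s * x)) \<partial>mu l j) * ennreal (v j)) \<le> ennreal (r * v l)" .
  qed
  have ui: "integrable (renewal_measure i j) (\<lambda>x. exp (- s * x))" if "s \<ge> s1" for s i j
    using fin[OF that, of i j] by (intro integrableI_bounded) (simp_all add: measurable_cong_sets[OF sets_renewal_measure refl])
  define u where "u s i j = (LINT x|renewal_measure i j. exp (- s * x))" for s i j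
  have un: "(\<integral>\<^sup>+x. ennreal (exp (- s * x)) \<partial>renewal_measure i j) = ennreal (u s i j)" if "s \<ge> s1" for s i j
    unfolding u_def by (rule nn_integral_eq_integral[OF ui[OF that]]) simp
  have u0: "u s i j \<ge> 0" for s i j by (simp add: u_def)
  have real_eq: "u s i j = (if i = j then 1 else 0) + (\<Sum>l\<in>UNIV. u s i l * a s l j)" if s: "s \<ge> s1" for s i j
  proof -
    have "ennreal (u s i j) = (if i = j then 1 else 0) + (\<Sum>l\<in>UNIV. ennreal (u s i l) * ennreal (a s l j))"
      using renewal_equation[where \<sigma>=s and i=i and j=j] unfolding un[OF s] an[OF s] .
    also have "\<dots> = ennreal (if i = j then 1 else 0) + ennreal (\<Sum>l\<in>UNIV. u s i l * a s l j)"
      by (subst sum_ennreal[symmetric]) (auto simp: u0 a0 ennreal_mult)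
    also have "\<dots> = ennreal ((if i = j then 1 else 0) + (\<Sum>l\<in>UNIV. u s i l * a s l j))"
      by (rule ennreal_plus[symmetric]) (auto intro!: sum_nonneg mult_nonneg_nonneg u0 a0)
    finally show ?thesis
      by (subst (asm) ennreal_inj) (auto intro!: add_nonneg_nonneg sum_nonneg mult_nonneg_nonneg u0 a0)
  qed
  define L where "L z i j = (LINT x|renewal_measure i j. exp (- z * complex_of_real x))" for z i j
  \<comment> \<open>The equation is known at real arguments, where all terms are finite; as its
    terms are holomorphic, it extends to the half-plane.\<close>
  have L_eq: "L z i j - (if i = j then 1 else 0) - (\<Sum>l\<in>UNIV. L z i l * laplace mu z $ l $ j) = 0" if z: "Re z > s1" for z i j
  proof (rule analytic_continuation[of "\<lambda>z. L z i j - (if i = j then 1 else 0) - (\<Sum>l\<in>UNIV. L z i l * laplace mu z $ l $ j)"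
      "{z. Re z > s1}" "complex_of_real ` {s1<..}" "complex_of_real (s1 + 1)"])
    have "(\<lambda>z. L z i j) holomorphic_on {z. Re z > s1}" for j
      unfolding L_def
      by (rule laplace_transform_holomorphic[OF sets_renewal_measure renewal_measure_nonneg ui[OF order_refl]])
    moreover have "(\<lambda>z. laplace mu z $ l $ j) holomorphic_on {z. Re z > s1}" for l
      by (rule laplace_holomorphic[OF dom]) (simp add: s1_def)
    ultimately show "(\<lambda>z. L z i j - (if i = j then 1 else 0) - (\<Sum>l\<in>UNIV. L z i l * laplace mu z $ l $ j)) holomorphic_on {z. Re z > s1}"
      by (intro holomorphic_intros)
    show "open {z. Re z > s1}" by (rule open_halfspace_Re_gt)
    show "connected {z. Re z > s1}" using convex_halfspace_Re_gt convex_connected by blast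
    show "complex_of_real (s1 + 1) islimpt complex_of_real ` {s1<..}"
      unfolding islimpt_approachable
    proof (intro allI impI)
      fix e :: real assume "e > 0"
      have "dist (complex_of_real (s1 + 1 + e / 2)) (complex_of_real (s1 + 1)) = \<bar>e / 2\<bar>"
        unfolding dist_of_real by (simp add: dist_real_def)
      then have "dist (complex_of_real (s1 + 1 + e / 2)) (complex_of_real (s1 + 1)) < e" using \<open>e > 0\<close> by simp
      moreover have "complex_of_real (s1 + 1 + e / 2) \<noteq> complex_of_real (s1 + 1)"
        unfolding of_real_eq_iff using \<open>e > 0\<close> by simp
      moreover have "complex_of_real (s1 + 1 + e / 2) \<in> complex_of_real ` {s1<..}"
        using \<open>e > 0\<close> by (intro imageI) simp
      ultimately show "\<exists>x'\<in>complex_of_real ` {s1<..}. x' \<noteq> complex_of_real (s1 + 1) \<and> dist x' (complex_of_real (s1 + 1)) < e"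
        by blast
    qed
    fix w assume "w \<in> complex_of_real ` {s1<..}"
    then obtain s where s: "w = complex_of_real s" "s > s1" by auto
    have *: "(LINT x|N. exp (- complex_of_real s * complex_of_real x)) = complex_of_real (LINT x|N. exp (- s * x))" for N
    proof -
      have "(LINT x|N. exp (- complex_of_real s * complex_of_real x)) = (LINT x|N. complex_of_real (exp (- s * x)))"
        by (intro Bochner_Integration.integral_cong refl) (simp flip: exp_of_real)
      then show ?thesis by simp
    qed
    have "L w i l = complex_of_real (u s i l)" "laplace mu w $ l $ j = complex_of_real (a s l j)" for l j
      unfolding L_def laplace_entry u_def a_def s(1) * by auto
    then have "L w i j - (if i = j then 1 else 0) - (\<Sum>l\<in>UNIV. L w i l * laplace mu w $ l $ j)
      = complex_of_real (u s i j - (if i = j then 1 else 0) - (\<Sum>l\<in>UNIV. u s i l * a s l j))"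
      by simp
    also have "\<dots> = 0" using real_eq[of s i j] s(2) by simp
    finally show "L w i j - (if i = j then 1 else 0) - (\<Sum>l\<in>UNIV. L w i l * laplace mu w $ l $ j) = 0" .
  qed (use z in auto)
  \<comment> \<open>A left inverse, as the intensity is the right factor in the renewal equation;
    for square matrices this is the inverse.\<close>
  have inv: "(\<chi> i j. L z i j) ** (mat 1 - laplace mu z) = mat 1" if z: "Re z > s1" for z
  proof -
    have "((\<chi> i j. L z i j) ** (mat 1 - laplace mu z)) $ i $ j = mat 1 $ i $ j" for i j
    proof -
      have "((\<chi> i j. L z i j) ** (mat 1 - laplace mu z)) $ i $ j
        = (\<Sum>l\<in>UNIV. (if l = j then L z i l else 0) - L z i l * laplace mu z $ l $ j)"
        unfolding matrix_matrix_mult_def by (auto simp: mat_def algebra_simps intro!: sum.cong)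
      also have "\<dots> = L z i j - (\<Sum>l\<in>UNIV. L z i l * laplace mu z $ l $ j)" by (simp add: sum_subtractf)
      also have "\<dots> = mat 1 $ i $ j" using L_eq[OF z, of i j] by (simp add: mat_def algebra_simps)
      finally show ?thesis .
    qed
    then show ?thesis by (simp add: vec_eq_iff)
  qed
  have "det (mat 1 - laplace mu z) \<noteq> 0 \<and>
    (\<forall>i j. integrable (renewal_measure i j) (\<lambda>x. exp (- Re z * x)) \<and> matrix_inv (mat 1 - laplace mu z) $ i $ j = L z i j)"
    if z: "Re z > s1" for z
  proof (intro conjI allI)
    have "det (\<chi> i j. L z i j) * det (mat 1 - laplace mu z) = 1"
      using arg_cong[OF inv[OF z], of det] by (simp add: det_mul)
    then show "det (mat 1 - laplace mu z) \<noteq> 0" by auto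
    show "integrable (renewal_measure i j) (\<lambda>x. exp (- Re z * x))" for i j using z by (intro ui) simp
    show "matrix_inv (mat 1 - laplace mu z) $ i $ j = L z i j" for i j
      by (simp add: matrix_inv_unique_left[OF inv[OF z]])
  qed
  then show ?thesis unfolding L_def by blast
qed

end

section \<open>The resolvent\<close>

context cmj_process
begin

abbreviation "char_matrix z \<equiv> mat 1 - laplace mu z"

lemma interior_laplace_domain:
  assumes "complex_of_real \<theta>\<^sub>0 \<in> interior (laplace_domain mu)"
  obtains l where "l < \<theta>\<^sub>0" "complex_of_real l \<in> laplace_domain mu"
proof -
  obtain e where e: "e > 0" "ball (complex_of_real \<theta>\<^sub>0) e \<subseteq> laplace_domain mu"
    using assms mem_interior by blast
  have "complex_of_real (\<theta>\<^sub>0 - e / 2) \<in> ball (complex_of_real \<theta>\<^sub>0) e"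
    using e(1) unfolding mem_ball dist_of_real by (simp add: dist_real_def)
  with e show ?thesis by (intro that[of "\<theta>\<^sub>0 - e / 2"]) auto
qed

lemma char_matrix_holomorphic:
  assumes "complex_of_real l \<in> laplace_domain mu"
  shows "(\<lambda>z. char_matrix z $ i $ j) holomorphic_on {z. Re z > l}"
proof -
  have "(\<lambda>z. laplace mu z $ i $ j) holomorphic_on {z. Re z > l}"
    by (rule laplace_holomorphic[OF assms]) simp
  then show ?thesis by (auto intro!: holomorphic_intros)
qed

text \<open>The (i,j) entry of the adjugate of \<open>char_matrix z\<close>, in the form delivered
  by Cramer's rule.\<close>

definition char_minor :: "'p \<Rightarrow> 'p \<Rightarrow> complex \<Rightarrow> complex" where
  "char_minor i j z = det (\<chi> k l. if l = i then (if k = j then 1 else 0) else char_matrix z $ k $ l)"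

lemma char_det_holomorphic:
  assumes "complex_of_real l \<in> laplace_domain mu"
  shows "(\<lambda>z. det (char_matrix z)) holomorphic_on {z. Re z > l}"
    and "char_minor i j holomorphic_on {z. Re z > l}"
proof -
  show "(\<lambda>z. det (char_matrix z)) holomorphic_on {z. Re z > l}"
    by (rule det_holomorphic[OF char_matrix_holomorphic[OF assms]])
  show "char_minor i j holomorphic_on {z. Re z > l}"
    unfolding char_minor_def[abs_def]
  proof (rule det_holomorphic)
    fix k m
    show "(\<lambda>z. (\<chi> k l. if l = i then if k = j then 1 else 0 else char_matrix z $ k $ l) $ k $ m) holomorphic_on {z. Re z > l}"
      using char_matrix_holomorphic[OF assms, of k m] by (cases "m = i") simp_all
  qed
qed

lemma resolvent_entry:
  assumes "det (char_matrix z) \<noteq> 0"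
  shows "matrix_inv (char_matrix z) $ i $ j = char_minor i j z / det (char_matrix z)"
  unfolding char_minor_def by (rule matrix_inv_entry[OF assms])

text \<open>For x \<ge> 0 the modulus of exp(-z x) decreases in Re z, so the bound covers a full
  half-plane. Normal families of vertical translates need exactly this uniformity.\<close>

lemma char_det_bounded:
  assumes "complex_of_real l \<in> laplace_domain mu"
  shows "\<exists>B. \<forall>z. l \<le> Re z \<longrightarrow> norm (det (char_matrix z)) \<le> B \<and> (\<forall>i j. norm (char_minor i j z) \<le> B)"
proof -
  define C where "C = 1 + (\<Sum>i\<in>UNIV. \<Sum>j\<in>UNIV. LINT x|mu i j. exp (- l * x))"
  have nn: "0 \<le> (LINT x|mu i j. exp (- l * x))" for i j by simp
  have n0: "norm (mat 1 $ i $ j :: complex) \<le> 1" for i j :: 'p by (simp add: mat_def)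
  have entry: "norm (char_matrix z $ i $ j) \<le> C" if "l \<le> Re z" for z i j
  proof -
    have "norm (char_matrix z $ i $ j) \<le> norm (mat 1 $ i $ j :: complex) + norm (laplace mu z $ i $ j)"
      by (simp add: norm_triangle_ineq4)
    also have "norm (laplace mu z $ i $ j) \<le> (LINT x|mu i j. exp (- l * x))"
      by (rule norm_laplace_le[OF assms _ that]) simp
    also have "(LINT x|mu i j. exp (- l * x)) \<le> (\<Sum>j\<in>UNIV. LINT x|mu i j. exp (- l * x))"
      by (rule member_le_sum) (use nn in auto)
    also have "\<dots> \<le> (\<Sum>i\<in>UNIV. \<Sum>j\<in>UNIV. LINT x|mu i j. exp (- l * x))"
      by (rule member_le_sum[where f="\<lambda>i. \<Sum>j\<in>UNIV. LINT x|mu i j. exp (- l * x)"]) (use nn in \<open>auto intro: sum_nonneg\<close>)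
    finally show ?thesis using n0[of i j] unfolding C_def by simp
  qed
  have C1: "1 \<le> C" unfolding C_def using nn by (simp add: sum_nonneg)
  let ?B = "real (card {p. p permutes (UNIV :: 'p set)}) * C ^ CARD('p)"
  have "norm (det (char_matrix z)) \<le> ?B" "norm (char_minor i j z) \<le> ?B" if "l \<le> Re z" for z i j
  proof -
    show "norm (det (char_matrix z)) \<le> ?B" by (rule norm_det_le[OF entry[OF that]])
    have "norm ((\<chi> k l. if l = i then if k = j then 1 else 0 else char_matrix z $ k $ l) $ k $ m) \<le> C" for k m
      using entry[OF that, of k m] C1 by (cases "m = i") auto
    then show "norm (char_minor i j z) \<le> ?B" unfolding char_minor_def by (rule norm_det_le)
  qed
  then show ?thesis by blast
qed

lemma in_roots_above:
  assumes "complex_of_real l \<in> laplace_domain mu" "l \<le> \<theta>\<^sub>0"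
  shows "z \<in> roots_above mu \<theta>\<^sub>0 \<longleftrightarrow> \<theta>\<^sub>0 < Re z \<and> det (char_matrix z) = 0"
  using laplace_domain_upward[OF assms(1), of z] assms(2) by (auto simp: roots_above_def roots_def)

text \<open>The determinant of the inverse is a polynomial in bounded entries, hence bounded, and
  the two determinants multiply to 1.\<close>

lemma char_det_lower_bound_line:
  assumes inv: "\<And>\<eta>. invertible (char_matrix (Complex \<theta>\<^sub>0 \<eta>))"
    and bdd: "bdd_above (range (\<lambda>\<eta>. norm (matrix_inv (char_matrix (Complex \<theta>\<^sub>0 \<eta>)))))"
  shows "\<exists>m>0. \<forall>\<eta>. m \<le> norm (det (char_matrix (Complex \<theta>\<^sub>0 \<eta>)))"
proof -
  obtain B where B: "\<And>\<eta>. norm (matrix_inv (char_matrix (Complex \<theta>\<^sub>0 \<eta>))) \<le> B"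
    using bdd by (auto simp: bdd_above_def)
  let ?C = "real (card {p. p permutes (UNIV :: 'p set)}) * B ^ CARD('p)"
  have d: "norm (det (char_matrix (Complex \<theta>\<^sub>0 \<eta>))) * norm (det (matrix_inv (char_matrix (Complex \<theta>\<^sub>0 \<eta>)))) = 1" for \<eta>
  proof -
    have "det (char_matrix (Complex \<theta>\<^sub>0 \<eta>)) \<noteq> 0" using inv[of \<eta>] by (simp add: invertible_det_nz)
    from arg_cong[OF matrix_inv_inverse(1)[OF this], of det] show ?thesis
      by (simp add: det_mul norm_mult[symmetric])
  qed
  have C: "norm (det (matrix_inv (char_matrix (Complex \<theta>\<^sub>0 \<eta>)))) \<le> ?C" for \<eta>
  proof (rule norm_det_le)
    fix i j
    show "norm (matrix_inv (char_matrix (Complex \<theta>\<^sub>0 \<eta>)) $ i $ j) \<le> B"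
      by (rule order_trans[OF Finite_Cartesian_Product.norm_nth_le order_trans[OF Finite_Cartesian_Product.norm_nth_le B]])
  qed
  have "norm (det (matrix_inv (char_matrix (Complex \<theta>\<^sub>0 0)))) \<noteq> 0"
    using d[of 0] by (intro notI) simp
  then have "0 < norm (det (matrix_inv (char_matrix (Complex \<theta>\<^sub>0 0))))" by simp
  then have C0: "?C > 0" using C[of 0] by (rule less_le_trans)
  have "1 / ?C \<le> norm (det (char_matrix (Complex \<theta>\<^sub>0 \<eta>)))" for \<eta>
  proof -
    have "1 \<le> norm (det (char_matrix (Complex \<theta>\<^sub>0 \<eta>))) * ?C"
      unfolding d[of \<eta>, symmetric] by (rule mult_left_mono[OF C]) simp
    then show ?thesis using C0 by (simp only: pos_divide_le_eq)
  qed
  with C0 show ?thesis by (intro exI[of _ "1 / ?C"]) simp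
qed

text \<open>In Cramer's quotient the numerator is bounded on a half-plane and the denominator is
  kept away from 0 by the strip estimate.\<close>

lemma resolvent_bounded_strip:
  assumes dom: "complex_of_real l \<in> laplace_domain mu" "l < \<theta>\<^sub>0"
    and inv: "\<And>\<eta>. invertible (char_matrix (Complex \<theta>\<^sub>0 \<eta>))"
    and bdd: "bdd_above (range (\<lambda>\<eta>. norm (matrix_inv (char_matrix (Complex \<theta>\<^sub>0 \<eta>)))))"
    and fin: "finite (roots_above mu \<theta>\<^sub>0)" and "\<theta>\<^sub>0 < c"
  shows "\<exists>T B. \<forall>z i j. c \<le> Re z \<longrightarrow> Re z \<le> \<sigma> \<longrightarrow> T \<le> \<bar>Im z\<bar> \<longrightarrow> norm (matrix_inv (char_matrix z) $ i $ j) \<le> B"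
proof -
  obtain m where m: "m > 0" "\<And>\<eta>. m \<le> norm (det (char_matrix (Complex \<theta>\<^sub>0 \<eta>)))"
    using char_det_lower_bound_line[OF inv bdd] by blast
  obtain B where B: "\<And>z. l \<le> Re z \<Longrightarrow> norm (det (char_matrix z)) \<le> B" "\<And>z i j. l \<le> Re z \<Longrightarrow> norm (char_minor i j z) \<le> B"
    using char_det_bounded[OF dom(1)] by blast
  have "{z. \<theta>\<^sub>0 < Re z \<and> det (char_matrix z) = 0} = roots_above mu \<theta>\<^sub>0"
    using in_roots_above[OF dom(1) less_imp_le[OF dom(2)]] by blast
  with fin have f: "finite {z. \<theta>\<^sub>0 < Re z \<and> det (char_matrix z) = 0}" by simp
  have bd: "\<exists>B. \<forall>z. x \<le> Re z \<longrightarrow> norm (det (char_matrix z)) \<le> B" if "l < x" for x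
    using B(1) that by (intro exI[of _ B]) auto
  obtain T m' where m': "m' > 0" "\<And>z. c \<le> Re z \<Longrightarrow> Re z \<le> \<sigma> \<Longrightarrow> T \<le> \<bar>Im z\<bar> \<Longrightarrow> m' \<le> norm (det (char_matrix z))"
    using vertical_strip_lower_bound[OF char_det_holomorphic(1)[OF dom(1)] dom(2) \<open>\<theta>\<^sub>0 < c\<close> bd m f, of \<sigma>] by blast
  have "norm (matrix_inv (char_matrix z) $ i $ j) \<le> B / m'" if "c \<le> Re z" "Re z \<le> \<sigma>" "T \<le> \<bar>Im z\<bar>" for z i j
  proof -
    have d: "m' \<le> norm (det (char_matrix z))" by (rule m'(2)[OF that])
    then have "det (char_matrix z) \<noteq> 0" using m'(1) by auto
    then have "norm (matrix_inv (char_matrix z) $ i $ j) = norm (char_minor i j z) / norm (det (char_matrix z))"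
      by (simp add: resolvent_entry norm_divide)
    also have "\<dots> \<le> B / m'"
      by (rule frac_le[OF _ B(2) m'(1) d]) (use that dom(2) \<open>\<theta>\<^sub>0 < c\<close> order_trans[OF norm_ge_zero B(2)[of z]] in auto)
    finally show ?thesis .
  qed
  then show ?thesis by blast
qed

lemma resolvent_holomorphic:
  assumes dom: "complex_of_real l \<in> laplace_domain mu" "l \<le> \<theta>\<^sub>0"
  shows "(\<lambda>z. matrix_inv (char_matrix z) $ i $ j) holomorphic_on {z. \<theta>\<^sub>0 < Re z} - roots_above mu \<theta>\<^sub>0"
proof -
  have nz: "det (char_matrix z) \<noteq> 0" if "z \<in> {z. \<theta>\<^sub>0 < Re z} - roots_above mu \<theta>\<^sub>0" for z
    using that in_roots_above[OF dom] by blast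
  have sub: "{z. \<theta>\<^sub>0 < Re z} - roots_above mu \<theta>\<^sub>0 \<subseteq> {z. l < Re z}" using dom(2) by auto
  have "(\<lambda>z. char_minor i j z / det (char_matrix z)) holomorphic_on {z. \<theta>\<^sub>0 < Re z} - roots_above mu \<theta>\<^sub>0"
    by (intro holomorphic_on_divide holomorphic_on_subset[OF char_det_holomorphic(1)[OF dom(1)] sub]
      holomorphic_on_subset[OF char_det_holomorphic(2)[OF dom(1)] sub] nz)
  then show ?thesis
    by (rule holomorphic_transform) (simp add: resolvent_entry[OF nz])
qed

text \<open>\<open>root_order\<close> is a \<open>LEAST\<close>, so some admissible exponent has to
  be exhibited. The multiplicity n of p as a zero of the determinant is one, since the n-th power
  cancels that zero in Cramer's quotient. The point w rules out an identically vanishing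
  determinant.\<close>

lemma root_order_pole:
  assumes dom: "complex_of_real l \<in> laplace_domain mu" "l \<le> \<theta>\<^sub>0" and p: "p \<in> roots_above mu \<theta>\<^sub>0"
    and nz: "det (char_matrix w) \<noteq> 0" "l < Re w"
  shows "root_order mu p \<ge> 1 \<and> (\<exists>V. open V \<and> p \<in> V \<and> (\<forall>i j. \<exists>g. g holomorphic_on V \<and>
    (\<forall>z\<in>V - {p}. g z = (z - p) ^ root_order mu p * matrix_inv (char_matrix z) $ i $ j)))"
proof -
  let ?H = "{z. Re z > l}" and ?D = "\<lambda>z. det (char_matrix z)"
  let ?P = "\<lambda>k. k \<ge> 1 \<and> (\<exists>U. open U \<and> p \<in> U \<and> U \<subseteq> laplace_domain mu \<and>
             (\<forall>z\<in>U - {p}. invertible (char_matrix z)) \<and>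
             (\<forall>i j. \<exists>g. g holomorphic_on U \<and>
                (\<forall>z\<in>U - {p}. g z = (z - p) ^ k * matrix_inv (char_matrix z) $ i $ j)))"
  have p0: "?D p = 0" "p \<in> ?H" using p in_roots_above[OF dom] dom(2) by auto
  have H: "open ?H" "connected ?H"
    using open_halfspace_Re_gt convex_halfspace_Re_gt convex_connected by blast+
  have nc: "\<not> ?D constant_on ?H"
  proof
    assume "?D constant_on ?H"
    then obtain k where "\<forall>z\<in>?H. ?D z = k" unfolding constant_on_def by blast
    then have "?D p = k" "?D w = k" using p0(2) nz(2) by auto
    with p0(1) nz(1) show False by simp
  qed
  obtain g r n where g: "0 < n" "0 < r" "ball p r \<subseteq> ?H" "g holomorphic_on ball p r"
    "\<And>z. z \<in> ball p r \<Longrightarrow> ?D z = (z - p) ^ n * g z" "\<And>z. z \<in> ball p r \<Longrightarrow> g z \<noteq> 0"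
    by (rule holomorphic_factor_zero_nonconstant[OF char_det_holomorphic(1)[OF dom(1)] H p0(2) p0(1) nc]) blast
  have D: "?D z \<noteq> 0" if "z \<in> ball p r - {p}" for z
    using that g(5)[of z] g(6)[of z] by auto
  have "?P n"
  proof (intro conjI exI allI)
    show "1 \<le> n" using g(1) by simp
    show "open (ball p r)" "p \<in> ball p r" using g(2) by auto
    show "ball p r \<subseteq> laplace_domain mu"
    proof
      fix z assume "z \<in> ball p r"
      then have "l < Re z" using g(3) by auto
      then show "z \<in> laplace_domain mu" by (intro laplace_domain_upward[OF dom(1)]) simp
    qed
    show "\<forall>z\<in>ball p r - {p}. invertible (char_matrix z)" using D by (simp add: invertible_det_nz)
    fix i j
    show "(\<lambda>z. char_minor i j z / g z) holomorphic_on ball p r"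
      by (intro holomorphic_on_divide holomorphic_on_subset[OF char_det_holomorphic(2)[OF dom(1)] g(3)] g(4) g(6))
    show "\<forall>z\<in>ball p r - {p}. char_minor i j z / g z = (z - p) ^ n * matrix_inv (char_matrix z) $ i $ j"
    proof
      fix z assume z: "z \<in> ball p r - {p}"
      have "matrix_inv (char_matrix z) $ i $ j = char_minor i j z / ((z - p) ^ n * g z)"
        using resolvent_entry[OF D[OF z]] g(5)[of z] z by simp
      then show "char_minor i j z / g z = (z - p) ^ n * matrix_inv (char_matrix z) $ i $ j" using z by simp
    qed
  qed
  then have "?P (root_order mu p)" unfolding root_order_def by (rule LeastI)
  then show ?thesis by blast
qed

proposition renewal_measure_expansion:
  assumes domain: "complex_of_real \<theta>\<^sub>0 \<in> interior (laplace_domain mu)"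
    and rad: "cspectral_radius (\<chi> i j. complex_of_real (measure (mu i j) {0})) < 1"
    and inv: "\<And>\<eta>. invertible (char_matrix (Complex \<theta>\<^sub>0 \<eta>))"
    and bdd: "bdd_above (range (\<lambda>\<eta>. norm (matrix_inv (char_matrix (Complex \<theta>\<^sub>0 \<eta>)))))"
    and fin: "finite (roots_above mu \<theta>\<^sub>0)"
    and \<theta>: "\<theta> > \<theta>\<^sub>0" "roots_above mu \<theta>\<^sub>0 = roots_above mu \<theta>" "\<theta> > 0"
  shows "\<exists>\<sigma>\<ge>0. \<exists>q C. \<forall>i j. integrable (renewal_measure i j) (\<lambda>x. exp (- \<sigma> * x)) \<and>
    (\<forall>t\<ge>0. \<forall>A\<in>{{0..t}, {0..<t}}. norm (complex_of_real (measure (renewal_measure i j) A)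
        - exppoly (roots_above mu \<theta>) (root_order mu) (q i j) (complex_of_real t)) \<le> C i j * exp (\<theta> * t))"
proof -
  obtain l where l: "l < \<theta>\<^sub>0" "complex_of_real l \<in> laplace_domain mu" by (rule interior_laplace_domain[OF domain])
  obtain s1 where s1: "\<And>z. s1 < Re z \<Longrightarrow> det (char_matrix z) \<noteq> 0"
    "\<And>z i j. s1 < Re z \<Longrightarrow> integrable (renewal_measure i j) (\<lambda>x. exp (- Re z * x))"
    "\<And>z i j. s1 < Re z \<Longrightarrow> matrix_inv (char_matrix z) $ i $ j = (LINT x|renewal_measure i j. exp (- z * complex_of_real x))"
    using renewal_measure_laplace[OF l(2) rad] by blast
  \<comment> \<open>To the right of \<open>s1\<close> the transforms of the renewal measure converge
    and the determinant has no zeros, so all roots lie to the left of the line Re z =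
    \<sigma>.\<close>
  define \<sigma> where "\<sigma> = max s1 \<theta> + 1"
  have \<sigma>: "s1 < \<sigma>" "\<theta> < \<sigma>" "0 \<le> \<sigma>" using \<theta>(3) by (auto simp: \<sigma>_def)
  \<comment> \<open>Two barriers for the contour: \<open>\<theta>\<^sub>0\<close>, to the right of
    which the strip bound on the resolvent is available, and 0, where the weight 1/z^2 has its pole.
    The new line lies midway between the higher barrier and \<theta>.\<close>
  define a where "a = max \<theta>\<^sub>0 0"
  define c where "c = (a + \<theta>) / 2"
  have ac: "0 \<le> a" "a < c" "c < \<theta>" "\<theta>\<^sub>0 \<le> a" "\<theta>\<^sub>0 < c" using \<theta> by (auto simp: a_def c_def max_def)
  let ?P = "roots_above mu \<theta>"
  note dom = l(2) less_imp_le[OF l(1)]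
  have P: "finite ?P" "?P \<subseteq> {z. c < Re z \<and> Re z < \<sigma>}"
  proof -
    show "finite ?P" using fin \<theta>(2) by simp
    show "?P \<subseteq> {z. c < Re z \<and> Re z < \<sigma>}"
    proof
      fix z assume z: "z \<in> ?P"
      then have "\<theta> < Re z" by (simp add: roots_above_def)
      moreover have "det (char_matrix z) = 0" using z in_roots_above[OF dom] \<theta>(2) by blast
      then have "Re z \<le> s1" using s1(1)[of z] by (rule contrapos_pp) simp
      ultimately show "z \<in> {z. c < Re z \<and> Re z < \<sigma>}" using ac \<sigma> by auto
    qed
  qed
  obtain T B where TB: "\<And>z i j. c \<le> Re z \<Longrightarrow> Re z \<le> \<sigma> \<Longrightarrow> T \<le> \<bar>Im z\<bar> \<Longrightarrow> norm (matrix_inv (char_matrix z) $ i $ j) \<le> B"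
    using resolvent_bounded_strip[OF l(2,1) inv bdd fin ac(5), of \<sigma>] by blast
  have int: "integrable (renewal_measure i j) (\<lambda>x. exp (- \<sigma> * x))" for i j
    using s1(2)[of "complex_of_real \<sigma>"] \<sigma>(1) by simp
  define Q where "Q i j q C \<longleftrightarrow> (\<forall>t\<ge>0. \<forall>A\<in>{{0..t}, {0..<t}}. norm (complex_of_real (measure (renewal_measure i j) A)
        - exppoly ?P (root_order mu) q (complex_of_real t)) \<le> C * exp (\<theta> * t))" for i j q C
  have "\<exists>q C. Q i j q C" for i j
    unfolding Q_def
  proof (rule renewal_asymptotics[where R="\<lambda>z. matrix_inv (char_matrix z) $ i $ j", OF sets_renewal_measure renewal_measure_nonneg int _ ac(1,2,3) \<sigma>(2) P])
    show "(LINT x|renewal_measure i j. exp (- Complex \<sigma> y * complex_of_real x)) = matrix_inv (char_matrix (Complex \<sigma> y)) $ i $ j" for y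
      using s1(3)[of "Complex \<sigma> y" i j] \<sigma>(1) by simp
    show "(\<lambda>z. matrix_inv (char_matrix z) $ i $ j) holomorphic_on {z. a < Re z} - ?P"
    proof (rule holomorphic_on_subset[OF resolvent_holomorphic[OF dom]])
      show "{z. a < Re z} - ?P \<subseteq> {z. \<theta>\<^sub>0 < Re z} - roots_above mu \<theta>\<^sub>0"
        unfolding \<theta>(2) using ac(4) by auto
    qed
    show "norm (matrix_inv (char_matrix z) $ i $ j) \<le> B" if "c \<le> Re z" "Re z \<le> \<sigma>" "T \<le> \<bar>Im z\<bar>" for z
      by (rule TB[OF that])
    fix p assume "p \<in> ?P"
    then have p: "p \<in> roots_above mu \<theta>\<^sub>0" using \<theta>(2) by simp
    have "det (char_matrix (complex_of_real \<sigma>)) \<noteq> 0" "l < Re (complex_of_real \<sigma>)"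
      using s1(1)[of "complex_of_real \<sigma>"] \<sigma> \<theta>(1) l(1) by auto
    from root_order_pole[OF dom p this] obtain V where V: "1 \<le> root_order mu p" "open V" "p \<in> V"
      "\<forall>i j. \<exists>g. g holomorphic_on V \<and> (\<forall>z\<in>V - {p}. g z = (z - p) ^ root_order mu p * matrix_inv (char_matrix z) $ i $ j)"
      by (elim conjE exE)
    from V(4)[rule_format, of i j] obtain g where "g holomorphic_on V"
      "\<forall>z\<in>V - {p}. g z = (z - p) ^ root_order mu p * matrix_inv (char_matrix z) $ i $ j"
      by (elim conjE exE)
    with V(1-3) show "1 \<le> root_order mu p \<and> (\<exists>V g. open V \<and> p \<in> V \<and> g holomorphic_on V \<and>
        (\<forall>z\<in>V - {p}. g z = (z - p) ^ root_order mu p * matrix_inv (char_matrix z) $ i $ j))"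
      by (intro conjI exI[of _ V] exI[of _ g])
  qed
  then obtain q C where "\<And>i j. Q i j (q i j) (C i j)" by metis
  then have A: "integrable (renewal_measure i j) (\<lambda>x. exp (- \<sigma> * x)) \<and>
    (\<forall>t\<ge>0. \<forall>A\<in>{{0..t}, {0..<t}}. norm (complex_of_real (measure (renewal_measure i j) A)
        - exppoly ?P (root_order mu) (q i j) (complex_of_real t)) \<le> C i j * exp (\<theta> * t))" for i j
    using int unfolding Q_def by (rule conjI[rotated])
  show ?thesis
    by (rule exI[of _ \<sigma>], rule conjI, rule \<sigma>(3), rule exI[of _ q], rule exI[of _ C], intro allI, rule A)
qed

end

section \<open>Expansion of the mean\<close>

context cmj_process
begin

text \<open>\<open>w\<close> are the coefficients of the density of the exponential polynomial approximating the renewal function.\<close>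

proposition mean_expansion:
  fixes f :: "real \<Rightarrow> 'p \<Rightarrow> real" and Z :: "'p \<Rightarrow> real \<Rightarrow> 'a \<Rightarrow> real"
  assumes domain: "complex_of_real \<theta>\<^sub>0 \<in> interior (laplace_domain mu)"
    and rad: "cspectral_radius (\<chi> i j. complex_of_real (measure (mu i j) {0})) < 1"
    and inv: "\<And>\<eta>. invertible (char_matrix (Complex \<theta>\<^sub>0 \<eta>))"
    and bdd: "bdd_above (range (\<lambda>\<eta>. norm (matrix_inv (char_matrix (Complex \<theta>\<^sub>0 \<eta>)))))"
    and fin: "finite (roots_above mu \<theta>\<^sub>0)"
    and \<theta>: "\<theta> > \<theta>\<^sub>0" "roots_above mu \<theta>\<^sub>0 = roots_above mu \<theta>" "\<theta> > 0"
    and Z: "\<And>i t. t \<ge> 0 \<Longrightarrow> has_L1_sum M (contribution \<phi> \<T> S \<tau> i t) (Z i t)"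
    and f: "\<And>t j. f t j = (LINT \<omega>|M. \<phi> [] \<omega> t $ j)"
    and neg: "\<And>t j. t < 0 \<Longrightarrow> f t j = 0"
    and var: "\<And>j. (\<integral>\<^sup>+x\<in>{0..}. ennreal (exp (- \<theta> * x)) * total_variation (\<lambda>t. f t j) x \<partial>lborel) < \<infinity>"
  shows "\<exists>w C. \<forall>i. \<forall>t\<ge>0. norm (complex_of_real (LINT \<omega>|M. Z i t \<omega>)
      - (\<Sum>j\<in>UNIV. LINT x:{0..t}|lborel. complex_of_real (f x j) * exppoly (roots_above mu \<theta>) (root_order mu) (w i j) (complex_of_real (t - x))))
    \<le> C i * exp (\<theta> * t)"
    and "\<And>j. (\<lambda>t. f t j) \<in> borel_measurable borel"
    and "\<exists>C. \<forall>j. \<forall>x\<ge>0. \<bar>f x j\<bar> \<le> C j * exp (\<theta> * x)"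
proof -
  \<comment> \<open>One predicate for all properties, so that the decompositions can be chosen
    simultaneously for every j.\<close>
  define mdec where "mdec j g h \<longleftrightarrow> mono g \<and> mono h \<and> (\<forall>x<0. g x = 0 \<and> h x = 0) \<and> (\<forall>x. f x j = g x - h x) \<and>
    (\<integral>\<^sup>+x\<in>{0..}. ennreal (exp (- \<theta> * x)) * ennreal (g x) \<partial>lborel) < \<infinity> \<and>
    (\<integral>\<^sup>+x\<in>{0..}. ennreal (exp (- \<theta> * x)) * ennreal (h x) \<partial>lborel) < \<infinity>" for j and g h :: "real \<Rightarrow> real"
  have "\<exists>g h. mdec j g h" for j
    unfolding mdec_def by (rule monotone_decomposition[OF neg var])
  then obtain g h where gh: "\<And>j. mdec j (g j) (h j)" by metis
  have mono: "mono (g j)" "mono (h j)" and gneg: "\<And>x. x < 0 \<Longrightarrow> g j x = 0" "\<And>x. x < 0 \<Longrightarrow> h j x = 0"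
    and fgh: "\<And>x. f x j = g j x - h j x"
    and gi: "(\<integral>\<^sup>+x\<in>{0..}. ennreal (exp (- \<theta> * x)) * ennreal (g j x) \<partial>lborel) < \<infinity>"
    and hi: "(\<integral>\<^sup>+x\<in>{0..}. ennreal (exp (- \<theta> * x)) * ennreal (h j x) \<partial>lborel) < \<infinity>" for j
    using gh[of j] unfolding mdec_def by auto

  have g0: "0 \<le> g j x" "0 \<le> h j x" for j x
    using mono_nonneg[OF mono(1) gneg(1)] mono_nonneg[OF mono(2) gneg(2)] by blast+
  have gm[measurable]: "g j \<in> borel_measurable borel" "h j \<in> borel_measurable borel" for j
    by (rule borel_measurable_mono[OF mono(1)], rule borel_measurable_mono[OF mono(2)])
  have f_eq: "(\<lambda>t. f t j) = (\<lambda>t. g j t - h j t)" for j by (simp add: fgh)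
  show fm: "(\<lambda>t. f t j) \<in> borel_measurable borel" for j unfolding f_eq by measurable
  show "\<exists>C. \<forall>j. \<forall>x\<ge>0. \<bar>f x j\<bar> \<le> C j * exp (\<theta> * x)"
  proof -
    have "\<exists>C. \<forall>x\<ge>0. \<bar>f x j\<bar> \<le> C * exp (\<theta> * x)" for j
    proof -
      obtain C1 C2 where gC: "\<And>x. x \<ge> 0 \<Longrightarrow> g j x \<le> C1 * exp (\<theta> * x)" and hC: "\<And>x. x \<ge> 0 \<Longrightarrow> h j x \<le> C2 * exp (\<theta> * x)"
        using mono_exp_bound[OF mono(1) g0(1) \<theta>(3) gi] mono_exp_bound[OF mono(2) g0(2) \<theta>(3) hi] by blast
      have "\<bar>f x j\<bar> \<le> (C1 + C2) * exp (\<theta> * x)" if "x \<ge> 0" for x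
      proof -
        have "\<bar>f x j\<bar> \<le> g j x + h j x" using g0(1)[of j x] g0(2)[of j x] by (simp add: fgh)
        also have "\<dots> \<le> C1 * exp (\<theta> * x) + C2 * exp (\<theta> * x)" by (intro add_mono gC hC that)
        finally show ?thesis by (simp only: distrib_right)
      qed
      then show ?thesis by blast
    qed
    then show ?thesis by metis
  qed
  obtain \<sigma> q C where \<sigma>: "\<sigma> \<ge> 0" and int: "\<And>i j. integrable (renewal_measure i j) (\<lambda>x. exp (- \<sigma> * x))"
    and approx: "\<And>i j t A. t \<ge> 0 \<Longrightarrow> A \<in> {{0..t}, {0..<t}} \<Longrightarrow> norm (complex_of_real (measure (renewal_measure i j) A)
        - exppoly (roots_above mu \<theta>) (root_order mu) (q i j) (complex_of_real t)) \<le> C i j * exp (\<theta> * t)"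
    using renewal_measure_expansion[OF domain rad inv bdd fin \<theta>] by blast
  define w where "w i j = exppoly_deriv (root_order mu) (q i j)" for i j
  let ?W = "\<lambda>i j x. exppoly (roots_above mu \<theta>) (root_order mu) (w i j) (complex_of_real x)"
  note finU = laplace_finite_on_bounded[OF sets_renewal_measure int \<sigma>]
  note conv = renewal_monotone_convolution[OF sets_renewal_measure renewal_measure_nonneg \<theta>(3) finU
      laplace_finite_sigma_finite[OF sets_renewal_measure int \<sigma>] approx, folded w_def]
  define D where "D k i j B \<longleftrightarrow> (\<forall>t\<ge>0. norm ((LINT s|renewal_measure i j. indicator {0..t} s *\<^sub>R complex_of_real (k (t - s)))
      - (LBINT x. indicator {0..t} x *\<^sub>R (complex_of_real (k x) * ?W i j (t - x)))) \<le> B * exp (\<theta> * t))" for k i j B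
  have "\<exists>B. D (g j) i j B" for i j unfolding D_def by (rule conv[OF _ _ mono(1) gneg(1) gi])
  define B1 where "B1 i j = (SOME B. D (g j) i j B)" for i j
  have B1: "D (g j) i j (B1 i j)" for i j
    unfolding B1_def by (rule someI_ex) fact
  have "\<exists>B. D (h j) i j B" for i j unfolding D_def by (rule conv[OF _ _ mono(2) gneg(2) hi])
  define B2 where "B2 i j = (SOME B. D (h j) i j B)" for i j
  have B2: "D (h j) i j (B2 i j)" for i j
    unfolding B2_def by (rule someI_ex) fact
  have "norm (complex_of_real (LINT \<omega>|M. Z i t \<omega>)
      - (\<Sum>j\<in>UNIV. LINT x:{0..t}|lborel. complex_of_real (f x j) * ?W i j (t - x))) \<le> (\<Sum>j\<in>UNIV. B1 i j + B2 i j) * exp (\<theta> * t)"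
    if t: "t \<ge> 0" for i t
  proof -
    have ci: "integrable (renewal_measure i j) (\<lambda>s. indicator {0..t} s * k (t - s))"
      if k: "mono k" "\<And>x. x < 0 \<Longrightarrow> k x = 0" for k :: "real \<Rightarrow> real" and j
    proof (rule Bochner_Integration.integrable_bound)
      show "integrable (renewal_measure i j) (\<lambda>s. k t * indicator {..t} s)"
        using finU[of i j t] by (intro integrable_mult_right) (simp add: integrable_indicator_iff)
      show "(\<lambda>s. indicator {0..t} s * k (t - s)) \<in> borel_measurable (renewal_measure i j)"
        using borel_measurable_mono[OF k(1)] by (simp add: measurable_cong_sets[OF sets_renewal_measure refl])
      show "AE s in renewal_measure i j. norm (indicator {0..t} s * k (t - s)) \<le> norm (k t * indicator {..t} s)"
      proof (rule AE_I2)
        fix s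
        show "norm (indicator {0..t} s * k (t - s)) \<le> norm (k t * indicator {..t} s)"
        proof (cases "s \<in> {0..t}")
          case True
          then have "k (t - s) \<le> k t" by (intro monoD[OF k(1)]) simp
          then show ?thesis using True mono_nonneg[OF k, of "t - s"] by simp
        qed simp
      qed
    qed
    have li: "integrable lborel (\<lambda>x. indicator {0..t} x *\<^sub>R (complex_of_real (k x) * ?W i j (t - x)))"
      if k: "mono k" "\<And>x. x < 0 \<Longrightarrow> k x = 0" for k :: "real \<Rightarrow> real" and j
    proof (rule Bochner_Integration.integrable_bound)
      have c: "continuous_on UNIV (\<lambda>x. ?W i j (t - x))" unfolding exppoly_def by (intro continuous_intros)
      show "integrable lborel (\<lambda>x. k t *\<^sub>R (indicator {0..t} x *\<^sub>R ?W i j (t - x)))"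
        using borel_integrable_atLeastAtMost'[OF continuous_on_subset[OF c], of 0 t]
        by (intro integrable_scaleR_right) (simp add: set_integrable_def)
      have [measurable]: "k \<in> borel_measurable borel" "(\<lambda>x. ?W i j (t - x)) \<in> borel_measurable borel"
        by (rule borel_measurable_mono[OF k(1)], rule borel_measurable_continuous_onI[OF c])
      show "(\<lambda>x. indicator {0..t} x *\<^sub>R (complex_of_real (k x) * ?W i j (t - x))) \<in> borel_measurable lborel"
        by measurable
      show "AE x in lborel. norm (indicator {0..t} x *\<^sub>R (complex_of_real (k x) * ?W i j (t - x)))
          \<le> norm (k t *\<^sub>R (indicator {0..t} x *\<^sub>R ?W i j (t - x)))"
      proof (rule AE_I2)
        fix x
        show "norm (indicator {0..t} x *\<^sub>R (complex_of_real (k x) * ?W i j (t - x))) \<le> norm (k t *\<^sub>R (indicator {0..t} x *\<^sub>R ?W i j (t - x)))"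
        proof (cases "x \<in> {0..t}")
          case True
          then have "\<bar>k x\<bar> \<le> \<bar>k t\<bar>" using monoD[OF k(1), of x t] mono_nonneg[OF k, of x] by simp
          then show ?thesis using True by (simp add: norm_mult mult_right_mono)
        qed simp
      qed
    qed
    \<comment> \<open>The renewal measure lives on [0,\<infinity>) and f vanishes at negative times,
      so points s outside [0,t] contribute nothing.\<close>
    have shift: "AE s in renewal_measure i j. indicator {0..t} s * f (t - s) j = f (t - s) j" for j
      using renewal_measure_nonneg
    proof eventually_elim
      case (elim s)
      then show ?case by (cases "s \<le> t") (simp_all add: neg)
    qed
    have ms: "(\<lambda>s. f (t - s) j) \<in> borel_measurable (renewal_measure i j)"
      "(\<lambda>s. indicator {0..t} s * f (t - s) j) \<in> borel_measurable (renewal_measure i j)" for j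
      using fm[of j] by (simp_all add: measurable_cong_sets[OF sets_renewal_measure refl])
    have fi: "integrable (renewal_measure i j) (\<lambda>s. indicator {0..t} s * f (t - s) j)" for j
      unfolding fgh right_diff_distrib
      by (intro Bochner_Integration.integrable_diff ci mono gneg)
    then have "integrable (renewal_measure i j) (\<lambda>s. f (t - s) j)" for j
      using integrable_cong_AE[OF ms(2,1) shift] by blast
    then have "(LINT \<omega>|M. Z i t \<omega>) = (\<Sum>j\<in>UNIV. LINT s|renewal_measure i j. f (t - s) j)"
      by (rule expectation_process[OF Z[OF t] f fm])
    also have "\<dots> = (\<Sum>j\<in>UNIV. LINT s|renewal_measure i j. indicator {0..t} s * f (t - s) j)"
      by (intro sum.cong refl integral_cong_AE[OF ms(2,1) shift, symmetric])
    also have "\<dots> = (\<Sum>j\<in>UNIV. (LINT s|renewal_measure i j. indicator {0..t} s * g j (t - s)) - (LINT s|renewal_measure i j. indicator {0..t} s * h j (t - s)))"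
      unfolding fgh right_diff_distrib
      by (intro sum.cong refl Bochner_Integration.integral_diff ci mono gneg)
    finally have EZ: "complex_of_real (LINT \<omega>|M. Z i t \<omega>) = (\<Sum>j\<in>UNIV.
        (LINT s|renewal_measure i j. indicator {0..t} s *\<^sub>R complex_of_real (g j (t - s)))
        - (LINT s|renewal_measure i j. indicator {0..t} s *\<^sub>R complex_of_real (h j (t - s))))"
      by (simp add: scaleR_conv_of_real flip: of_real_mult)
    have EI: "(LINT x:{0..t}|lborel. complex_of_real (f x j) * ?W i j (t - x)) =
        (LBINT x. indicator {0..t} x *\<^sub>R (complex_of_real (g j x) * ?W i j (t - x)))
        - (LBINT x. indicator {0..t} x *\<^sub>R (complex_of_real (h j x) * ?W i j (t - x)))" for j
    proof -
      have "(LINT x:{0..t}|lborel. complex_of_real (f x j) * ?W i j (t - x)) = (LBINT x.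
        indicator {0..t} x *\<^sub>R (complex_of_real (g j x) * ?W i j (t - x)) - indicator {0..t} x *\<^sub>R (complex_of_real (h j x) * ?W i j (t - x)))"
        unfolding set_lebesgue_integral_def fgh
        by (intro Bochner_Integration.integral_cong refl) (simp add: algebra_simps scaleR_diff_right)
      then show ?thesis by (simp only: Bochner_Integration.integral_diff[OF li[OF mono(1) gneg(1)] li[OF mono(2) gneg(2)]])
    qed
    define d1 where "d1 j = (LINT s|renewal_measure i j. indicator {0..t} s *\<^sub>R complex_of_real (g j (t - s)))
      - (LBINT x. indicator {0..t} x *\<^sub>R (complex_of_real (g j x) * ?W i j (t - x)))" for j
    define d2 where "d2 j = (LINT s|renewal_measure i j. indicator {0..t} s *\<^sub>R complex_of_real (h j (t - s)))
      - (LBINT x. indicator {0..t} x *\<^sub>R (complex_of_real (h j x) * ?W i j (t - x)))" for j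
    have d: "norm (d1 j) \<le> B1 i j * exp (\<theta> * t)" "norm (d2 j) \<le> B2 i j * exp (\<theta> * t)" for j
      using B1[of j i] B2[of j i] t unfolding D_def d1_def d2_def by blast+
    have "complex_of_real (LINT \<omega>|M. Z i t \<omega>) - (\<Sum>j\<in>UNIV. LINT x:{0..t}|lborel. complex_of_real (f x j) * ?W i j (t - x))
      = (\<Sum>j\<in>UNIV. d1 j - d2 j)"
      unfolding EZ EI sum_subtractf[symmetric] d1_def d2_def by (intro sum.cong refl) simp
    also have "norm \<dots> \<le> (\<Sum>j\<in>UNIV. (B1 i j + B2 i j) * exp (\<theta> * t))"
    proof (rule sum_norm_le)
      fix j
      show "norm (d1 j - d2 j) \<le> (B1 i j + B2 i j) * exp (\<theta> * t)"
        using order_trans[OF norm_triangle_ineq4 add_mono[OF d(1)[of j] d(2)[of j]]] by (simp add: distrib_right)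
    qed
    finally show ?thesis by (simp only: sum_distrib_right)
  qed
  then show "\<exists>w C. \<forall>i. \<forall>t\<ge>0. norm (complex_of_real (LINT \<omega>|M. Z i t \<omega>)
      - (\<Sum>j\<in>UNIV. LINT x:{0..t}|lborel. complex_of_real (f x j) * exppoly (roots_above mu \<theta>) (root_order mu) (w i j) (complex_of_real (t - x))))
    \<le> C i * exp (\<theta> * t)"
    by (intro exI[of _ w] exI[of _ "\<lambda>i. \<Sum>j\<in>UNIV. B1 i j + B2 i j"]) blast
qed

end

text \<open>exp(p (t - x)) splits into exp(p t), which leaves the integral, and exp(-p x). The
  coefficients w p k thereby turn into matrix entries of the first expansion; the exponential bound
  on f provides integrability on [0,t].\<close>

lemma exppoly_convolution_expand:
  fixes f :: "real \<Rightarrow> real"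
  assumes fm[measurable]: "f \<in> borel_measurable borel" and fb: "\<And>x. x \<ge> 0 \<Longrightarrow> \<bar>f x\<bar> \<le> C * exp (\<theta> * x)" and "\<theta> \<ge> 0"
  shows "(LINT x:{0..t}|lborel. complex_of_real (f x) * exppoly P K w (complex_of_real (t - x)))
    = (\<Sum>p\<in>P. exp (p * complex_of_real t) * (\<Sum>k<K p. w p k *
        (LINT x:{0..t}|lborel. complex_of_real (f x * (t - x) ^ k) * exp (- p * complex_of_real x))))"
proof -
  let ?h = "\<lambda>p k x. indicator {0..t} x *\<^sub>R (complex_of_real (f x * (t - x) ^ k) * exp (- p * complex_of_real x))"
  have hi: "integrable lborel (?h p k)" for p k
  proof (rule Bochner_Integration.integrable_bound)
    have c: "continuous_on UNIV (\<lambda>x. (t - x) ^ k *\<^sub>R exp (- p * complex_of_real x))" by (intro continuous_intros)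
    show "integrable lborel (\<lambda>x. (C * exp (\<theta> * t)) *\<^sub>R (indicator {0..t} x *\<^sub>R ((t - x) ^ k *\<^sub>R exp (- p * complex_of_real x))))"
      using borel_integrable_atLeastAtMost'[OF continuous_on_subset[OF c], of 0 t]
      by (intro integrable_scaleR_right) (simp add: set_integrable_def)
    show "?h p k \<in> borel_measurable lborel" by measurable
    show "AE x in lborel. norm (?h p k x) \<le> norm ((C * exp (\<theta> * t)) *\<^sub>R (indicator {0..t} x *\<^sub>R ((t - x) ^ k *\<^sub>R exp (- p * complex_of_real x))))"
    proof (rule AE_I2)
      fix x :: real
      show "norm (?h p k x) \<le> norm ((C * exp (\<theta> * t)) *\<^sub>R (indicator {0..t} x *\<^sub>R ((t - x) ^ k *\<^sub>R exp (- p * complex_of_real x))))"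
      proof (cases "x \<in> {0..t}")
        case True
        have C0: "C \<ge> 0" using fb[of 0] by simp
        have "\<bar>f x\<bar> \<le> C * exp (\<theta> * x)" using True by (intro fb) simp
        also have "\<dots> \<le> C * exp (\<theta> * t)"
          using True \<open>\<theta> \<ge> 0\<close> C0 by (intro mult_left_mono) (auto intro: mult_left_mono)
        finally have "\<bar>f x\<bar> \<le> C * exp (\<theta> * t)" .
        moreover have "norm (?h p k x) = \<bar>f x\<bar> * (\<bar>t - x\<bar> ^ k * exp (- (Re p * x)))"
          using True by (simp only: norm_mult norm_scaleR norm_of_real abs_mult power_abs) simp
        moreover have "norm ((C * exp (\<theta> * t)) *\<^sub>R (indicator {0..t} x *\<^sub>R ((t - x) ^ k *\<^sub>R exp (- p * complex_of_real x))))
          = C * exp (\<theta> * t) * (\<bar>t - x\<bar> ^ k * exp (- (Re p * x)))"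
          using True C0 by (simp add: power_abs)
        ultimately show ?thesis by (simp only:) (intro mult_right_mono, auto)
      qed simp
    qed
  qed
  have e: "indicator {0..t} x *\<^sub>R (complex_of_real (f x) * exppoly P K w (complex_of_real (t - x)))
    = (\<Sum>p\<in>P. exp (p * complex_of_real t) * (\<Sum>k<K p. w p k * ?h p k x))" for x
  proof -
    have "exp (p * complex_of_real (t - x)) = exp (p * complex_of_real t) * exp (- p * complex_of_real x)" for p
      by (simp add: exp_add[symmetric] algebra_simps)
    then show ?thesis
      unfolding exppoly_def
      by (simp add: sum_distrib_left scaleR_sum_right mult_ac)
  qed
  have "(LINT x:{0..t}|lborel. complex_of_real (f x) * exppoly P K w (complex_of_real (t - x)))
    = (LBINT x. (\<Sum>p\<in>P. exp (p * complex_of_real t) * (\<Sum>k<K p. w p k * ?h p k x)))"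
    unfolding set_lebesgue_integral_def e ..
  also have "\<dots> = (\<Sum>p\<in>P. LBINT x. exp (p * complex_of_real t) * (\<Sum>k<K p. w p k * ?h p k x))"
    by (rule Bochner_Integration.integral_sum) (intro integrable_mult_right Bochner_Integration.integrable_sum hi)
  also have "\<dots> = (\<Sum>p\<in>P. exp (p * complex_of_real t) * (\<Sum>k<K p. w p k * (LBINT x. ?h p k x)))"
    by (intro sum.cong refl) (simp only: integral_mult_right_zero Bochner_Integration.integral_sum[OF integrable_mult_right[OF hi]])
  finally show ?thesis unfolding set_lebesgue_integral_def .
qed

lemma bigo_exp_of_bound:
  fixes h :: "real \<Rightarrow> complex"
  assumes "\<And>t. t \<ge> 0 \<Longrightarrow> norm (h t) \<le> C * exp (a * t)" "a \<le> b"
  shows "h \<in> O[at_top](\<lambda>t. complex_of_real (exp (b * t)))"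
proof (rule bigoI[of _ "\<bar>C\<bar>"])
  show "\<forall>\<^sub>F t in at_top. norm (h t) \<le> \<bar>C\<bar> * norm (complex_of_real (exp (b * t)))"
    using eventually_ge_at_top[of 0]
  proof eventually_elim
    case (elim t)
    have "norm (h t) \<le> C * exp (a * t)" by (rule assms(1)[OF elim])
    also have "\<dots> \<le> \<bar>C\<bar> * exp (b * t)"
      using elim assms(2) by (intro mult_mono) (auto intro: mult_right_mono)
    finally show ?case by simp
  qed
qed

text \<open>Exchange of summation over the triangle m \<le> k < K: what all k contribute to the
  power t^m is collected in one coefficient.\<close>

lemma coefficient_collect:
  fixes B :: "nat \<Rightarrow> complex ^ 'p ^ 'p" and d :: "'p::finite \<Rightarrow> nat \<Rightarrow> nat \<Rightarrow> complex"
  shows "(\<Sum>m<K. complex_of_real (t ^ m) * (\<Sum>j\<in>UNIV. \<Sum>k\<in>{m..<K}. B k $ i $ j * d j k m))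
    = (\<Sum>j\<in>UNIV. \<Sum>k<K. B k $ i $ j * (\<Sum>m\<le>k. complex_of_real (t ^ m) * d j k m))"
proof -
  have "(\<Sum>m<K. complex_of_real (t ^ m) * (\<Sum>j\<in>UNIV. \<Sum>k\<in>{m..<K}. B k $ i $ j * d j k m))
    = (\<Sum>m<K. \<Sum>j\<in>UNIV. \<Sum>k\<in>{m..<K}. B k $ i $ j * (complex_of_real (t ^ m) * d j k m))"
    by (simp add: sum_distrib_left mult_ac)
  also have "\<dots> = (\<Sum>j\<in>UNIV. \<Sum>m<K. \<Sum>k\<in>{m..<K}. B k $ i $ j * (complex_of_real (t ^ m) * d j k m))"
    by (rule sum.swap)
  also have "\<dots> = (\<Sum>j\<in>UNIV. \<Sum>k<K. \<Sum>m\<le>k. B k $ i $ j * (complex_of_real (t ^ m) * d j k m))"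
  proof (rule sum.cong[OF refl])
    fix j
    show "(\<Sum>m<K. \<Sum>k\<in>{m..<K}. B k $ i $ j * (complex_of_real (t ^ m) * d j k m))
      = (\<Sum>k<K. \<Sum>m\<le>k. B k $ i $ j * (complex_of_real (t ^ m) * d j k m))"
      unfolding sum.Sigma[OF finite_lessThan ballI[OF finite_atLeastLessThan]] sum.Sigma[OF finite_lessThan ballI[OF finite_atMost]]
      by (rule sum.reindex_bij_witness[of _ "\<lambda>(k, m). (m, k)" "\<lambda>(m, k). (k, m)"]) auto
  qed
  finally show ?thesis by (simp add: sum_distrib_left)
qed

theorem theorem4p2:
  fixes M :: "'a measure"
    and \<xi> :: "nat list \<Rightarrow> 'a \<Rightarrow> 'p::finite \<Rightarrow> 'p \<Rightarrow> real measure"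
    and \<zeta> :: "nat list \<Rightarrow> 'a \<Rightarrow> 'p \<Rightarrow> ennreal"
    and \<phi> :: "nat list \<Rightarrow> 'a \<Rightarrow> real \<Rightarrow> real ^ 'p"
    and \<T> :: "'p \<Rightarrow> 'a \<Rightarrow> nat list set"
    and S :: "'p \<Rightarrow> nat list \<Rightarrow> 'a \<Rightarrow> real"
    and \<tau> :: "'p \<Rightarrow> nat list \<Rightarrow> 'a \<Rightarrow> 'p"
    and Z :: "'p \<Rightarrow> real \<Rightarrow> 'a \<Rightarrow> real"
    and \<mu> :: "'p \<Rightarrow> 'p \<Rightarrow> real measure"
    and f F :: "real \<Rightarrow> real ^ 'p"
    and \<theta>\<^sub>0 \<theta> :: real
  defines "\<mu> \<equiv> intensity M (\<xi> [])"
    and "f \<equiv> \<lambda>t. \<chi> i. LINT \<omega>|M. \<phi> [] \<omega> t $ i"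
    and "F \<equiv> \<lambda>t. \<chi> i. LINT \<omega>|M. Z i t \<omega>"
  assumes process: "cmj_process M \<xi> \<zeta> \<phi> \<T> S \<tau>"
    and Z: "\<And>i t. t \<ge> 0 \<Longrightarrow> has_L1_sum M (contribution \<phi> \<T> S \<tau> i t) (Z i t)"
    and locally_finite: "\<And>i j t. emeasure (\<mu> i j) {0..t} < \<infinity>"
    and non_lattice: "non_lattice \<mu>"
    and domain: "complex_of_real \<theta>\<^sub>0 \<in> interior (laplace_domain \<mu>)"
    and spectral_radius: "cspectral_radius (\<chi> i j. complex_of_real (measure (\<mu> i j) {0})) < 1"
    and inverses: "\<And>\<eta>. invertible (mat 1 - laplace \<mu> (Complex \<theta>\<^sub>0 \<eta>))"
    and inverses_bounded:
      "bdd_above (range (\<lambda>\<eta>. norm (matrix_inv (mat 1 - laplace \<mu> (Complex \<theta>\<^sub>0 \<eta>)))))"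
    and finite_roots: "finite (roots_above \<mu> \<theta>\<^sub>0)"
    and f_finite: "\<And>i t. integrable M (\<lambda>\<omega>. \<phi> [] \<omega> t $ i)"
    and f_negative: "\<And>t. t < 0 \<Longrightarrow> f t = 0"
    and f_right_continuous: "\<And>t. continuous (at_right t) f"
    and f_left_limits: "\<And>t. \<exists>l. (f \<longlongrightarrow> l) (at_left t)"
    and \<theta>: "\<theta> > \<theta>\<^sub>0" "roots_above \<mu> \<theta>\<^sub>0 = roots_above \<mu> \<theta>"
    and variation:
      "\<And>i. (\<integral>\<^sup>+x\<in>{0..}. ennreal (exp (- \<theta> * x)) * total_variation (\<lambda>t. f t $ i) x \<partial>lborel) < \<infinity>"
  shows "\<exists>(B :: complex \<Rightarrow> nat \<Rightarrow> complex ^ 'p ^ 'p) (b :: complex \<Rightarrow> nat \<Rightarrow> complex ^ 'p).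
    (\<forall>i. (\<lambda>t. complex_of_real (F t $ i) -
            (\<Sum>r\<in>roots_above \<mu> \<theta>. exp (r * complex_of_real t) *
               (\<Sum>k<root_order \<mu> r.
                  (B r k *v (\<chi> j. LINT x:{0..t}|lborel.
                     complex_of_real (f x $ j * (t - x) ^ k) * exp (- r * complex_of_real x))) $ i)))
          \<in> O[at_top](\<lambda>t. complex_of_real (exp (\<theta> * t)))) \<and>
    (\<forall>\<epsilon>>0. \<forall>i. (\<lambda>t. complex_of_real (F t $ i) -
            (\<Sum>r\<in>roots_above \<mu> \<theta>. exp (r * complex_of_real t) *
               (\<Sum>k<root_order \<mu> r. complex_of_real (t ^ k) * b r k $ i)))
          \<in> O[at_top](\<lambda>t. complex_of_real (exp ((\<theta> + \<epsilon>) * t))))"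
proof -
  interpret cmj_process M \<xi> \<zeta> \<phi> \<T> S \<tau> by (rule process)
  define fc where "fc t j = f t $ j" for t j
  have fc: "fc t j = (LINT \<omega>|M. \<phi> [] \<omega> t $ j)" for t j by (simp add: fc_def f_def)
  have fneg: "fc t j = 0" if "t < 0" for t j using f_negative[OF that] by (simp add: fc_def)
  have var: "(\<integral>\<^sup>+x\<in>{0..}. ennreal (exp (- \<theta> * x)) * total_variation (\<lambda>t. fc t j) x \<partial>lborel) < \<infinity>" for j
    using variation[of j] by (simp only: fc_def)
  have F: "F t $ i = (LINT \<omega>|M. Z i t \<omega>)" for t i by (simp add: F_def)
  let ?K = "root_order \<mu>" and ?P = "roots_above \<mu> \<theta>"
  let ?I = "\<lambda>t r k j. LINT x:{0..t}|lborel. complex_of_real (fc x j * (t - x) ^ k) * exp (- r * complex_of_real x)"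
  show ?thesis
  proof (cases "\<theta> > 0")
    case True
    note assms' = domain[unfolded \<mu>_def] spectral_radius[unfolded \<mu>_def] inverses[unfolded \<mu>_def]
      inverses_bounded[unfolded \<mu>_def] finite_roots[unfolded \<mu>_def] \<theta>(1) \<theta>(2)[unfolded \<mu>_def] True Z fc fneg var
    obtain w C where wC: "\<And>i t. t \<ge> 0 \<Longrightarrow> norm (complex_of_real (LINT \<omega>|M. Z i t \<omega>)
        - (\<Sum>j\<in>UNIV. LINT x:{0..t}|lborel. complex_of_real (fc x j) * exppoly ?P ?K (w i j) (complex_of_real (t - x))))
        \<le> C i * exp (\<theta> * t)"
      using mean_expansion(1)[OF assms'] unfolding \<mu>_def by blast
    have fm: "(\<lambda>t. fc t j) \<in> borel_measurable borel" for j
      by (rule mean_expansion(2)[OF assms'])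
    obtain A where A: "\<And>j x. x \<ge> 0 \<Longrightarrow> \<bar>fc x j\<bar> \<le> A j * exp (\<theta> * x)"
      using mean_expansion(3)[OF assms'] by blast
    \<comment> \<open>Row i belongs to the type of the ancestor and column j to the type of the
      individuals counted, whose mean characteristic is the j-th component of f.\<close>
    define B :: "complex \<Rightarrow> nat \<Rightarrow> complex ^ 'p ^ 'p" where "B r k = (\<chi> i j. w i j r k)" for r k
    define Dt where "Dt r k j d E \<longleftrightarrow> (\<forall>t\<ge>0. norm (exp (r * complex_of_real t) * ?I t r k j
      - exp (r * complex_of_real t) * (\<Sum>m\<le>k. complex_of_real (t ^ m) * d m)) \<le> E * exp (\<theta> * t))" for r k j d E
    have ex: "\<exists>d E. Dt r k j d E" if "r \<in> ?P" for r k j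
      unfolding Dt_def
      by (rule truncated_convolution_asymptotics[OF fm A]) (use that in \<open>simp_all add: roots_above_def\<close>)
    \<comment> \<open>Witnesses exist only for roots r in \<open>?P\<close>, while \<open>d\<close>
      and \<open>E\<close> have to be total functions; hence the explicit choice.\<close>
    define d where "d r k j = (SOME d. \<exists>E. Dt r k j d E)" for r k j
    define E where "E r k j = (SOME E. Dt r k j (d r k j) E)" for r k j
    have dE: "Dt r k j (d r k j) (E r k j)" if "r \<in> ?P" for r k j
      unfolding E_def by (rule someI_ex) (unfold d_def, rule someI_ex[OF ex[OF that]])
    \<comment> \<open>By the binomial expansion of (t - x)^k, the power t^m receives a term from
      every k \<ge> m.\<close>
    define b :: "complex \<Rightarrow> nat \<Rightarrow> complex ^ 'p" where
      "b r m = (\<chi> i. \<Sum>j\<in>UNIV. \<Sum>k\<in>{m..<?K r}. B r k $ i $ j * d r k j m)" for r m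
    let ?S1 = "\<lambda>i t. \<Sum>r\<in>?P. exp (r * complex_of_real t) * (\<Sum>k<?K r. (B r k *v (\<chi> j. ?I t r k j)) $ i)"
    let ?S2 = "\<lambda>i t. \<Sum>r\<in>?P. exp (r * complex_of_real t) * (\<Sum>k<?K r. complex_of_real (t ^ k) * b r k $ i)"
    have S1: "?S1 i t = (\<Sum>j\<in>UNIV. LINT x:{0..t}|lborel. complex_of_real (fc x j) * exppoly ?P ?K (w i j) (complex_of_real (t - x)))" for i t
    proof -
      have "?S1 i t = (\<Sum>r\<in>?P. \<Sum>j\<in>UNIV. exp (r * complex_of_real t) * (\<Sum>k<?K r. w i j r k * ?I t r k j))"
      proof (rule sum.cong[OF refl])
        fix r
        have "(\<Sum>k<?K r. (B r k *v (\<chi> j. ?I t r k j)) $ i) = (\<Sum>j\<in>UNIV. \<Sum>k<?K r. w i j r k * ?I t r k j)"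
          unfolding matrix_vector_mult_def B_def by (simp only: vec_lambda_beta) (rule sum.swap)
        then show "exp (r * complex_of_real t) * (\<Sum>k<?K r. (B r k *v (\<chi> j. ?I t r k j)) $ i)
          = (\<Sum>j\<in>UNIV. exp (r * complex_of_real t) * (\<Sum>k<?K r. w i j r k * ?I t r k j))"
          by (simp only: sum_distrib_left)
      qed
      also have "\<dots> = (\<Sum>j\<in>UNIV. \<Sum>r\<in>?P. exp (r * complex_of_real t) * (\<Sum>k<?K r. w i j r k * ?I t r k j))"
        by (rule sum.swap)
      also have "\<dots> = (\<Sum>j\<in>UNIV. LINT x:{0..t}|lborel. complex_of_real (fc x j) * exppoly ?P ?K (w i j) (complex_of_real (t - x)))"
        by (intro sum.cong refl exppoly_convolution_expand[OF fm A less_imp_le[OF True], symmetric])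
      finally show ?thesis .
    qed
    have bound1: "norm (complex_of_real (F t $ i) - ?S1 i t) \<le> C i * exp (\<theta> * t)" if "t \<ge> 0" for i t
      unfolding S1 F by (rule wC[OF that])
    have bound12: "norm (?S1 i t - ?S2 i t) \<le> (\<Sum>r\<in>?P. \<Sum>j\<in>UNIV. \<Sum>k<?K r. norm (B r k $ i $ j) * E r k j) * exp (\<theta> * t)" if t: "t \<ge> 0" for i t
    proof -
      let ?G = "\<lambda>r k j. exp (r * complex_of_real t) * ?I t r k j
        - exp (r * complex_of_real t) * (\<Sum>m\<le>k. complex_of_real (t ^ m) * d r k j m)"
      have "?S1 i t - ?S2 i t = (\<Sum>r\<in>?P. \<Sum>j\<in>UNIV. \<Sum>k<?K r. B r k $ i $ j * ?G r k j)"
        unfolding sum_subtractf[symmetric]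
      proof (rule sum.cong[OF refl])
        fix r
        have 1: "(\<Sum>k<?K r. (B r k *v (\<chi> j. ?I t r k j)) $ i) = (\<Sum>j\<in>UNIV. \<Sum>k<?K r. B r k $ i $ j * ?I t r k j)"
          unfolding matrix_vector_mult_def by (simp only: vec_lambda_beta) (rule sum.swap)
        have 2: "(\<Sum>k<?K r. complex_of_real (t ^ k) * b r k $ i) = (\<Sum>j\<in>UNIV. \<Sum>k<?K r. B r k $ i $ j * (\<Sum>m\<le>k. complex_of_real (t ^ m) * d r k j m))"
          unfolding b_def vec_lambda_beta by (rule coefficient_collect[where B="B r" and d="\<lambda>j k. d r k j"])
        have 3: "e * (\<Sum>j\<in>UNIV. \<Sum>k<n. a j k * X j k) - e * (\<Sum>j\<in>UNIV. \<Sum>k<n. a j k * Y j k)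
          = (\<Sum>j\<in>UNIV. \<Sum>k<n. a j k * (e * X j k - e * Y j k))" for e and n :: nat and a X Y :: "'p \<Rightarrow> nat \<Rightarrow> complex"
          by (simp add: sum_distrib_left sum_subtractf right_diff_distrib mult.left_commute)
        show "exp (r * complex_of_real t) * (\<Sum>k<?K r. (B r k *v (\<chi> j. ?I t r k j)) $ i)
          - exp (r * complex_of_real t) * (\<Sum>k<?K r. complex_of_real (t ^ k) * b r k $ i)
          = (\<Sum>j\<in>UNIV. \<Sum>k<?K r. B r k $ i $ j * ?G r k j)"
          unfolding 1 2 by (rule 3)
      qed
      also have "norm \<dots> \<le> (\<Sum>r\<in>?P. \<Sum>j\<in>UNIV. \<Sum>k<?K r. norm (B r k $ i $ j) * E r k j * exp (\<theta> * t))"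
      proof (intro sum_norm_le)
        fix r j k assume "r \<in> ?P"
        then have "norm (?G r k j) \<le> E r k j * exp (\<theta> * t)" using dE[of r k j] t unfolding Dt_def by blast
        then show "norm (B r k $ i $ j * ?G r k j) \<le> norm (B r k $ i $ j) * E r k j * exp (\<theta> * t)"
          unfolding norm_mult mult.assoc by (rule mult_left_mono) simp
      qed
      finally show ?thesis by (simp only: sum_distrib_right)
    qed
    have bound2: "norm (complex_of_real (F t $ i) - ?S2 i t)
        \<le> (C i + (\<Sum>r\<in>?P. \<Sum>j\<in>UNIV. \<Sum>k<?K r. norm (B r k $ i $ j) * E r k j)) * exp (\<theta> * t)" if t: "t \<ge> 0" for i t
      using norm_diff_triangle_le[OF bound1[OF t] bound12[OF t]] by (simp only: distrib_right)
    have "\<forall>i. (\<lambda>t. complex_of_real (F t $ i) - ?S1 i t) \<in> O[at_top](\<lambda>t. complex_of_real (exp (\<theta> * t)))"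
      by (intro allI bigo_exp_of_bound[OF bound1]) simp_all
    moreover have "\<forall>\<epsilon>>0. \<forall>i. (\<lambda>t. complex_of_real (F t $ i) - ?S2 i t) \<in> O[at_top](\<lambda>t. complex_of_real (exp ((\<theta> + \<epsilon>) * t)))"
      by (intro allI impI bigo_exp_of_bound[OF bound2]) simp_all
    ultimately show ?thesis unfolding fc_def by blast
  next
    case False
    \<comment> \<open>As \<open>Vf\<close> is nondecreasing, the integral of \<open>e\<^sup>-\<^sup>\<theta>\<^sup>x Vf(x)\<close> can only converge if \<open>Vf = 0\<close>.\<close>
    have f0: "fc x j = 0" for x j
    proof -
      obtain g h where gh: "mono g" "mono h" "\<forall>x<0. g x = 0 \<and> h x = 0" "\<forall>x. fc x j = g x - h x"
        "(\<integral>\<^sup>+x\<in>{0..}. ennreal (exp (- \<theta> * x)) * ennreal (g x) \<partial>lborel) < \<infinity>"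
        "(\<integral>\<^sup>+x\<in>{0..}. ennreal (exp (- \<theta> * x)) * ennreal (h x) \<partial>lborel) < \<infinity>"
        using monotone_decomposition[OF fneg var] by blast

      have "g x = 0"
        by (rule mono_exp_integrable_imp_0[OF gh(1) mono_nonneg[OF gh(1)] _ gh(5)]) (use gh(3) False in auto)
      moreover have "h x = 0"
        by (rule mono_exp_integrable_imp_0[OF gh(2) mono_nonneg[OF gh(2)] _ gh(6)]) (use gh(3) False in auto)
      ultimately show ?thesis using gh(4) by simp
    qed
    \<comment> \<open>The mean is an integral of f against the renewal measure and vanishes with f,
      so zero coefficients serve in both expansions.\<close>
    have F0: "F t $ i = 0" if "t \<ge> 0" for t i
    proof -
      have "(LINT \<omega>|M. Z i t \<omega>) = (\<Sum>j\<in>UNIV. LINT s|renewal_measure i j. fc (t - s) j)"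
        by (rule expectation_process[OF Z[OF that] fc]) (simp_all add: f0)
      then show ?thesis by (simp add: F f0)
    qed
    have z: "(\<lambda>t. complex_of_real (F t $ i) - 0) \<in> O[at_top](\<lambda>t. complex_of_real (exp (c * t)))" for i c
      by (rule bigo_exp_of_bound[of _ 0 c]) (simp_all add: F0)
    show ?thesis
    proof (intro exI conjI allI impI)
      show "(\<lambda>t. complex_of_real (F t $ i) -
            (\<Sum>r\<in>?P. exp (r * complex_of_real t) *
               (\<Sum>k<?K r.
                  ((\<lambda>_ _. 0 :: complex ^ 'p ^ 'p) r k *v (\<chi> j. LINT x:{0..t}|lborel.
                     complex_of_real (f x $ j * (t - x) ^ k) * exp (- r * complex_of_real x))) $ i)))
          \<in> O[at_top](\<lambda>t. complex_of_real (exp (\<theta> * t)))" for i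
        using z[of i \<theta>] by simp
      show "(\<lambda>t. complex_of_real (F t $ i) -
            (\<Sum>r\<in>?P. exp (r * complex_of_real t) *
               (\<Sum>k<?K r. complex_of_real (t ^ k) * (\<lambda>_ _. 0 :: complex ^ 'p) r k $ i)))
          \<in> O[at_top](\<lambda>t. complex_of_real (exp ((\<theta> + \<epsilon>) * t)))" for \<epsilon> i
        using z[of i "\<theta> + \<epsilon>"] by simp
    qed
  qed
qed

end
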